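(* (1) Let $r\in\mathbb N_{>0}$, $s\in\mathbb S$ and $(\eta,P,z,\xi)\in\mathcal P_{r,s}$. The lattice $L_{r,s}(\eta,P,z,\xi)$ is isomorphic to the discrete group $\mathrm{Osc}^r(B,l)$ for $$B=P^{-1}e^{sA}P=:\begin{pmatrix}a&b\\c&d\end{pmatrix},\qquad l=rB^{-1}\xi+\frac r2\begin{pmatrix}-bd\\ac\end{pmatrix}.$$ In particular, every lattice in $\mathrm{Osc}_{1,0}$ is isomorphic to a discrete split oscillator group. (2) For every discrete split oscillator group there is a lattice in $\mathrm{Osc}_{1,0}$ that is isomorphic to this group. More exactly, given a discrete split oscillator group $\mathrm{Osc}^r(B,l)$ with $B=\begin{pmatrix}a&b\\c&d\end{pmatrix}$, let $s>0$ be defined by $e^s+e^{-s}=\operatorname{tr}B$, choose $P\in\mathrm{GL}(2,\mathbb R)$ such that $B=P^{-1}e^{sA}P$, and put $$\xi:=\frac1rBl-\frac12B\begin{pmatrix}-bd\\ac\end{pmatrix}.$$ Then $L_{r,s}(0,P,0,\xi)$ is a lattice in $\mathrm{Osc}_{1,0}$ isomorphic to $\mathrm{Osc}^r(B,l)$.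
   Context: Let $\omega(\xi,\xi')=xy'-x'y$ for $\xi=(x,y),\xi'=(x',y')\in\mathbb R^2$. The Heisenberg group is $H=\mathbb R\times\mathbb R^2$ with $(z,\xi)(z',\xi')=(z+z'+\tfrac12\omega(\xi,\xi'),\xi+\xi')$. For $P\in\mathrm{GL}(2,\mathbb R)$, $\eta\in\mathbb R^2$ put $\bar F_P(z,\xi)=(\det(P)z,P\xi)$ and $\bar F_\eta(z,\xi)=(z+\omega(\eta,\xi),\xi)$; these are automorphisms of $H$. Let $A=\begin{pmatrix}0&1\\1&0\end{pmatrix}$. The split oscillator group is $\mathrm{Osc}_{1,0}=H\rtimes\mathbb R$, $(z,\xi,t)(z',\xi',t')=(z+z'+\tfrac12\omega(\xi,e^{tA}\xi'),\xi+e^{tA}\xi',t+t')$. For $\eta\in\mathbb R^2$, $F_\eta$ is the automorphism of $\mathrm{Osc}_{1,0}$ given by conjugation by $(0,\eta,0)$. A lattice is a discrete subgroup $L$ with $L\backslash\mathrm{Osc}_{1,0}$ of finite invariant measure. For $r\in\mathbb N_{>0}$, $\Gamma_r=\{(z,\xi)\in H\mid\xi=(\xi_1,\xi_2)\in\mathbb Z^2,\ z\in\tfrac12\xi_1\xi_2+\tfrac1r\mathbb Z\}$, and $\mathcal B_r=\{(\xi,B)\in\mathbb R^2\times\mathrm{GL}(2,\mathbb R)\mid\bar F_\xi\bar F_B(\Gamma_r)=\Gamma_r\}$. Let $\mathbb S=\{s>0\mid e^s+e^{-s}\in\mathbb N\}$. $\mathcal P_{r,s}$ is the set of $(\eta,P,z,\xi)\in\mathbb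 R^2\times\mathrm{GL}(2,\mathbb R)\times\mathbb R\times\mathbb R^2$ with $(\xi,P^{-1}e^{sA}P)\in\mathcal B_r$. For such parameters, $L_{r,s}(\eta,P,z,\xi)=F_\eta(\langle\bar F_P(\Gamma_r),(\det(P)z,P\xi,s)\rangle)$, which is a lattice in $\mathrm{Osc}_{1,0}$; every lattice in $\mathrm{Osc}_{1,0}$ is of this form for some $r,s$. $H^r(\mathbb Z)=\langle\alpha,\beta,\gamma\mid\alpha\beta\alpha^{-1}\beta^{-1}=\gamma^r,\alpha\gamma=\gamma\alpha,\beta\gamma=\gamma\beta\rangle$. For $B=\begin{pmatrix}a&b\\c&d\end{pmatrix}\in\mathrm{SL}(2,\mathbb Z)$ with $\operatorname{tr}B>2$ and $l\in(\mathbb Z/r\mathbb Z)^2$ (represented by an integer vector; up to isomorphism the choice does not matter), $\mathrm{Osc}^r(B,l):=H^r(\mathbb Z)\rtimes_\phi\mathbb Z\cdot\delta$ with $\phi(\delta)(\alpha)=\alpha^a\beta^c\gamma^{-l_2}$, $\phi(\delta)(\beta)=\alpha^b\beta^d\gamma^{l_1}$, $\phi(\delta)(\gamma)=\gamma$. In part (1), $l$ is an integer vector, considered modulo $r$. A discrete split oscillator group is a semidirect product $H_d\rtimes_\phi\mathbb Z\delta$, with $H_d\cong H^r(\mathbb Z)$ for some $r\geq 1$, for which the automorphism induced by $\phi(\delta)$ on $H_d/Z(H_d)\cong\mathbb Z^2$ lies in $\{B\in\mathrm{SL}(2,\mathbb Z)\mid\operatorname{tr}B>2\}$; each is isomorphic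 to some $\mathrm{Osc}^r(B,l)$. *)

theory Defs
  imports
    "HOL-Analysis.Analysis"
    "HOL-Algebra.Bij"
    "HOL-Algebra.Coset"
    "HOL-Algebra.Generated_Groups"
    "HOL-Algebra.Elementary_Groups"
begin

section \<open>General notions\<close>

text \<open>The library's \<^const>\<open>exp\<close> is not available on matrices, which carry no
  \<^class>\<open>real_normed_algebra_1\<close> structure.\<close>

definition mat_exp :: "real^'n^'n \<Rightarrow> real^'n^'n" where
  "mat_exp M = (\<Sum>n. (1 / fact n) *\<^sub>R (((**) M ^^ n) (mat 1)))"

abbreviation real_mat :: "int^2^2 \<Rightarrow> real^2^2" where
  "real_mat \<equiv> map_matrix real_of_int"

definition real_vec :: "int^2 \<Rightarrow> real^2" where
  "real_vec v = (\<chi> i. real_of_int (v $ i))"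

definition group_center :: "('a, 'b) monoid_scheme \<Rightarrow> 'a set" where
  "group_center G = {c \<in> carrier G. \<forall>x\<in>carrier G. c \<otimes>\<^bsub>G\<^esub> x = x \<otimes>\<^bsub>G\<^esub> c}"

definition semidirect ::
  "('a, 'c) monoid_scheme \<Rightarrow> ('b, 'd) monoid_scheme \<Rightarrow> ('b \<Rightarrow> 'a \<Rightarrow> 'a) \<Rightarrow> ('a \<times> 'b) monoid" where
  "semidirect G K \<phi> =
    \<lparr>carrier = carrier G \<times> carrier K,
     mult = (\<lambda>(g, k) (g', k'). (g \<otimes>\<^bsub>G\<^esub> \<phi> k g', k \<otimes>\<^bsub>K\<^esub> k')),
     one = (\<one>\<^bsub>G\<^esub>, \<one>\<^bsub>K\<^esub>)\<rparr>"

definition int_vec_group :: "(int^2) monoid" where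
  "int_vec_group = \<lparr>carrier = UNIV, mult = (+), one = 0\<rparr>"

text \<open>Groups given by generators and relations. The letter \<open>(g, True)\<close> stands for the
  generator \<open>g\<close> and \<open>(g, False)\<close> for its inverse; a pair \<open>(u, v)\<close> of words in the set of
  relations imposes \<open>u = v\<close>.\<close>

type_synonym 'g word = "('g \<times> bool) list"

inductive word_cong :: "('g word \<times> 'g word) set \<Rightarrow> 'g word \<Rightarrow> 'g word \<Rightarrow> bool" for R where
  relation: "(u, v) \<in> R \<Longrightarrow> word_cong R u v"
| cancel: "word_cong R [(g, b), (g, \<not> b)] []"
| refl: "word_cong R u u"
| sym: "word_cong R u v \<Longrightarrow> word_cong R v u"
| trans: "word_cong R u v \<Longrightarrow> word_cong R v w \<Longrightarrow> word_cong R u w"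
| append: "word_cong R u u' \<Longrightarrow> word_cong R v v' \<Longrightarrow> word_cong R (u @ v) (u' @ v')"

definition word_class :: "('g word \<times> 'g word) set \<Rightarrow> 'g word \<Rightarrow> 'g word set" where
  "word_class R u = {v. word_cong R u v}"

definition presented_group :: "('g word \<times> 'g word) set \<Rightarrow> 'g word set monoid" where
  "presented_group R =
    \<lparr>carrier = range (word_class R),
     mult = (\<lambda>X Y. \<Union>u\<in>X. \<Union>v\<in>Y. word_class R (u @ v)),
     one = word_class R []\<rparr>"


section \<open>The discrete groups\<close>

datatype heis_gen = Alpha | Beta | Gamma

definition disc_heis_rels :: "nat \<Rightarrow> (heis_gen word \<times> heis_gen word) set" where
  "disc_heis_rels r =
    {([(Alpha, True), (Beta, True), (Alpha, False), (Beta, False)], replicate r (Gamma, True)),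
     ([(Alpha, True), (Gamma, True)], [(Gamma, True), (Alpha, True)]),
     ([(Beta, True), (Gamma, True)], [(Gamma, True), (Beta, True)])}"

definition disc_heis :: "nat \<Rightarrow> heis_gen word set monoid" where
  "disc_heis r = presented_group (disc_heis_rels r)"

definition disc_heis_gen :: "nat \<Rightarrow> heis_gen \<Rightarrow> heis_gen word set" where
  "disc_heis_gen r g = word_class (disc_heis_rels r) [(g, True)]"

text \<open>The automorphism \<open>\<phi>(\<delta>)\<close>. Elements of \<^const>\<open>AutoGroup\<close> are extensional functions, so an
  automorphism is determined by its values on the three generators.\<close>

definition disc_osc_aut ::
  "nat \<Rightarrow> int^2^2 \<Rightarrow> int^2 \<Rightarrow> heis_gen word set \<Rightarrow> heis_gen word set" where
  "disc_osc_aut r B l =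
    (let H = disc_heis r;
         \<alpha> = disc_heis_gen r Alpha; \<beta> = disc_heis_gen r Beta; \<gamma> = disc_heis_gen r Gamma
     in THE f. f \<in> carrier (AutoGroup H) \<and>
          f \<alpha> = \<alpha> [^]\<^bsub>H\<^esub> (B$1$1) \<otimes>\<^bsub>H\<^esub> \<beta> [^]\<^bsub>H\<^esub> (B$2$1) \<otimes>\<^bsub>H\<^esub> \<gamma> [^]\<^bsub>H\<^esub> (- (l$2)) \<and>
          f \<beta> = \<alpha> [^]\<^bsub>H\<^esub> (B$1$2) \<otimes>\<^bsub>H\<^esub> \<beta> [^]\<^bsub>H\<^esub> (B$2$2) \<otimes>\<^bsub>H\<^esub> \<gamma> [^]\<^bsub>H\<^esub> (l$1) \<and>
          f \<gamma> = \<gamma>)"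

text \<open>The parameter \<open>l\<close> is an integer vector representing a class modulo \<open>r\<close>.\<close>

definition disc_osc :: "nat \<Rightarrow> int^2^2 \<Rightarrow> int^2 \<Rightarrow> (heis_gen word set \<times> int) monoid" where
  "disc_osc r B l =
    semidirect (disc_heis r) integer_group
      (\<lambda>n. disc_osc_aut r B l [^]\<^bsub>AutoGroup (disc_heis r)\<^esub> (n :: int))"

text \<open>The matrix \<open>B\<close> of the induced automorphism refers to an identification of
  \<open>H\<^sub>d / Z(H\<^sub>d)\<close> with \<open>\<int>\<^sup>2\<close>; changing it replaces \<open>B\<close> by an integral conjugate, so determinant
  and trace do not depend on the choice.\<close>

definition discrete_split_oscillator_group :: "('a \<times> int) monoid \<Rightarrow> bool" where
  "discrete_split_oscillator_group D \<longleftrightarrow>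
    (\<exists>(Hd :: 'a monoid) \<phi>.
       group Hd \<and> (\<exists>r\<ge>1. Hd \<cong> disc_heis r) \<and>
       \<phi> \<in> hom integer_group (AutoGroup Hd) \<and>
       (\<exists>\<psi> \<in> iso (Hd Mod group_center Hd) int_vec_group. \<exists>B :: int^2^2.
          det B = 1 \<and> trace B > 2 \<and>
          (\<forall>x \<in> carrier Hd.
             \<psi> (group_center Hd #>\<^bsub>Hd\<^esub> \<phi> 1 x) = B *v \<psi> (group_center Hd #>\<^bsub>Hd\<^esub> x))) \<and>
       D = semidirect Hd integer_group \<phi>)"


section \<open>The split oscillator group and its lattices\<close>

definition omega :: "real^2 \<Rightarrow> real^2 \<Rightarrow> real" where
  "omega \<xi> \<xi>' = \<xi>$1 * \<xi>'$2 - \<xi>'$1 * \<xi>$2"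

definition A_mat :: "real^2^2" where
  "A_mat = vector [vector [0, 1], vector [1, 0]]"

type_synonym heis = "real \<times> (real^2)"
type_synonym osc = "real \<times> (real^2) \<times> real"

definition Osc :: "osc monoid" where
  "Osc =
    \<lparr>carrier = UNIV,
     mult = (\<lambda>(z, \<xi>, t) (z', \<xi>', t').
       (z + z' + 1/2 * omega \<xi> (mat_exp (t *\<^sub>R A_mat) *v \<xi>'),
        \<xi> + mat_exp (t *\<^sub>R A_mat) *v \<xi>', t + t')),
     one = (0, 0, 0)\<rparr>"

definition heis_lin :: "real^2^2 \<Rightarrow> heis \<Rightarrow> heis" where
  "heis_lin P = (\<lambda>(z, \<xi>). (det P * z, P *v \<xi>))"

definition heis_shear :: "real^2 \<Rightarrow> heis \<Rightarrow> heis" where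
  "heis_shear \<eta> = (\<lambda>(z, \<xi>). (z + omega \<eta> \<xi>, \<xi>))"

definition heis_to_osc :: "heis \<Rightarrow> osc" where
  "heis_to_osc = (\<lambda>(z, \<xi>). (z, \<xi>, 0))"

definition osc_conj :: "real^2 \<Rightarrow> osc \<Rightarrow> osc" where
  "osc_conj \<eta> x = (0, \<eta>, 0) \<otimes>\<^bsub>Osc\<^esub> x \<otimes>\<^bsub>Osc\<^esub> inv\<^bsub>Osc\<^esub> (0, \<eta>, 0)"

text \<open>The Borel \<open>\<sigma>\<close>-algebra of the quotient topology on \<open>L\Osc\<close>: a set of right cosets is open
  iff its preimage in the group, i.e. its union, is open.\<close>

definition quotient_borel :: "osc set \<Rightarrow> osc set measure" where
  "quotient_borel L =
    sigma (rcosets\<^bsub>Osc\<^esub> L) {U. U \<subseteq> rcosets\<^bsub>Osc\<^esub> L \<and> open (\<Union>U)}"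

definition finite_invariant_quotient_measure :: "osc set \<Rightarrow> osc set measure \<Rightarrow> bool" where
  "finite_invariant_quotient_measure L M \<longleftrightarrow>
    sets M = sets (quotient_borel L) \<and> finite_measure M \<and> emeasure M (space M) \<noteq> 0 \<and>
    (\<forall>g\<in>carrier Osc. \<forall>S\<in>sets M. emeasure M ((\<lambda>C. C #>\<^bsub>Osc\<^esub> g) ` S) = emeasure M S)"

definition osc_lattice :: "osc set \<Rightarrow> bool" where
  "osc_lattice L \<longleftrightarrow>
    subgroup L Osc \<and> discrete L \<and> (\<exists>M. finite_invariant_quotient_measure L M)"

definition Gamma_set :: "nat \<Rightarrow> heis set" where
  "Gamma_set r =
    {(z, \<xi>). \<xi>$1 \<in> \<int> \<and> \<xi>$2 \<in> \<int> \<and> (\<exists>k::int. z = 1/2 * \<xi>$1 * \<xi>$2 + of_int k / of_nat r)}"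

definition B_set :: "nat \<Rightarrow> ((real^2) \<times> (real^2^2)) set" where
  "B_set r =
    {(\<xi>, B). invertible B \<and> heis_shear \<xi> ` (heis_lin B ` Gamma_set r) = Gamma_set r}"

definition S_set :: "real set" where
  "S_set = {s. s > 0 \<and> exp s + exp (- s) \<in> \<nat>}"

definition P_set :: "nat \<Rightarrow> real \<Rightarrow> ((real^2) \<times> (real^2^2) \<times> real \<times> (real^2)) set" where
  "P_set r s =
    {(\<eta>, P, z, \<xi>). invertible P \<and>
       (\<xi>, matrix_inv P ** mat_exp (s *\<^sub>R A_mat) ** P) \<in> B_set r}"

definition L_lat ::
  "nat \<Rightarrow> real \<Rightarrow> real^2 \<Rightarrow> real^2^2 \<Rightarrow> real \<Rightarrow> real^2 \<Rightarrow> osc set" where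
  "L_lat r s \<eta> P z \<xi> =
    osc_conj \<eta> ` generate Osc
      (heis_to_osc ` heis_lin P ` Gamma_set r \<union> {(det P * z, P *v \<xi>, s)})"

text \<open>The vector with entries \<open>- b d\<close> and \<open>a c\<close>, for \<open>B\<close> with rows \<open>(a, b)\<close> and \<open>(c, d)\<close>.\<close>

definition corr_vec :: "'a::ring_1^2^2 \<Rightarrow> 'a^2" where
  "corr_vec B = vector [- (B$1$2 * B$2$2), B$1$1 * B$2$1]"

end

theory Submission
  imports Defs
begin

text \<open>Every group in sight is generated by four elements \<open>a, b, c, d\<close>, where \<open>a, b, c\<close> satisfy the
Heisenberg relations and conjugation by \<open>d\<close> acts on \<open>a, b\<close> through a matrix \<open>B\<close> and powers of the
central element \<open>c\<close>, and every element is \<open>a\<^sup>x b\<^sup>y c\<^sup>k d\<^sup>n\<close> for unique integers. These data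
determine the group, and \<open>disc_osc_recognition\<close> says that it is then \<open>disc_osc r B l\<close>. All
isomorphisms are obtained by exhibiting such elements.

For \<open>L_lat r s \<eta> P z \<xi>\<close> they are, up to conjugation by \<open>(0, \<eta>, 0)\<close>, the images of the obvious
generators of \<open>Gamma_set r\<close> and the element \<open>d = (det P * z, P *v \<xi>, s)\<close>. Conjugation by \<open>d\<close> is, in
the coordinates given by \<open>P\<close>, the linear map \<open>B\<close> followed by the shear with \<open>\<xi>\<close>. It preserves
\<open>Gamma_set r\<close> exactly if \<open>B\<close> and the vector \<open>l\<close> of the statement are integral
(\<open>B_set_imp_integral\<close>, \<open>integral_imp_B_set\<close>), and \<open>l\<close> consists of the exponents of \<open>c\<close>, up to sign
and order. That the group is a lattice follows from a bounded Borel fundamental domain: Lebesgue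
measure is invariant under left and right translations, so its restriction to the domain, pushed to
the quotient, is finite and invariant (\<open>osc_lattice_fundamental_domain\<close>). Conversely, an integral
matrix of determinant \<open>1\<close> and trace \<open>e\<^sup>s + e\<^sup>-\<^sup>s > 2\<close> is conjugate to \<open>e\<^sup>s\<^sup>A\<close> over the reals, which
realises each \<open>disc_osc r B l\<close>.

An abstract discrete split oscillator group has generators of this kind because the automorphism
fixes \<open>c\<close>: the power \<open>c\<^sup>r\<close> is a commutator, so \<open>c\<close> is raised to the power \<open>det B = 1\<close>
(\<open>discrete_split_is_disc_osc\<close>).

For an arbitrary lattice \<open>L\<close>, a finite invariant measure gives recurrence in the sense of Poincare:
for every non-empty open \<open>V\<close> and every \<open>g\<close> some \<open>v g\<^sup>n w\<^sup>-\<^sup>1\<close> with \<open>n > 0\<close> and \<open>v, w\<close> in \<open>V\<close> lies in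
\<open>L\<close> (\<open>osc_lattice_recurrent\<close>). This produces an element of positive time, which a conjugation brings
to the form \<open>\<delta> = (z\<^sub>0, 0, t\<^sub>0)\<close>, and a further element with non-zero planar part; a commutator is then
an element \<open>(h, u, 0)\<close> with \<open>u \<noteq> 0\<close>. Conjugation by \<open>\<delta>\<close> expands one light-cone direction of the plane
and contracts the other, so discreteness keeps \<open>u\<close> off both of them, and \<open>u\<close> and its image span the
plane. The corresponding commutator is a non-trivial central element. Thus the centre of the
lattice is generated by some \<open>c\<close>, all commutators are multiples of \<open>c\<close>, and this alone forces the
planar parts of the elements of time \<open>0\<close> to form a lattice of rank two. Elements of time \<open>t\<close> act on it
by integral matrices of trace \<open>e\<^sup>t + e\<^sup>-\<^sup>t\<close>, so the times form an infinite cyclic group, and the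
recognition theorem applies (\<open>iso_disc_osc\<close>).\<close>

section \<open>The discrete Heisenberg group in normal form\<close>

lemma (in group) conj_int_pow:
  assumes "g \<in> carrier G" "x \<in> carrier G"
  shows "g \<otimes> x [^] (i::int) \<otimes> inv g = (g \<otimes> x \<otimes> inv g) [^] i"
proof -
  have "(\<lambda>x. g \<otimes> x \<otimes> inv g) \<in> hom G G"
    by (rule homI) (use assms in \<open>auto simp: m_assoc inv_solve_left\<close>)
  from hom_int_pow[OF this _ is_group is_group] show ?thesis
    using assms by auto
qed

lemma (in group) commute_int_pow:
  assumes "g \<in> carrier G" "x \<in> carrier G" "g \<otimes> x = x \<otimes> g"
  shows "g \<otimes> x [^] (i::int) = x [^] i \<otimes> g"
proof -
  have "g \<otimes> x \<otimes> inv g = x"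
    using assms by (simp add: m_assoc)
  with conj_int_pow[of g x i] assms have "g \<otimes> x [^] i \<otimes> inv g = x [^] i"
    by simp
  then show ?thesis
    using assms by (metis inv_closed inv_solve_right int_pow_closed m_closed inv_inv)
qed

lemma (in group) commute_int_pow2:
  assumes "g \<in> carrier G" "x \<in> carrier G" "g \<otimes> x = x \<otimes> g"
  shows "g [^] (j::int) \<otimes> x [^] (i::int) = x [^] i \<otimes> g [^] j"
  using commute_int_pow[of "x [^] i" g j] commute_int_pow[of g x i] assms by auto

text \<open>The triple \<open>(x, y, k)\<close> stands for the word \<open>\<alpha>\<^sup>x \<beta>\<^sup>y \<gamma>\<^sup>k\<close>. In a product
of two such words \<open>\<beta>\<^sup>y\<close> has to pass \<open>\<alpha>\<close> raised to \<open>x'\<close>; this costs the factor \<open>\<gamma>\<close> raised to \<open>- r y x'\<close>, which is the cocycle below.\<close>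

definition heis_model :: "nat \<Rightarrow> (int \<times> int \<times> int) monoid" where
  "heis_model r =
    \<lparr>carrier = UNIV,
     mult = (\<lambda>(x, y, k) (x', y', k'). (x + x', y + y', k + k' - int r * y * x')),
     one = (0, 0, 0)\<rparr>"

lemma heis_model_simps [simp]:
  "carrier (heis_model r) = UNIV"
  "(x, y, k) \<otimes>\<^bsub>heis_model r\<^esub> (x', y', k') = (x + x', y + y', k + k' - int r * y * x')"
  "\<one>\<^bsub>heis_model r\<^esub> = (0, 0, 0)"
  by (simp_all add: heis_model_def)

lemma group_heis_model: "group (heis_model r)"
proof (rule groupI)
  fix p :: "int \<times> int \<times> int"
  obtain x y k where p: "p = (x, y, k)" by (cases p) auto
  show "\<exists>q\<in>carrier (heis_model r). q \<otimes>\<^bsub>heis_model r\<^esub> p = \<one>\<^bsub>heis_model r\<^esub>"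
    by (rule bexI[of _ "(- x, - y, - k - int r * y * x)"]) (auto simp: p algebra_simps)
qed (auto simp: algebra_simps split: prod.splits)

interpretation heis_model: group "heis_model r" for r
  by (rule group_heis_model)

lemma heis_model_gen_pows:
  "(1, 0, 0) [^]\<^bsub>heis_model r\<^esub> (n::int) = (n, 0, 0)"
  "(0, 1, 0) [^]\<^bsub>heis_model r\<^esub> (n::int) = (0, n, 0)"
  "(0, 0, 1) [^]\<^bsub>heis_model r\<^esub> (n::int) = (0, 0, n)"
proof -
  have "(\<lambda>n. (n, 0, 0)) \<in> hom integer_group (heis_model r)"
    "(\<lambda>n. (0, n, 0)) \<in> hom integer_group (heis_model r)"
    "(\<lambda>n. (0, 0, n)) \<in> hom integer_group (heis_model r)"
    by (auto intro!: homI)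
  from this[THEN hom_int_pow, of 1 n]
  show "(1, 0, 0) [^]\<^bsub>heis_model r\<^esub> (n::int) = (n, 0, 0)"
    "(0, 1, 0) [^]\<^bsub>heis_model r\<^esub> (n::int) = (0, n, 0)"
    "(0, 0, 1) [^]\<^bsub>heis_model r\<^esub> (n::int) = (0, 0, n)"
    by (simp_all add: group_heis_model)
qed

definition normal_form :: "('a, 'b) monoid_scheme \<Rightarrow> 'a \<Rightarrow> 'a \<Rightarrow> 'a \<Rightarrow> int \<times> int \<times> int \<Rightarrow> 'a" where
  "normal_form G a b c = (\<lambda>(x, y, k). a [^]\<^bsub>G\<^esub> x \<otimes>\<^bsub>G\<^esub> b [^]\<^bsub>G\<^esub> y \<otimes>\<^bsub>G\<^esub> c [^]\<^bsub>G\<^esub> k)"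

text \<open>The relations of the discrete Heisenberg group, for three elements of an arbitrary group.\<close>

locale heis_triple = group +
  fixes r :: nat and a b c
  assumes a_closed [simp, intro]: "a \<in> carrier G"
    and b_closed [simp, intro]: "b \<in> carrier G"
    and c_closed [simp, intro]: "c \<in> carrier G"
    and ab: "a \<otimes> b = b \<otimes> a \<otimes> c [^] int r"
    and ac: "a \<otimes> c = c \<otimes> a"
    and bc: "b \<otimes> c = c \<otimes> b"
begin

lemma c_int_pow_commute:
  "c [^] (k::int) \<otimes> a [^] (x::int) = a [^] x \<otimes> c [^] k"
  "c [^] (k::int) \<otimes> b [^] (y::int) = b [^] y \<otimes> c [^] k"
  using commute_int_pow2[of a c] commute_int_pow2[of b c] ac bc by auto

lemma ab_int_pow:
  "b [^] (y::int) \<otimes> a [^] (x::int) = a [^] x \<otimes> b [^] y \<otimes> c [^] (- int r * x * y)"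
proof -
  have "a \<otimes> b [^] y \<otimes> inv a = (b \<otimes> c [^] int r) [^] y"
  proof -
    have "a \<otimes> b = b \<otimes> c [^] int r \<otimes> a"
      using ab c_int_pow_commute(1)[of "int r" 1] by (simp add: m_assoc)
    then have "a \<otimes> b \<otimes> inv a = b \<otimes> c [^] int r"
      by (simp add: inv_solve_right')
    then show ?thesis by (simp add: conj_int_pow)
  qed
  also have "\<dots> = b [^] y \<otimes> c [^] (int r * y)"
    using c_int_pow_commute(2)[of "int r" 1]
    by (subst int_pow_mult_distrib) (auto simp: int_pow_pow)
  finally have 1: "a \<otimes> b [^] y = b [^] y \<otimes> c [^] (int r * y) \<otimes> a"
    by (simp add: inv_solve_right')
  have "inv (b [^] y) \<otimes> a \<otimes> b [^] y = c [^] (int r * y) \<otimes> a"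
    using 1 by (simp add: m_assoc inv_solve_left')
  then have "inv (b [^] y) \<otimes> a [^] x \<otimes> b [^] y = (c [^] (int r * y) \<otimes> a) [^] x"
    using conj_int_pow[of "inv (b [^] y)" a x] by simp
  also have "\<dots> = c [^] (int r * y * x) \<otimes> a [^] x"
    using c_int_pow_commute(1)[of "int r * y" 1]
    by (subst int_pow_mult_distrib) (auto simp: int_pow_pow)
  finally have 2: "a [^] x \<otimes> b [^] y = b [^] y \<otimes> (c [^] (int r * y * x) \<otimes> a [^] x)"
    by (simp add: m_assoc inv_solve_left')
  have "a [^] x \<otimes> b [^] y \<otimes> c [^] (- int r * x * y) =
      b [^] y \<otimes> (a [^] x \<otimes> (c [^] (int r * y * x) \<otimes> c [^] (- int r * x * y)))"
    unfolding 2 c_int_pow_commute by (simp add: m_assoc)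
  also have "c [^] (int r * y * x) \<otimes> c [^] (- int r * x * y) = \<one>"
    by (simp add: mult.commute mult.left_commute flip: int_pow_mult)
  finally show ?thesis by simp
qed

lemma normal_form_hom: "normal_form G a b c \<in> hom (heis_model r) G"
proof (rule homI)
  fix p q :: "int \<times> int \<times> int"
  obtain x y k x' y' k' where pq: "p = (x, y, k)" "q = (x', y', k')"
    by (cases p, cases q) auto
  have "(a [^] x \<otimes> b [^] y \<otimes> c [^] k) \<otimes> (a [^] x' \<otimes> b [^] y' \<otimes> c [^] k')
      = a [^] x \<otimes> b [^] y \<otimes> (c [^] k \<otimes> a [^] x') \<otimes> b [^] y' \<otimes> c [^] k'"
    by (simp add: m_assoc)
  also have "\<dots> = a [^] x \<otimes> (b [^] y \<otimes> a [^] x') \<otimes> (c [^] k \<otimes> b [^] y') \<otimes> c [^] k'"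
    unfolding c_int_pow_commute(1)[of k x'] by (simp add: m_assoc)
  also have "\<dots> = a [^] x \<otimes> a [^] x' \<otimes> b [^] y \<otimes> (c [^] (- int r * x' * y) \<otimes> b [^] y') \<otimes> c [^] k \<otimes> c [^] k'"
    unfolding c_int_pow_commute(2)[of k] ab_int_pow[of y x'] by (simp add: m_assoc)
  also have "\<dots> = (a [^] x \<otimes> a [^] x') \<otimes> (b [^] y \<otimes> b [^] y') \<otimes> (c [^] (- int r * x' * y) \<otimes> c [^] k \<otimes> c [^] k')"
    unfolding c_int_pow_commute(2)[of "- int r * x' * y" y'] by (simp add: m_assoc)
  also have "\<dots> = a [^] (x + x') \<otimes> b [^] (y + y') \<otimes> c [^] (k + k' - int r * y * x')"
    by (simp flip: int_pow_mult add: algebra_simps)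
  finally show "normal_form G a b c (p \<otimes>\<^bsub>heis_model r\<^esub> q) = normal_form G a b c p \<otimes> normal_form G a b c q"
    by (simp add: pq normal_form_def)
qed (auto simp: normal_form_def)

lemma normal_form_gens:
  "normal_form G a b c (1, 0, 0) = a"
  "normal_form G a b c (0, 1, 0) = b"
  "normal_form G a b c (0, 0, 1) = c"
  by (simp_all add: normal_form_def)

end

section \<open>Groups given by generators and relations\<close>

lemma word_class_eq_iff: "word_class R u = word_class R v \<longleftrightarrow> word_cong R u v"
proof
  assume "word_class R u = word_class R v"
  then have "v \<in> word_class R u"
    by (simp add: word_class_def word_cong.refl)
  then show "word_cong R u v" by (simp add: word_class_def)
next
  assume "word_cong R u v"
  then have "word_cong R u w \<longleftrightarrow> word_cong R v w" for w
    using word_cong.trans[of R v u w, OF word_cong.sym] word_cong.trans[of R u v w] by blast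
  then show "word_class R u = word_class R v"
    by (simp add: word_class_def)
qed

lemma presented_group_carrier: "carrier (presented_group R) = range (word_class R)"
  and presented_group_one: "\<one>\<^bsub>presented_group R\<^esub> = word_class R []"
  by (simp_all add: presented_group_def)

lemma presented_group_mult:
  "word_class R u \<otimes>\<^bsub>presented_group R\<^esub> word_class R v = word_class R (u @ v)"
proof -
  have "word_class R (u' @ v') = word_class R (u @ v)"
    if "u' \<in> word_class R u" "v' \<in> word_class R v" for u' v'
  proof -
    have "word_cong R u u'" "word_cong R v v'"
      using that by (simp_all add: word_class_def)
    then show ?thesis
      using word_cong.append word_class_eq_iff by metis
  qed
  moreover have "u \<in> word_class R u" "v \<in> word_class R v"
    by (simp_all add: word_class_def word_cong.refl)
  ultimately have "(\<Union>u'\<in>word_class R u. \<Union>v'\<in>word_class R v. word_class R (u' @ v')) = word_class R (u @ v)"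
    by (metis (no_types, lifting) SUP_eq_const empty_iff)
  then show ?thesis by (simp add: presented_group_def)
qed

definition inverse_word :: "'g word \<Rightarrow> 'g word" where
  "inverse_word w = rev (map (\<lambda>(g, b). (g, \<not> b)) w)"

lemma word_cong_inverse_word: "word_cong R (inverse_word w @ w) []"
proof (induction w)
  case Nil
  then show ?case by (simp add: inverse_word_def word_cong.refl)
next
  case (Cons x w)
  obtain g b where x: "x = (g, b)" by (cases x)
  have "word_cong R [(g, \<not> b), (g, b)] []"
    using word_cong.cancel[of R g "\<not> b"] by simp
  then have "word_cong R (inverse_word w @ ([(g, \<not> b), (g, b)] @ w)) (inverse_word w @ ([] @ w))"
    by (intro word_cong.append word_cong.refl)
  with Cons.IH show ?case
    using word_cong.trans by (fastforce simp: inverse_word_def x)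
qed

lemma group_presented_group: "group (presented_group R)"
proof (rule groupI)
  fix X assume "X \<in> carrier (presented_group R)"
  then obtain w where w: "X = word_class R w" by (auto simp: presented_group_carrier)
  have "word_class R (inverse_word w) \<otimes>\<^bsub>presented_group R\<^esub> X = \<one>\<^bsub>presented_group R\<^esub>"
    by (simp add: w presented_group_mult presented_group_one word_class_eq_iff word_cong_inverse_word)
  then show "\<exists>Y\<in>carrier (presented_group R). Y \<otimes>\<^bsub>presented_group R\<^esub> X = \<one>\<^bsub>presented_group R\<^esub>"
    by (auto simp: presented_group_carrier)
qed (auto simp: presented_group_carrier presented_group_one presented_group_mult)

primrec word_eval :: "('a, 'b) monoid_scheme \<Rightarrow> ('g \<Rightarrow> 'a) \<Rightarrow> 'g word \<Rightarrow> 'a" where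
  "word_eval G f [] = \<one>\<^bsub>G\<^esub>"
| "word_eval G f (x # w) = (if snd x then f (fst x) else inv\<^bsub>G\<^esub> f (fst x)) \<otimes>\<^bsub>G\<^esub> word_eval G f w"

context group
begin

lemma word_eval_closed [simp, intro]:
  "(\<And>g. f g \<in> carrier G) \<Longrightarrow> word_eval G f w \<in> carrier G"
  by (induction w) auto

lemma word_eval_append:
  "(\<And>g. f g \<in> carrier G) \<Longrightarrow> word_eval G f (u @ v) = word_eval G f u \<otimes> word_eval G f v"
  by (induction u) (auto simp: m_assoc)

lemma word_eval_cong:
  assumes f: "\<And>g. f g \<in> carrier G"
    and R: "\<And>u v. (u, v) \<in> R \<Longrightarrow> word_eval G f u = word_eval G f v"
    and "word_cong R u v"
  shows "word_eval G f u = word_eval G f v"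
  using assms(3)
proof (induction rule: word_cong.induct)
  case (cancel g b)
  then show ?case using f[of g] by (cases b) auto
next
  case (relation u v)
  then show ?case by (rule R)
next
  case (append u u' v v')
  then show ?case using f by (simp add: word_eval_append)
qed simp_all

text \<open>A class is sent to the value of any of its words; by \<open>word_eval_cong\<close> the choice does not matter.\<close>

lemma presented_group_universal:
  assumes f: "\<And>g. f g \<in> carrier G"
    and R: "\<And>u v. (u, v) \<in> R \<Longrightarrow> word_eval G f u = word_eval G f v"
  obtains h where "h \<in> hom (presented_group R) G" "\<And>g. h (word_class R [(g, True)]) = f g"
proof
  let ?h = "\<lambda>X. word_eval G f (SOME u. u \<in> X)"
  have h: "?h (word_class R u) = word_eval G f u" for u
  proof -
    have "u \<in> word_class R u" by (simp add: word_class_def word_cong.refl)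
    then have "(SOME v. v \<in> word_class R u) \<in> word_class R u" by (rule someI)
    then show ?thesis
      using word_eval_cong[OF f R] by (simp add: word_class_def)
  qed
  show "?h \<in> hom (presented_group R) G"
    by (rule homI) (use f in \<open>auto simp: presented_group_carrier presented_group_mult h word_eval_append\<close>)
  show "?h (word_class R [(g, True)]) = f g" for g
    using f by (simp add: h)
qed

end

lemma group_disc_heis: "group (disc_heis r)"
  by (simp add: disc_heis_def group_presented_group)

lemma disc_heis_gen_closed [simp, intro]: "disc_heis_gen r g \<in> carrier (disc_heis r)"
  by (simp add: disc_heis_gen_def disc_heis_def presented_group_carrier)

lemma word_class_True: "word_class (disc_heis_rels r) [(g, True)] = disc_heis_gen r g"
  by (simp add: disc_heis_gen_def)

lemma word_class_False:
  "word_class (disc_heis_rels r) [(g, False)] = inv\<^bsub>disc_heis r\<^esub> disc_heis_gen r g"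
proof -
  interpret group "disc_heis r" by (rule group_disc_heis)
  have "word_class (disc_heis_rels r) [(g, False)] \<otimes>\<^bsub>disc_heis r\<^esub> disc_heis_gen r g = \<one>\<^bsub>disc_heis r\<^esub>"
    unfolding disc_heis_def disc_heis_gen_def presented_group_mult presented_group_one
    using word_cong.cancel[of "disc_heis_rels r" g False] by (simp add: word_class_eq_iff)
  moreover have "word_class (disc_heis_rels r) [(g, False)] \<in> carrier (disc_heis r)"
    by (simp add: disc_heis_def presented_group_carrier)
  ultimately show ?thesis
    using inv_equality by (metis disc_heis_gen_closed)
qed

lemma word_class_Cons:
  "word_class (disc_heis_rels r) (x # w) =
    word_class (disc_heis_rels r) [x] \<otimes>\<^bsub>disc_heis r\<^esub> word_class (disc_heis_rels r) w"
  by (simp add: disc_heis_def presented_group_mult)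

lemma word_class_replicate:
  "word_class (disc_heis_rels r) (replicate n (g, True)) = disc_heis_gen r g [^]\<^bsub>disc_heis r\<^esub> n"
proof -
  interpret group "disc_heis r" by (rule group_disc_heis)
  show ?thesis
  proof (induction n)
    case 0
    then show ?case by (simp add: disc_heis_def presented_group_one)
  next
    case (Suc n)
    have "word_class (disc_heis_rels r) (replicate (Suc n) (g, True)) =
        disc_heis_gen r g \<otimes>\<^bsub>disc_heis r\<^esub> disc_heis_gen r g [^]\<^bsub>disc_heis r\<^esub> n"
      using Suc word_class_Cons[of r "(g, True)" "replicate n (g, True)"] by (simp add: word_class_True)
    also have "\<dots> = disc_heis_gen r g [^]\<^bsub>disc_heis r\<^esub> Suc n"
      by (rule nat_pow_Suc2[symmetric]) simp
    finally show ?case .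
  qed
qed

abbreviation disc_normal_form :: "nat \<Rightarrow> int \<times> int \<times> int \<Rightarrow> heis_gen word set" where
  "disc_normal_form r \<equiv>
    normal_form (disc_heis r) (disc_heis_gen r Alpha) (disc_heis_gen r Beta) (disc_heis_gen r Gamma)"

lemma heis_triple_disc_heis:
  "heis_triple (disc_heis r) r (disc_heis_gen r Alpha) (disc_heis_gen r Beta) (disc_heis_gen r Gamma)"
proof -
  interpret group "disc_heis r" by (rule group_disc_heis)
  have W: "word_class (disc_heis_rels r) u = word_class (disc_heis_rels r) v"
    if "(u, v) \<in> disc_heis_rels r" for u v
    using that by (simp add: word_class_eq_iff word_cong.relation)
  let ?a = "disc_heis_gen r Alpha" and ?b = "disc_heis_gen r Beta" and ?c = "disc_heis_gen r Gamma"
  note S = word_class_Cons[of r _ "_ # _"] word_class_True word_class_False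
  have 1: "?a \<otimes>\<^bsub>disc_heis r\<^esub> (?b \<otimes>\<^bsub>disc_heis r\<^esub> (inv\<^bsub>disc_heis r\<^esub> ?a \<otimes>\<^bsub>disc_heis r\<^esub> inv\<^bsub>disc_heis r\<^esub> ?b))
      = ?c [^]\<^bsub>disc_heis r\<^esub> r"
    using W[of "[(Alpha, True), (Beta, True), (Alpha, False), (Beta, False)]" "replicate r (Gamma, True)"]
    by (simp add: disc_heis_rels_def[of r] word_class_replicate S)
       (simp add: S word_class_replicate flip: disc_heis_rels_def)
  have 2: "?a \<otimes>\<^bsub>disc_heis r\<^esub> ?c = ?c \<otimes>\<^bsub>disc_heis r\<^esub> ?a"
    using W[of "[(Alpha, True), (Gamma, True)]" "[(Gamma, True), (Alpha, True)]"]
    unfolding S by (simp add: disc_heis_rels_def)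
  have 3: "?b \<otimes>\<^bsub>disc_heis r\<^esub> ?c = ?c \<otimes>\<^bsub>disc_heis r\<^esub> ?b"
    using W[of "[(Beta, True), (Gamma, True)]" "[(Gamma, True), (Beta, True)]"]
    unfolding S by (simp add: disc_heis_rels_def)
  have 4: "?a \<otimes>\<^bsub>disc_heis r\<^esub> ?b = ?c [^]\<^bsub>disc_heis r\<^esub> r \<otimes>\<^bsub>disc_heis r\<^esub> (?b \<otimes>\<^bsub>disc_heis r\<^esub> ?a)"
    unfolding 1[symmetric] by (simp add: m_assoc inv_solve_left' flip: inv_mult_group)
  have 5: "?c [^]\<^bsub>disc_heis r\<^esub> int r \<otimes>\<^bsub>disc_heis r\<^esub> (?b \<otimes>\<^bsub>disc_heis r\<^esub> ?a) = ?b \<otimes>\<^bsub>disc_heis r\<^esub> ?a \<otimes>\<^bsub>disc_heis r\<^esub> ?c [^]\<^bsub>disc_heis r\<^esub> int r"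
    using 2 3 commute_int_pow[of "?b \<otimes>\<^bsub>disc_heis r\<^esub> ?a" ?c "int r"]
    by (simp add: m_assoc) (metis disc_heis_gen_closed m_assoc)
  show ?thesis
    by unfold_locales (use 2 3 4 5 in \<open>simp_all add: int_pow_int\<close>)
qed

text \<open>Surjectivity holds because the image is a subgroup containing the generators. For injectivity the
presentation is evaluated in the model, which recovers the exponents.\<close>

lemma normal_form_disc_heis_iso:
  "disc_normal_form r
    \<in> iso (heis_model r) (disc_heis r)" (is "?N \<in> _")
proof -
  interpret H: heis_triple "disc_heis r" r "disc_heis_gen r Alpha" "disc_heis_gen r Beta" "disc_heis_gen r Gamma"
    by (rule heis_triple_disc_heis)
  interpret N: group_hom "heis_model r" "disc_heis r" ?N
    by unfold_locales (rule H.normal_form_hom)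
  let ?f = "\<lambda>g. case g of Alpha \<Rightarrow> (1, 0, 0) | Beta \<Rightarrow> (0, 1, 0) | Gamma \<Rightarrow> (0, 0, 1 :: int)"
  have inv1: "inv\<^bsub>heis_model r\<^esub> (1,0,0) = (- 1, 0, 0)" "inv\<^bsub>heis_model r\<^esub> (0,1,0) = (0, - 1, 0)"
    by (rule heis_model.inv_equality; simp)+
  have evg: "word_eval (heis_model r) ?f (replicate n (Gamma, True)) = (0, 0, int n)" for n
    by (induction n) auto
  obtain h where h: "h \<in> hom (presented_group (disc_heis_rels r)) (heis_model r)"
    and hg: "\<And>g. h (word_class (disc_heis_rels r) [(g, True)]) = ?f g"
  proof (rule heis_model.presented_group_universal[of ?f r "disc_heis_rels r"])
    fix u v assume "(u, v) \<in> disc_heis_rels r"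
    then show "word_eval (heis_model r) ?f u = word_eval (heis_model r) ?f v"
      by (auto simp: disc_heis_rels_def evg inv1)
  qed auto
  interpret h: group_hom "disc_heis r" "heis_model r" h
    by unfold_locales (use h in \<open>simp add: disc_heis_def\<close>)
  have hN: "h (?N p) = p" for p
  proof (cases p)
    case (fields x y k)
    then show ?thesis
      using hg by (simp add: normal_form_def h.hom_int_pow word_class_True heis_model_gen_pows)
  qed
  have "word_class (disc_heis_rels r) w \<in> range ?N" for w
  proof (induction w)
    case Nil
    have "?N (0,0,0) = word_class (disc_heis_rels r) []"
      using N.hom_one by (simp add: disc_heis_def presented_group_one)
    then show ?case by (metis rangeI)
  next
    case (Cons x w)
    have gen: "disc_heis_gen r g \<in> range ?N" for g
      using H.normal_form_gens[symmetric] by (cases g) blast+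
    have "inv\<^bsub>disc_heis r\<^esub> disc_heis_gen r g \<in> range ?N" for g
    proof -
      from gen[of g] obtain p where "disc_heis_gen r g = ?N p" by blast
      then have "inv\<^bsub>disc_heis r\<^esub> disc_heis_gen r g = ?N (inv\<^bsub>heis_model r\<^esub> p)" by simp
      then show ?thesis by blast
    qed
    with gen have "word_class (disc_heis_rels r) [x] \<in> range ?N"
      by (cases x; cases "snd x") (auto simp: word_class_True word_class_False)
    with Cons.IH obtain p q where pq: "word_class (disc_heis_rels r) [x] = ?N p"
      "word_class (disc_heis_rels r) w = ?N q" by blast
    have "word_class (disc_heis_rels r) (x # w) = ?N (p \<otimes>\<^bsub>heis_model r\<^esub> q)"
      unfolding word_class_Cons[of r x w] pq by simp
    then show ?case by blast
  qed
  then have "carrier (disc_heis r) \<subseteq> range ?N"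
    by (auto simp: disc_heis_def presented_group_carrier)
  moreover have "inj ?N"
    by (metis hN injI)
  ultimately show ?thesis
    using N.homh N.hom_closed by (auto simp: iso_def bij_betw_def)
qed

section \<open>Semidirect products with the integers\<close>

context group
begin

lemma carrier_AutoGroup:
  "carrier (AutoGroup G) = {f. f \<in> hom G G \<and> f \<in> extensional (carrier G) \<and> bij_betw f (carrier G) (carrier G)}"
  by (auto simp: AutoGroup_def auto_def Bij_def)

lemma mult_AutoGroup:
  "f \<in> carrier (AutoGroup G) \<Longrightarrow> g \<in> carrier (AutoGroup G) \<Longrightarrow> x \<in> carrier G \<Longrightarrow>
    (f \<otimes>\<^bsub>AutoGroup G\<^esub> g) x = f (g x)"
  by (auto simp: AutoGroup_def auto_def BijGroup_def compose_def)

lemma one_AutoGroup: "x \<in> carrier G \<Longrightarrow> \<one>\<^bsub>AutoGroup G\<^esub> x = x"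
  by (auto simp: AutoGroup_def BijGroup_def)

lemma AutoGroup_hom: "f \<in> carrier (AutoGroup G) \<Longrightarrow> f \<in> hom G G"
  by (simp add: carrier_AutoGroup)

lemma AutoGroup_closed: "f \<in> carrier (AutoGroup G) \<Longrightarrow> x \<in> carrier G \<Longrightarrow> f x \<in> carrier G"
  by (auto simp: carrier_AutoGroup hom_def)

lemma AutoGroup_mult:
  "f \<in> carrier (AutoGroup G) \<Longrightarrow> x \<in> carrier G \<Longrightarrow> y \<in> carrier G \<Longrightarrow> f (x \<otimes> y) = f x \<otimes> f y"
  by (auto simp: carrier_AutoGroup hom_def)

end

lemma semidirect_simps [simp]:
  "carrier (semidirect G K \<phi>) = carrier G \<times> carrier K"
  "(g, k) \<otimes>\<^bsub>semidirect G K \<phi>\<^esub> (g', k') = (g \<otimes>\<^bsub>G\<^esub> \<phi> k g', k \<otimes>\<^bsub>K\<^esub> k')"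
  "\<one>\<^bsub>semidirect G K \<phi>\<^esub> = (\<one>\<^bsub>G\<^esub>, \<one>\<^bsub>K\<^esub>)"
  by (simp_all add: semidirect_def)

lemma group_semidirect:
  assumes "group G" "group K" and \<phi>: "\<phi> \<in> hom K (AutoGroup G)"
  shows "group (semidirect G K \<phi>)"
proof -
  interpret G: group G by fact
  interpret K: group K by fact
  interpret \<phi>: group_hom K "AutoGroup G" \<phi>
    by (intro group_hom.intro group_hom_axioms.intro G.AutoGroup assms)
  have cl: "\<phi> k g \<in> carrier G" if "k \<in> carrier K" "g \<in> carrier G" for k g
    by (rule G.AutoGroup_closed[OF \<phi>.hom_closed[OF that(1)] that(2)])
  have mul: "\<phi> k (g \<otimes>\<^bsub>G\<^esub> g') = \<phi> k g \<otimes>\<^bsub>G\<^esub> \<phi> k g'" if "k \<in> carrier K" "g \<in> carrier G" "g' \<in> carrier G" for k g g'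
    by (rule G.AutoGroup_mult[OF \<phi>.hom_closed[OF that(1)] that(2,3)])
  have act: "\<phi> (k \<otimes>\<^bsub>K\<^esub> k') g = \<phi> k (\<phi> k' g)" if "k \<in> carrier K" "k' \<in> carrier K" "g \<in> carrier G" for k k' g
    using that by (simp add: G.mult_AutoGroup)
  have one: "\<phi> \<one>\<^bsub>K\<^esub> g = g" if "g \<in> carrier G" for g
    using that by (simp add: G.one_AutoGroup)
  show ?thesis
  proof (rule groupI)
    fix p q s
    assume "p \<in> carrier (semidirect G K \<phi>)" "q \<in> carrier (semidirect G K \<phi>)" "s \<in> carrier (semidirect G K \<phi>)"
    then show "p \<otimes>\<^bsub>semidirect G K \<phi>\<^esub> q \<otimes>\<^bsub>semidirect G K \<phi>\<^esub> s = p \<otimes>\<^bsub>semidirect G K \<phi>\<^esub> (q \<otimes>\<^bsub>semidirect G K \<phi>\<^esub> s)"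
      by (cases p; cases q; cases s) (simp add: cl mul act G.m_assoc K.m_assoc del: \<phi>.hom_mult)
  next
    fix p assume "p \<in> carrier (semidirect G K \<phi>)"
    then obtain g k where p: "p = (g, k)" and gk: "g \<in> carrier G" "k \<in> carrier K" by auto
    let ?q = "(\<phi> (inv\<^bsub>K\<^esub> k) (inv\<^bsub>G\<^esub> g), inv\<^bsub>K\<^esub> k)"
    have "?q \<otimes>\<^bsub>semidirect G K \<phi>\<^esub> p = \<one>\<^bsub>semidirect G K \<phi>\<^esub>"
    proof -
      have "\<phi> (inv\<^bsub>K\<^esub> k) (inv\<^bsub>G\<^esub> g) \<otimes>\<^bsub>G\<^esub> \<phi> (inv\<^bsub>K\<^esub> k) g = \<phi> (inv\<^bsub>K\<^esub> k) \<one>\<^bsub>G\<^esub>"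
        using gk mul[of "inv\<^bsub>K\<^esub> k" "inv\<^bsub>G\<^esub> g" g] by (metis G.inv_closed G.l_inv K.inv_closed)
      also have "\<dots> = \<one>\<^bsub>G\<^esub>"
        using gk by (rule_tac hom_one[OF G.AutoGroup_hom[OF \<phi>.hom_closed] assms(1) assms(1)]) simp
      finally show ?thesis using gk by (simp add: p)
    qed
    with gk cl show "\<exists>q\<in>carrier (semidirect G K \<phi>). q \<otimes>\<^bsub>semidirect G K \<phi>\<^esub> p = \<one>\<^bsub>semidirect G K \<phi>\<^esub>"
      by (rule_tac bexI[of _ ?q]) (simp_all add: cl del: \<phi>.hom_inv)
  qed (auto simp: cl one simp del: \<phi>.hom_one)
qed

text \<open>The relation between \<open>d\<close> and \<open>\<theta>\<close> is only assumed for the generator of the integers. It passes to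
positive exponents by induction, and from there to negative ones because the inverse automorphism
is again given by \<open>\<phi>\<close>.\<close>

lemma semidirect_integer_hom:
  assumes "group G" "group N" and \<phi>: "\<phi> \<in> hom integer_group (AutoGroup N)"
    and \<theta>: "\<theta> \<in> hom N G" and d: "d \<in> carrier G"
    and conj: "\<And>x. x \<in> carrier N \<Longrightarrow> d \<otimes>\<^bsub>G\<^esub> \<theta> x \<otimes>\<^bsub>G\<^esub> inv\<^bsub>G\<^esub> d = \<theta> (\<phi> 1 x)"
  shows "(\<lambda>(x, n). \<theta> x \<otimes>\<^bsub>G\<^esub> d [^]\<^bsub>G\<^esub> (n::int)) \<in> hom (semidirect N integer_group \<phi>) G"
proof -
  interpret G: group G by fact
  interpret N: group N by fact
  interpret \<phi>: group_hom integer_group "AutoGroup N" \<phi>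
    by (intro group_hom.intro group_hom_axioms.intro N.AutoGroup group_integer_group \<phi>)
  interpret \<theta>: group_hom N G \<theta>
    by (intro group_hom.intro group_hom_axioms.intro assms)
  have act: "\<phi> (k + k') g = \<phi> k (\<phi> k' g)" if "g \<in> carrier N" for k k' g
    using that \<phi>.hom_mult[of k k'] by (simp add: N.mult_AutoGroup del: \<phi>.hom_mult)
  have cl: "\<phi> k g \<in> carrier N" if "g \<in> carrier N" for k g
    by (rule N.AutoGroup_closed[OF \<phi>.hom_closed that]) simp
  have conj': "d \<otimes>\<^bsub>G\<^esub> \<theta> x = \<theta> (\<phi> 1 x) \<otimes>\<^bsub>G\<^esub> d" if "x \<in> carrier N" for x
    using conj[OF that] d that cl[OF that] by (simp add: G.inv_solve_right')
  have up: "d [^]\<^bsub>G\<^esub> (int n) \<otimes>\<^bsub>G\<^esub> \<theta> x = \<theta> (\<phi> (int n) x) \<otimes>\<^bsub>G\<^esub> d [^]\<^bsub>G\<^esub> (int n)" if "x \<in> carrier N" for n x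
    using that
  proof (induction n arbitrary: x)
    case 0
    then show ?case using \<phi>.hom_one by (simp add: N.one_AutoGroup)
  next
    case (Suc n)
    have "d [^]\<^bsub>G\<^esub> int (Suc n) = d [^]\<^bsub>G\<^esub> int n \<otimes>\<^bsub>G\<^esub> d"
      using d G.int_pow_mult[OF d, of "int n" 1] by (simp add: add.commute)
    then have "d [^]\<^bsub>G\<^esub> int (Suc n) \<otimes>\<^bsub>G\<^esub> \<theta> x = d [^]\<^bsub>G\<^esub> int n \<otimes>\<^bsub>G\<^esub> \<theta> (\<phi> 1 x) \<otimes>\<^bsub>G\<^esub> d"
      using d Suc.prems cl by (simp add: G.m_assoc conj')
    also have "\<dots> = \<theta> (\<phi> (int n) (\<phi> 1 x)) \<otimes>\<^bsub>G\<^esub> d [^]\<^bsub>G\<^esub> int (Suc n)"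
      using d Suc.prems cl \<open>d [^]\<^bsub>G\<^esub> int (Suc n) = _\<close> by (simp add: Suc.IH G.m_assoc)
    also have "\<phi> (int n) (\<phi> 1 x) = \<phi> (int (Suc n)) x"
      using act[of x "int n" 1] Suc.prems by (simp add: add.commute)
    finally show ?case .
  qed
  have all: "d [^]\<^bsub>G\<^esub> n \<otimes>\<^bsub>G\<^esub> \<theta> x = \<theta> (\<phi> n x) \<otimes>\<^bsub>G\<^esub> d [^]\<^bsub>G\<^esub> n" if x: "x \<in> carrier N" for n :: int and x
  proof (cases "n \<ge> 0")
    case True
    with up[OF x, of "nat n"] show ?thesis by simp
  next
    case False
    define m where "m = nat (- n)"
    have n: "n = - int m" using False by (simp add: m_def)
    have "\<phi> (int m) (\<phi> n x) = x"
      using act[of x "int m" n] x \<phi>.hom_one by (simp add: n N.one_AutoGroup)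
    with up[OF cl[OF x], of m n]
    have "d [^]\<^bsub>G\<^esub> int m \<otimes>\<^bsub>G\<^esub> \<theta> (\<phi> n x) = \<theta> x \<otimes>\<^bsub>G\<^esub> d [^]\<^bsub>G\<^esub> int m" by simp
    moreover have "d [^]\<^bsub>G\<^esub> n = inv\<^bsub>G\<^esub> (d [^]\<^bsub>G\<^esub> int m)"
      using d by (simp add: n G.int_pow_neg)
    moreover have "\<theta> (\<phi> n x) = inv\<^bsub>G\<^esub> (d [^]\<^bsub>G\<^esub> int m) \<otimes>\<^bsub>G\<^esub> (\<theta> x \<otimes>\<^bsub>G\<^esub> d [^]\<^bsub>G\<^esub> int m)"
      using calculation(1) d x cl[OF x, of n] by (simp add: G.inv_solve_left)
    ultimately show ?thesis
      using d x by (simp add: G.m_assoc)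
  qed
  show ?thesis
  proof (rule homI)
    fix p q assume "p \<in> carrier (semidirect N integer_group \<phi>)" "q \<in> carrier (semidirect N integer_group \<phi>)"
    then obtain x n y m where pq: "p = (x, n)" "q = (y, m)" and xy: "x \<in> carrier N" "y \<in> carrier N"
      by auto
    have "\<theta> x \<otimes>\<^bsub>G\<^esub> \<theta> (\<phi> n y) \<otimes>\<^bsub>G\<^esub> (d [^]\<^bsub>G\<^esub> n \<otimes>\<^bsub>G\<^esub> d [^]\<^bsub>G\<^esub> m) = \<theta> x \<otimes>\<^bsub>G\<^esub> (d [^]\<^bsub>G\<^esub> n \<otimes>\<^bsub>G\<^esub> \<theta> y) \<otimes>\<^bsub>G\<^esub> d [^]\<^bsub>G\<^esub> m"
      using xy d cl by (simp add: all G.m_assoc)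
    then show "(\<lambda>(x, n). \<theta> x \<otimes>\<^bsub>G\<^esub> d [^]\<^bsub>G\<^esub> n) (p \<otimes>\<^bsub>semidirect N integer_group \<phi>\<^esub> q) =
        (\<lambda>(x, n). \<theta> x \<otimes>\<^bsub>G\<^esub> d [^]\<^bsub>G\<^esub> n) p \<otimes>\<^bsub>G\<^esub> (\<lambda>(x, n). \<theta> x \<otimes>\<^bsub>G\<^esub> d [^]\<^bsub>G\<^esub> n) q"
      using xy d cl by (simp add: pq G.int_pow_mult G.m_assoc)
  qed (use d in auto)
qed

section \<open>Homomorphisms and automorphisms of discrete Heisenberg groups\<close>

text \<open>A discrete Heisenberg group with chosen generators, without reference to a presentation.\<close>

locale heis_group = heis_triple +
  assumes bij_normal_form: "bij_betw (normal_form G a b c) UNIV (carrier G)"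
begin

lemma normal_form_iso: "normal_form G a b c \<in> iso (heis_model r) G"
  using normal_form_hom bij_normal_form by (simp add: iso_def)

lemma normal_form_cases:
  assumes "x \<in> carrier G"
  obtains p where "x = normal_form G a b c p"
  using assms bij_normal_form unfolding bij_betw_def by blast

lemma normal_form_eq_iff: "normal_form G a b c p = normal_form G a b c q \<longleftrightarrow> p = q"
  using bij_normal_form unfolding bij_betw_def inj_def by blast

lemma normal_form_closed [simp, intro]: "normal_form G a b c p \<in> carrier G"
  using bij_normal_form unfolding bij_betw_def by blast

lemma normal_form_mult:
  "normal_form G a b c p \<otimes> normal_form G a b c q = normal_form G a b c (p \<otimes>\<^bsub>heis_model r\<^esub> q)"
  using hom_mult[OF normal_form_hom, of p q] by simp

lemma hom_normal_form:
  assumes "group K" "h \<in> hom G K"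
  shows "h (normal_form G a b c p) = normal_form K (h a) (h b) (h c) p"
proof -
  interpret h: group_hom G K h
    by (intro group_hom.intro group_hom_axioms.intro is_group assms)
  show ?thesis
    by (cases p) (simp add: normal_form_def h.hom_int_pow)
qed

lemma hom_eqI:
  assumes "group K" "f \<in> hom G K" "h \<in> hom G K" "f a = h a" "f b = h b" "f c = h c"
    and "x \<in> carrier G"
  shows "f x = h x"
  using assms by (auto elim!: normal_form_cases simp: hom_normal_form)

text \<open>Since the normal form is unique, a homomorphism may be prescribed on the generators whenever their
images satisfy the relations with the same \<open>r\<close>.\<close>

lemma hom_extension:
  assumes "heis_triple K r a' b' c'"
  obtains h where "h \<in> hom G K" "\<And>p. h (normal_form G a b c p) = normal_form K a' b' c' p"
proof
  interpret K: heis_triple K r a' b' c' by fact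
  let ?i = "inv_into UNIV (normal_form G a b c)"
  have "?i \<in> hom G (heis_model r)"
    using heis_model.iso_set_sym[OF normal_form_iso] by (simp add: iso_def)
  from Group.hom_compose[OF this K.normal_form_hom]
  show "normal_form K a' b' c' \<circ> ?i \<in> hom G K" .
  have "?i (normal_form G a b c p) = p" for p
    using bij_normal_form by (simp add: bij_betw_def)
  then show "(normal_form K a' b' c' \<circ> ?i) (normal_form G a b c p) = normal_form K a' b' c' p" for p
    by simp
qed

end

lemma heis_group_disc_heis:
  "heis_group (disc_heis r) r (disc_heis_gen r Alpha) (disc_heis_gen r Beta) (disc_heis_gen r Gamma)"
  using heis_triple_disc_heis normal_form_disc_heis_iso
  by (simp add: heis_group_def heis_group_axioms_def iso_def)

lemma heis_model_int_pow:
  "fst (p [^]\<^bsub>heis_model r\<^esub> (n::int)) = n * fst p"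
  "fst (snd (p [^]\<^bsub>heis_model r\<^esub> n)) = n * fst (snd p)"
proof -
  have "fst \<in> hom (heis_model r) integer_group" "(\<lambda>p. fst (snd p)) \<in> hom (heis_model r) integer_group"
    by (auto intro!: homI)
  from this[THEN hom_int_pow, of p n]
  show "fst (p [^]\<^bsub>heis_model r\<^esub> (n::int)) = n * fst p"
    "fst (snd (p [^]\<^bsub>heis_model r\<^esub> n)) = n * fst (snd p)"
    by (simp_all add: group_heis_model)
qed

text \<open>The commutator of the new generators is \<open>\<gamma>\<close> raised to \<open>r\<close> times the determinant, so determinant \<open>1\<close> is
what the relations require.\<close>

lemma heis_triple_heis_model:
  assumes "det (B :: int^2^2) = 1"
  shows "heis_triple (heis_model r) r (B$1$1, B$2$1, m) (B$1$2, B$2$2, n) (0, 0, 1)"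
proof -
  have "B$1$1 * B$2$2 = B$1$2 * B$2$1 + 1"
    using assms by (simp add: det_2)
  then have "int r * (B$1$1 * B$2$2) = int r * (B$1$2 * B$2$1) + int r"
    by (simp add: distrib_left)
  then show ?thesis
    by unfold_locales (auto simp: heis_model_gen_pows algebra_simps)
qed

text \<open>The map is the matrix \<open>B\<close> on the first two coordinates and a translation of the third coordinate that
depends on these two only; such a map has an explicit inverse.\<close>

lemma heis_model_automorphism:
  assumes det: "det (B :: int^2^2) = 1"
  shows "normal_form (heis_model r) (B$1$1, B$2$1, m) (B$1$2, B$2$2, n) (0, 0, 1)
    \<in> iso (heis_model r) (heis_model r)" (is "?T \<in> _")
proof -
  interpret heis_triple "heis_model r" r "(B$1$1, B$2$1, m)" "(B$1$2, B$2$2, n)" "(0, 0, 1)"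
    by (rule heis_triple_heis_model[OF det])
  define g where "g x y = snd (snd (?T (x, y, 0)))" for x y
  have T: "?T (x, y, k) = (B$1$1 * x + B$1$2 * y, B$2$1 * x + B$2$2 * y, k + g x y)" for x y k
  proof -
    have 0: "fst (?T (x, y, 0)) = B$1$1 * x + B$1$2 * y"
         "fst (snd (?T (x, y, 0))) = B$2$1 * x + B$2$2 * y"
      by (cases "(B$1$1, B$2$1, m) [^]\<^bsub>heis_model r\<^esub> x"; cases "(B$1$2, B$2$2, n) [^]\<^bsub>heis_model r\<^esub> y";
          use heis_model_int_pow[of r "(B$1$1, B$2$1, m)" x] heis_model_int_pow[of r "(B$1$2, B$2$2, n)" y]
          in \<open>simp add: normal_form_def\<close>)+
    have "?T (x, y, k) = ?T (x, y, 0) \<otimes>\<^bsub>heis_model r\<^esub> (0, 0, k)"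
      using heis_model_gen_pows(3) by (simp add: normal_form_def)
    with 0 show ?thesis by (cases "?T (x, y, 0)") (simp add: g_def)
  qed
  have B: "B$1$1 * B$2$2 = 1 + B$1$2 * B$2$1"
    using det by (simp add: det_2)
  define S where "S = (\<lambda>(u, v, w). let x = B$2$2 * u - B$1$2 * v; y = B$1$1 * v - B$2$1 * u in (x, y, w - g x y))"
  have "S (?T p) = p" for p
  proof (cases p)
    case (fields x y k)
    have "B$2$2 * (B$1$1 * x + B$1$2 * y) - B$1$2 * (B$2$1 * x + B$2$2 * y) = (B$1$1 * B$2$2 - B$1$2 * B$2$1) * x"
      "B$1$1 * (B$2$1 * x + B$2$2 * y) - B$2$1 * (B$1$1 * x + B$1$2 * y) = (B$1$1 * B$2$2 - B$1$2 * B$2$1) * y"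
      by (simp_all add: algebra_simps)
    then show ?thesis by (simp add: fields T S_def Let_def B)
  qed
  moreover have "?T (S p) = p" for p
  proof (cases p)
    case (fields u v w)
    have "B$1$1 * (B$2$2 * u - B$1$2 * v) + B$1$2 * (B$1$1 * v - B$2$1 * u) = (B$1$1 * B$2$2 - B$1$2 * B$2$1) * u"
      "B$2$1 * (B$2$2 * u - B$1$2 * v) + B$2$2 * (B$1$1 * v - B$2$1 * u) = (B$1$1 * B$2$2 - B$1$2 * B$2$1) * v"
      by (simp_all add: algebra_simps)
    then show ?thesis by (simp add: fields T S_def Let_def B)
  qed
  ultimately have "bij ?T"
    by (intro bij_betw_byWitness[of _ S]) auto
  then show ?thesis
    using normal_form_hom by (simp add: iso_def)
qed

context heis_group
begin

lemma automorphism_ex1: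
  assumes "det (B :: int^2^2) = 1"
  shows "\<exists>!f. f \<in> carrier (AutoGroup G) \<and> f a = normal_form G a b c (B$1$1, B$2$1, m) \<and>
    f b = normal_form G a b c (B$1$2, B$2$2, n) \<and> f c = c"
proof (rule ex_ex1I)
  let ?N = "normal_form G a b c"
  let ?T = "normal_form (heis_model r) (B$1$1, B$2$1, m) (B$1$2, B$2$2, n) (0, 0, 1)"
  let ?f = "restrict (?N \<circ> ?T \<circ> inv_into UNIV ?N) (carrier G)"
  interpret T: heis_triple "heis_model r" r "(B$1$1, B$2$1, m)" "(B$1$2, B$2$2, n)" "(0, 0, 1)"
    by (rule heis_triple_heis_model[OF assms])
  have "?N \<circ> ?T \<circ> inv_into UNIV ?N \<in> iso G G"
    using heis_model.iso_set_sym[OF normal_form_iso] heis_model_automorphism[OF assms] normal_form_iso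
    by (metis (no_types, lifting) heis_model_simps(1) iso_set_trans)
  then have "?f \<in> carrier (AutoGroup G)"
    by (auto simp: carrier_AutoGroup iso_def hom_def cong: bij_betw_cong)
  moreover have "inv_into UNIV ?N (?N p) = p" for p
    using bij_normal_form by (simp add: bij_betw_def)
  then have "?f (?N p) = ?N (?T p)" for p
    by simp
  from this[of "(1,0,0)"] this[of "(0,1,0)"] this[of "(0,0,1)"]
  have "?f a = ?N (B$1$1, B$2$1, m)" "?f b = ?N (B$1$2, B$2$2, n)" "?f c = c"
    by (simp_all add: normal_form_gens T.normal_form_gens)
  ultimately show "\<exists>f. f \<in> carrier (AutoGroup G) \<and> f a = ?N (B$1$1, B$2$1, m) \<and>
    f b = ?N (B$1$2, B$2$2, n) \<and> f c = c" by blast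
next
  fix f f'
  assume f: "f \<in> carrier (AutoGroup G) \<and> f a = normal_form G a b c (B$1$1, B$2$1, m) \<and>
    f b = normal_form G a b c (B$1$2, B$2$2, n) \<and> f c = c"
  assume f': "f' \<in> carrier (AutoGroup G) \<and> f' a = normal_form G a b c (B$1$1, B$2$1, m) \<and>
    f' b = normal_form G a b c (B$1$2, B$2$2, n) \<and> f' c = c"
  show "f = f'"
  proof (rule extensionalityI)
    show "f \<in> extensional (carrier G)" "f' \<in> extensional (carrier G)"
      using f f' by (simp_all add: carrier_AutoGroup)
    show "f x = f' x" if "x \<in> carrier G" for x
      by (rule hom_eqI[OF is_group AutoGroup_hom AutoGroup_hom _ _ _ that]) (use f f' in auto)
  qed
qed

end

lemma disc_osc_aut:
  assumes "det B = 1"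
  shows "disc_osc_aut r B l \<in> carrier (AutoGroup (disc_heis r))"
    and "disc_osc_aut r B l (disc_heis_gen r Alpha) =
      disc_normal_form r (B$1$1, B$2$1, - (l$2))"
    and "disc_osc_aut r B l (disc_heis_gen r Beta) =
      disc_normal_form r (B$1$2, B$2$2, l$1)"
    and "disc_osc_aut r B l (disc_heis_gen r Gamma) = disc_heis_gen r Gamma"
  using theI'[OF heis_group.automorphism_ex1[OF heis_group_disc_heis assms, of r "- (l$2)" "l$1"]]
  unfolding disc_osc_aut_def Let_def normal_form_def prod.case by blast+

lemma disc_osc_action:
  assumes "det B = 1"
  shows "(\<lambda>n. disc_osc_aut r B l [^]\<^bsub>AutoGroup (disc_heis r)\<^esub> (n :: int))
    \<in> hom integer_group (AutoGroup (disc_heis r))"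
  using group.hom_integer_group_pow[OF group.AutoGroup[OF group_disc_heis] disc_osc_aut(1)[OF assms]] .

lemma group_disc_osc: "det B = 1 \<Longrightarrow> group (disc_osc r B l)"
  unfolding disc_osc_def
  by (intro group_semidirect group_disc_heis group_integer_group disc_osc_action)

text \<open>The homomorphism from the presented group sends the generators to \<open>a, b, c\<close> and the generator of the
complement to \<open>d\<close>. The relations make it well defined, and uniqueness of the exponents makes it
injective. Its image is \<open>L\<close>, which is why \<open>L\<close> is a subgroup.\<close>

theorem disc_osc_recognition:
  assumes "heis_triple G r a b c" and det: "det B = 1" and d: "d \<in> carrier G"
    and da: "d \<otimes>\<^bsub>G\<^esub> a \<otimes>\<^bsub>G\<^esub> inv\<^bsub>G\<^esub> d = normal_form G a b c (B$1$1, B$2$1, - (l$2))"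
    and db: "d \<otimes>\<^bsub>G\<^esub> b \<otimes>\<^bsub>G\<^esub> inv\<^bsub>G\<^esub> d = normal_form G a b c (B$1$2, B$2$2, l$1)"
    and dc: "d \<otimes>\<^bsub>G\<^esub> c \<otimes>\<^bsub>G\<^esub> inv\<^bsub>G\<^esub> d = c"
    and inj: "inj (\<lambda>(p, n). normal_form G a b c p \<otimes>\<^bsub>G\<^esub> d [^]\<^bsub>G\<^esub> (n::int))"
  defines "L \<equiv> range (\<lambda>(p, n). normal_form G a b c p \<otimes>\<^bsub>G\<^esub> d [^]\<^bsub>G\<^esub> (n::int))"
  shows "subgroup L G" "G\<lparr>carrier := L\<rparr> \<cong> disc_osc r B l"
proof -
  interpret G: heis_triple G r a b c by fact
  interpret H: heis_group "disc_heis r" r "disc_heis_gen r Alpha" "disc_heis_gen r Beta" "disc_heis_gen r Gamma"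
    by (rule heis_group_disc_heis)
  let ?N = "disc_normal_form r"
  let ?f = "disc_osc_aut r B l"
  obtain \<theta> where \<theta>: "\<theta> \<in> hom (disc_heis r) G" and \<theta>N: "\<And>p. \<theta> (?N p) = normal_form G a b c p"
    using H.hom_extension[OF assms(1)] by blast
  from \<theta>N[of "(1,0,0)"] \<theta>N[of "(0,1,0)"] \<theta>N[of "(0,0,1)"]
  have \<theta>gen: "\<theta> (disc_heis_gen r Alpha) = a" "\<theta> (disc_heis_gen r Beta) = b" "\<theta> (disc_heis_gen r Gamma) = c"
    by (simp_all add: H.normal_form_gens G.normal_form_gens)
  have f: "?f \<in> hom (disc_heis r) (disc_heis r)"
    using disc_osc_aut(1)[OF det] by (rule H.AutoGroup_hom)
  have conj: "d \<otimes>\<^bsub>G\<^esub> \<theta> x \<otimes>\<^bsub>G\<^esub> inv\<^bsub>G\<^esub> d = \<theta> (?f x)" if "x \<in> carrier (disc_heis r)" for x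
  proof (rule H.hom_eqI[OF G.is_group _ _ _ _ _ that, where h = "\<lambda>x. \<theta> (?f x)"])
    show "(\<lambda>x. d \<otimes>\<^bsub>G\<^esub> \<theta> x \<otimes>\<^bsub>G\<^esub> inv\<^bsub>G\<^esub> d) \<in> hom (disc_heis r) G"
      using \<theta> d by (auto intro!: homI simp: hom_def Pi_iff G.m_assoc G.inv_solve_left)
    show "(\<lambda>x. \<theta> (?f x)) \<in> hom (disc_heis r) G"
      using hom_compose[OF f \<theta>] by (simp add: comp_def)
  qed (use da db dc in \<open>simp_all add: \<theta>gen disc_osc_aut(2-4)[OF det] \<theta>N\<close>)
  let ?\<Psi> = "\<lambda>(x, n). \<theta> x \<otimes>\<^bsub>G\<^esub> d [^]\<^bsub>G\<^esub> (n::int)"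
  have hom: "?\<Psi> \<in> hom (disc_osc r B l) G"
    unfolding disc_osc_def
  proof (rule semidirect_integer_hom[OF G.is_group H.is_group disc_osc_action[OF det] \<theta> d])
    fix x assume "x \<in> carrier (disc_heis r)"
    then show "d \<otimes>\<^bsub>G\<^esub> \<theta> x \<otimes>\<^bsub>G\<^esub> inv\<^bsub>G\<^esub> d = \<theta> ((?f [^]\<^bsub>AutoGroup (disc_heis r)\<^esub> (1::int)) x)"
      using conj group.int_pow_1[OF H.AutoGroup disc_osc_aut(1)[OF det]] by simp
  qed
  have "bij_betw (map_prod ?N id) (UNIV \<times> UNIV) (carrier (disc_heis r) \<times> (UNIV :: int set))"
    using H.bij_normal_form by (intro bij_betw_map_prod) auto
  then have bij: "bij_betw (map_prod ?N id) UNIV (carrier (disc_osc r B l))"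
    by (simp add: disc_osc_def)
  have comp: "?\<Psi> \<circ> map_prod ?N id = (\<lambda>(p, n). normal_form G a b c p \<otimes>\<^bsub>G\<^esub> d [^]\<^bsub>G\<^esub> n)"
    by (auto simp: \<theta>N)
  have inj': "inj_on ?\<Psi> (carrier (disc_osc r B l))"
    using inj bij comp_inj_on_iff[of "map_prod ?N id" UNIV ?\<Psi>] by (simp add: comp bij_betw_def)
  have img: "?\<Psi> ` carrier (disc_osc r B l) = L"
  proof -
    have "?\<Psi> ` carrier (disc_osc r B l) = range (?\<Psi> \<circ> map_prod ?N id)"
      using bij_betw_imp_surj_on[OF bij] by (simp only: image_comp[symmetric])
    then show ?thesis by (simp only: comp L_def)
  qed
  interpret \<Psi>: group_hom "disc_osc r B l" G ?\<Psi>
    by (intro group_hom.intro group_hom_axioms.intro group_disc_osc det G.is_group hom)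
  show "subgroup L G"
    using \<Psi>.img_is_subgroup by (simp add: img)
  have "?\<Psi> \<in> hom (disc_osc r B l) (G\<lparr>carrier := L\<rparr>)"
  proof (rule homI)
    show "?\<Psi> p \<in> carrier (G\<lparr>carrier := L\<rparr>)" if "p \<in> carrier (disc_osc r B l)" for p
      using imageI[OF that, of ?\<Psi>] unfolding img by simp
    show "?\<Psi> (p \<otimes>\<^bsub>disc_osc r B l\<^esub> q) = ?\<Psi> p \<otimes>\<^bsub>G\<lparr>carrier := L\<rparr>\<^esub> ?\<Psi> q"
      if "p \<in> carrier (disc_osc r B l)" "q \<in> carrier (disc_osc r B l)" for p q
      using hom_mult[OF hom that] by simp
  qed
  then have "?\<Psi> \<in> iso (disc_osc r B l) (G\<lparr>carrier := L\<rparr>)"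
    using inj' img by (simp add: iso_def bij_betw_def)
  then show "G\<lparr>carrier := L\<rparr> \<cong> disc_osc r B l"
    using group.iso_sym[OF group_disc_osc[OF det]] is_isoI by blast
qed

section \<open>Discrete split oscillator groups\<close>

lemma int_vec_group_simps [simp]:
  "carrier int_vec_group = UNIV" "u \<otimes>\<^bsub>int_vec_group\<^esub> v = u + v" "\<one>\<^bsub>int_vec_group\<^esub> = 0"
  by (simp_all add: int_vec_group_def)

lemma group_int_vec_group: "group int_vec_group"
proof (rule groupI)
  fix v :: "int^2"
  show "\<exists>w\<in>carrier int_vec_group. w \<otimes>\<^bsub>int_vec_group\<^esub> v = \<one>\<^bsub>int_vec_group\<^esub>"
    by (rule bexI[of _ "- v"]) auto
qed (auto simp: add.assoc)

lemma hom_matrix_int_vec: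
  fixes Q :: "int^2^2"
  assumes "h \<in> hom G int_vec_group"
  shows "(\<lambda>x. Q *v h x) \<in> hom G int_vec_group"
  using assms by (auto simp: hom_def matrix_vector_right_distrib)

context heis_group
begin

lemma projection_hom:
  obtains \<pi> where "\<pi> \<in> hom G int_vec_group" "\<forall>x y k. \<pi> (normal_form G a b c (x, y, k)) = vector [x, y]"
proof
  let ?i = "inv_into UNIV (normal_form G a b c)" and ?p = "(\<lambda>(x, y, k). vector [x, y]) :: int \<times> int \<times> int \<Rightarrow> int^2"
  have i: "?i \<in> hom G (heis_model r)"
    using heis_model.iso_set_sym[OF normal_form_iso] by (simp add: iso_def)
  have "?p \<in> hom (heis_model r) int_vec_group"
    by (rule homI) (auto simp: vec_eq_iff forall_2)
  from Group.hom_compose[OF i this]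
  show "?p \<circ> ?i \<in> hom G int_vec_group" .
  have "?i (normal_form G a b c p) = p" for p
    using bij_normal_form by (simp add: bij_betw_def)
  then show "\<forall>x y k. (?p \<circ> ?i) (normal_form G a b c (x, y, k)) = vector [x, y]"
    by simp
qed

text \<open>Commuting with \<open>b\<close> forces the exponent of \<open>a\<close> to vanish and vice versa, because \<open>r \<noteq> 0\<close> in the cocycle.\<close>

lemma group_center_eq:
  assumes "r > 0"
  shows "group_center G = {normal_form G a b c (0, 0, k) | k. True}"
proof (intro equalityI subsetI)
  fix g assume g: "g \<in> group_center G"
  then have "g \<in> carrier G" by (simp add: group_center_def)
  then obtain p where p: "g = normal_form G a b c p" by (rule normal_form_cases)
  have "normal_form G a b c p \<otimes> normal_form G a b c q = normal_form G a b c q \<otimes> normal_form G a b c p" for q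
    using g by (auto simp: group_center_def p)
  then have "p \<otimes>\<^bsub>heis_model r\<^esub> q = q \<otimes>\<^bsub>heis_model r\<^esub> p" for q
    by (simp add: normal_form_mult normal_form_eq_iff)
  from this[of "(1,0,0)"] this[of "(0,1,0)"]
  show "g \<in> {normal_form G a b c (0, 0, k) | k. True}"
    using assms by (cases p) (auto simp: p)
next
  fix g assume "g \<in> {normal_form G a b c (0, 0, k) | k. True}"
  then obtain k where g: "g = normal_form G a b c (0, 0, k)" by blast
  have "g \<otimes> x = x \<otimes> g" if "x \<in> carrier G" for x
  proof -
    obtain p where "x = normal_form G a b c p" using \<open>x \<in> carrier G\<close> by (rule normal_form_cases)
    then show ?thesis by (cases p) (simp add: g normal_form_mult add.commute)
  qed
  then show "g \<in> group_center G" by (auto simp: group_center_def g)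
qed

lemma center_quotient:
  assumes "r > 0"
  obtains \<pi> where "\<pi> \<in> hom G int_vec_group" "\<forall>x y k. \<pi> (normal_form G a b c (x, y, k)) = vector [x, y]"
    "kernel G int_vec_group \<pi> = group_center G" "\<pi> ` carrier G = UNIV"
proof -
  obtain \<pi> where \<pi>: "\<pi> \<in> hom G int_vec_group" "\<forall>x y k. \<pi> (normal_form G a b c (x, y, k)) = vector [x, y]"
    by (rule projection_hom)
  have "kernel G int_vec_group \<pi> = group_center G"
  proof -
    have "\<pi> (normal_form G a b c p) = 0 \<longleftrightarrow> (\<exists>k. p = (0, 0, k))" for p
      by (cases p) (auto simp: \<pi>(2) vec_eq_iff forall_2)
    moreover have "carrier G = range (normal_form G a b c)"
      using bij_normal_form by (simp add: bij_betw_def)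
    ultimately show ?thesis
      unfolding group_center_eq[OF assms] kernel_def by auto
  qed
  moreover have "v \<in> \<pi> ` carrier G" for v
  proof -
    have "v = \<pi> (normal_form G a b c (v$1, v$2, 0))"
      by (simp add: \<pi>(2) vec_eq_iff forall_2)
    then show ?thesis by (rule image_eqI) (rule normal_form_closed)
  qed
  ultimately show ?thesis using that \<pi> by blast
qed

lemma center_normal:
  assumes "r > 0"
  shows "group_center G \<lhd> G"
proof -
  obtain \<pi> where \<pi>: "\<pi> \<in> hom G int_vec_group"
    "\<forall>x y k. \<pi> (normal_form G a b c (x, y, k)) = vector [x, y]"
    "kernel G int_vec_group \<pi> = group_center G" "\<pi> ` carrier G = UNIV"
    by (rule center_quotient[OF assms])
  interpret \<pi>: group_hom G int_vec_group \<pi>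
    by (intro group_hom.intro group_hom_axioms.intro is_group group_int_vec_group \<pi>(1))
  show ?thesis using \<pi>.normal_kernel \<pi>(3) by simp
qed

end

text \<open>The projection to the exponents of \<open>\<alpha>\<close> and \<open>\<beta>\<close> identifies the quotient by the centre with
\<open>\<int>\<^sup>2\<close>, and the defining automorphism is read off as \<open>B\<close> on the three generators.\<close>

theorem disc_osc_discrete_split:
  assumes r: "r > 0" and det: "det B = 1" and tr: "trace B > 2"
  shows "discrete_split_oscillator_group (disc_osc r B l)"
proof -
  let ?H = "disc_heis r" and ?f = "disc_osc_aut r B l"
  let ?\<phi> = "\<lambda>n. ?f [^]\<^bsub>AutoGroup ?H\<^esub> (n :: int)"
  interpret heis_group ?H r "disc_heis_gen r Alpha" "disc_heis_gen r Beta" "disc_heis_gen r Gamma"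
    by (rule heis_group_disc_heis)
  let ?N = "normal_form ?H (disc_heis_gen r Alpha) (disc_heis_gen r Beta) (disc_heis_gen r Gamma)"
  obtain \<pi> where \<pi>: "\<pi> \<in> hom ?H int_vec_group" "\<forall>x y k. \<pi> (?N (x, y, k)) = vector [x, y]"
    "kernel ?H int_vec_group \<pi> = group_center ?H" "\<pi> ` carrier ?H = UNIV"
    by (rule center_quotient[OF r])
  interpret \<pi>: group_hom ?H int_vec_group \<pi>
    by (intro group_hom.intro group_hom_axioms.intro is_group group_int_vec_group \<pi>(1))
  define \<psi> where "\<psi> = (\<lambda>X. the_elem (\<pi> ` X))"
  have iso: "\<psi> \<in> iso (?H Mod group_center ?H) int_vec_group"
    using \<pi>.FactGroup_iso_set \<pi>(3,4) by (simp add: \<psi>_def)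
  have \<psi>: "\<psi> (group_center ?H #>\<^bsub>?H\<^esub> x) = \<pi> x" if "x \<in> carrier ?H" for x
  proof -
    have "\<pi> ` (group_center ?H #>\<^bsub>?H\<^esub> x) = {\<pi> x}"
      using that \<pi>.hom_one unfolding \<pi>(3)[symmetric] by (auto simp: kernel_def r_coset_def image_iff intro!: exI[of _ "\<one>\<^bsub>?H\<^esub>"])
    then show ?thesis by (simp add: \<psi>_def)
  qed
  have f: "?f \<in> hom ?H ?H" "\<And>x. x \<in> carrier ?H \<Longrightarrow> ?f x \<in> carrier ?H"
    using AutoGroup_hom AutoGroup_closed disc_osc_aut(1)[OF det] by blast+
  have "\<pi> (?f x) = B *v \<pi> x" if "x \<in> carrier ?H" for x
  proof (rule hom_eqI[OF group_int_vec_group _ _ _ _ _ that, where f = "\<lambda>x. \<pi> (?f x)"])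
    show "(\<lambda>x. \<pi> (?f x)) \<in> hom ?H int_vec_group"
      using Group.hom_compose[OF f(1) \<pi>(1)] by (simp add: comp_def)
    show "(\<lambda>x. B *v \<pi> x) \<in> hom ?H int_vec_group"
      by (rule hom_matrix_int_vec[OF \<pi>(1)])
    have gens: "\<pi> (disc_heis_gen r Alpha) = vector [1, 0]" "\<pi> (disc_heis_gen r Beta) = vector [0, 1]"
       "\<pi> (disc_heis_gen r Gamma) = vector [0, 0]"
      using \<pi>(2)[rule_format, of 1 0 0] \<pi>(2)[rule_format, of 0 1 0] \<pi>(2)[rule_format, of 0 0 1] by (simp_all add: normal_form_gens)
    show "\<pi> (?f (disc_heis_gen r Alpha)) = B *v \<pi> (disc_heis_gen r Alpha)"
      "\<pi> (?f (disc_heis_gen r Beta)) = B *v \<pi> (disc_heis_gen r Beta)"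
      "\<pi> (?f (disc_heis_gen r Gamma)) = B *v \<pi> (disc_heis_gen r Gamma)"
      by (simp_all add: disc_osc_aut(2-4)[OF det] \<pi>(2) gens vec_eq_iff forall_2 matrix_vector_mult_def sum_2)
  qed
  then have act: "\<forall>x\<in>carrier ?H. \<psi> (group_center ?H #>\<^bsub>?H\<^esub> ?\<phi> 1 x) = B *v \<psi> (group_center ?H #>\<^bsub>?H\<^esub> x)"
    using \<psi> f(2) group.int_pow_1[OF AutoGroup disc_osc_aut(1)[OF det]] by simp
  show ?thesis
    unfolding discrete_split_oscillator_group_def
  proof (rule exI[of _ ?H], rule exI[of _ ?\<phi>], intro conjI)
    show "group ?H" by (fact is_group)
    show "\<exists>r'\<ge>1. ?H \<cong> disc_heis r'"
      using r iso_refl by (intro exI[of _ r]) simp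
    show "?\<phi> \<in> hom integer_group (AutoGroup ?H)"
      by (rule disc_osc_action[OF det])
    show "disc_osc r B l = semidirect ?H integer_group ?\<phi>"
      by (simp add: disc_osc_def)
    show "\<exists>\<psi>\<in>iso (?H Mod group_center ?H) int_vec_group. \<exists>B. det B = 1 \<and> trace B > 2 \<and>
        (\<forall>x\<in>carrier ?H. \<psi> (group_center ?H #>\<^bsub>?H\<^esub> ?\<phi> 1 x) = B *v \<psi> (group_center ?H #>\<^bsub>?H\<^esub> x))"
      using iso det tr act by blast
  qed
qed

lemma heis_group_transfer:
  assumes "heis_group G r a b c" "group K" and h: "h \<in> iso G K"
  shows "heis_group K r (h a) (h b) (h c)"
proof -
  interpret G: heis_group G r a b c by fact
  interpret K: group K by fact
  interpret h: group_hom G K h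
    using h by (intro group_hom.intro group_hom_axioms.intro G.is_group assms) (simp add: iso_def)
  have "heis_triple K r (h a) (h b) (h c)"
  proof unfold_locales
    show "h a \<otimes>\<^bsub>K\<^esub> h b = h b \<otimes>\<^bsub>K\<^esub> h a \<otimes>\<^bsub>K\<^esub> h c [^]\<^bsub>K\<^esub> int r"
      using arg_cong[OF G.ab, of h] h.hom_int_pow[of c "int r"] by simp
    show "h a \<otimes>\<^bsub>K\<^esub> h c = h c \<otimes>\<^bsub>K\<^esub> h a"
      using arg_cong[OF G.ac, of h] by simp
    show "h b \<otimes>\<^bsub>K\<^esub> h c = h c \<otimes>\<^bsub>K\<^esub> h b"
      using arg_cong[OF G.bc, of h] by simp
  qed auto
  moreover have "bij_betw (normal_form K (h a) (h b) (h c)) UNIV (carrier K)"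
  proof -
    have "normal_form K (h a) (h b) (h c) = h \<circ> normal_form G a b c"
      using G.hom_normal_form[OF K.is_group h.homh] by auto
    then show ?thesis
      using bij_betw_trans[OF G.bij_normal_form] h by (auto simp: iso_def)
  qed
  ultimately show ?thesis by (simp add: heis_group_def heis_group_axioms_def)
qed

text \<open>Two identifications of the quotient by the centre with \<open>\<int>\<^sup>2\<close> differ by an invertible integral
matrix \<open>Q\<close>. The proof of the trace formula multiplies by the adjugate of \<open>Q\<close>, so that no inverse of
an integral matrix has to be formed.\<close>

lemma int_matrix_conjugate:
  fixes Q R B B' :: "int^2^2"
  assumes QR: "Q ** R = mat 1" and QB: "Q ** B' = B ** Q"
  shows "det B' = det B" "trace B' = trace B"
proof -
  have "det Q * det R = 1"
    using arg_cong[OF QR, of det] by (simp add: det_mul)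
  then have nz: "det Q \<noteq> 0" by auto
  moreover have "det Q * det B' = det B * det Q"
    using arg_cong[OF QB, of det] by (simp add: det_mul)
  ultimately show "det B' = det B" by simp
  define Q' :: "int^2^2" where "Q' = vector [vector [Q$2$2, - (Q$1$2)], vector [- (Q$2$1), Q$1$1]]"
  have Q': "Q' ** Q = mat (det Q)" "Q ** Q' = mat (det Q)"
    by (simp_all add: Q'_def vec_eq_iff forall_2 matrix_matrix_mult_def sum_2 mat_def det_2 algebra_simps)
  have sc: "trace (mat k ** M) = k * trace M" for k and M :: "int^2^2"
    by (simp add: trace_def sum_2 matrix_matrix_mult_def mat_def algebra_simps)
  have "det Q * trace B' = trace (Q' ** (Q ** B'))"
    by (simp add: matrix_mul_assoc Q' sc)
  also have "\<dots> = trace (Q ** Q' ** B)"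
    unfolding QB by (metis matrix_mul_assoc trace_mul_sym)
  also have "\<dots> = det Q * trace B" by (simp add: Q' sc)
  finally show "trace B' = trace B" using nz by simp
qed

text \<open>The given identification \<open>\<psi>\<close> of the quotient is compared with the one that comes from the generators
\<open>a, b, c\<close> of \<open>Hd\<close>; the matrix \<open>B'\<close> of the automorphism with respect to the latter is conjugate to the
given one. The exponents of \<open>c\<close> in the images of \<open>a\<close> and \<open>b\<close> are \<open>- l\<^sub>2\<close> and \<open>l\<^sub>1\<close>.\<close>

theorem discrete_split_is_disc_osc:
  fixes D :: "('a \<times> int) monoid"
  assumes "discrete_split_oscillator_group D"
  obtains r B l where "r > 0" "det B = 1" "trace B > 2" "D \<cong> disc_osc r B l" "group D"
proof -
  from assms obtain Hd :: "'a monoid" and \<phi> where Hd: "group Hd" and ex_r: "\<exists>r\<ge>1. Hd \<cong> disc_heis r"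
    and \<phi>: "\<phi> \<in> hom integer_group (AutoGroup Hd)"
    and ex_\<psi>: "\<exists>\<psi>\<in>iso (Hd Mod group_center Hd) int_vec_group. \<exists>B. det B = 1 \<and> trace B > 2 \<and>
        (\<forall>x\<in>carrier Hd. \<psi> (group_center Hd #>\<^bsub>Hd\<^esub> \<phi> 1 x) = B *v \<psi> (group_center Hd #>\<^bsub>Hd\<^esub> x))"
    and D: "D = semidirect Hd integer_group \<phi>"
    unfolding discrete_split_oscillator_group_def by (elim exE conjE) blast
  from ex_r obtain r where r: "r \<ge> 1" "Hd \<cong> disc_heis r" by blast
  from ex_\<psi> obtain \<psi> B where \<psi>: "\<psi> \<in> iso (Hd Mod group_center Hd) int_vec_group"
    and B: "det B = 1" "trace B > 2"
    and act: "\<And>x. x \<in> carrier Hd \<Longrightarrow>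
      \<psi> (group_center Hd #>\<^bsub>Hd\<^esub> \<phi> 1 x) = B *v \<psi> (group_center Hd #>\<^bsub>Hd\<^esub> x)"
    by blast
  obtain h where "h \<in> iso (disc_heis r) Hd"
    using group.iso_sym[OF Hd r(2)] by (auto simp: is_iso_def)
  from heis_group_transfer[OF heis_group_disc_heis Hd this]
  obtain a b c where "heis_group Hd r a b c" by blast
  then interpret heis_group Hd r a b c .
  interpret D: group D
    unfolding D by (intro group_semidirect Hd group_integer_group \<phi>)
  have r0: "r > 0" using r by simp
  let ?N = "normal_form Hd a b c" and ?Z = "group_center Hd"
  interpret Z: normal ?Z Hd by (rule center_normal[OF r0])
  define f where "f = \<phi> 1"
  have fA: "f \<in> carrier (AutoGroup Hd)"
    using \<phi> unfolding f_def hom_def by auto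
  note f_closed = AutoGroup_closed[OF fA]
  obtain p q m where fa: "f a = ?N (p, q, m)"
    using normal_form_cases[OF f_closed[OF a_closed]] by (metis prod_cases3)
  obtain p' q' n where fb: "f b = ?N (p', q', n)"
    using normal_form_cases[OF f_closed[OF b_closed]] by (metis prod_cases3)
  have "f c \<in> ?Z"
  proof -
    have "f c \<otimes>\<^bsub>Hd\<^esub> y = y \<otimes>\<^bsub>Hd\<^esub> f c" if "y \<in> carrier Hd" for y
    proof -
      obtain x where x: "x \<in> carrier Hd" "y = f x"
        using fA \<open>y \<in> carrier Hd\<close> by (auto simp: carrier_AutoGroup bij_betw_def)
      have "c \<otimes>\<^bsub>Hd\<^esub> x = x \<otimes>\<^bsub>Hd\<^esub> c"
      proof -
        have "c \<in> ?Z" unfolding group_center_eq[OF r0] using normal_form_gens(3)[symmetric] by blast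
        with x(1) show ?thesis unfolding group_center_def by blast
      qed
      then have "f (c \<otimes>\<^bsub>Hd\<^esub> x) = f (x \<otimes>\<^bsub>Hd\<^esub> c)" by simp
      then show ?thesis using x by (simp add: AutoGroup_mult[OF fA])
    qed
    then show ?thesis using f_closed[OF c_closed] unfolding group_center_def by blast
  qed
  then obtain e where fc: "f c = ?N (0, 0, e)"
    by (auto simp: group_center_eq[OF r0])
  define B' :: "int^2^2" where "B' = vector [vector [p, p'], vector [q, q']]"
  define l :: "int^2" where "l = vector [n, - m]"
  obtain \<pi> where \<pi>: "\<pi> \<in> hom Hd int_vec_group" "\<forall>x y k. \<pi> (?N (x, y, k)) = vector [x, y]"
    by (rule projection_hom)
  define \<kappa> where "\<kappa> x = \<psi> (?Z #>\<^bsub>Hd\<^esub> x)" for x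
  have \<kappa>: "\<kappa> \<in> hom Hd int_vec_group"
    using Group.hom_compose[OF Z.r_coset_hom_Mod, of \<psi> int_vec_group] \<psi>
    by (simp add: \<kappa>_def[abs_def] comp_def iso_def)
  \<comment> \<open>The columns are the coordinates of the classes of \<open>a\<close> and \<open>b\<close> under \<open>\<psi>\<close>.\<close>
  define Q :: "int^2^2" where "Q = vector [vector [\<kappa> a $ 1, \<kappa> b $ 1], vector [\<kappa> a $ 2, \<kappa> b $ 2]]"
  have gens: "\<pi> a = vector [1, 0]" "\<pi> b = vector [0, 1]" "\<pi> c = vector [0, 0]"
    using \<pi>(2)[rule_format, of 1 0 0] \<pi>(2)[rule_format, of 0 1 0] \<pi>(2)[rule_format, of 0 0 1] by (simp_all add: normal_form_gens)
  have \<kappa>Q: "\<kappa> x = Q *v \<pi> x" if "x \<in> carrier Hd" for x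
  proof (rule hom_eqI[OF group_int_vec_group \<kappa> hom_matrix_int_vec[OF \<pi>(1)] _ _ _ that])
    have "?Z #>\<^bsub>Hd\<^esub> c = \<one>\<^bsub>Hd Mod ?Z\<^esub>"
      unfolding one_FactGroup
      by (rule Z.rcos_const) (auto simp: group_center_eq[OF r0] intro!: exI[of _ 1] simp: normal_form_gens)
    then have "\<kappa> c = 0"
      using hom_one[of \<psi> "Hd Mod ?Z" int_vec_group] \<psi> Z.factorgroup_is_group group_int_vec_group
      by (simp add: \<kappa>_def iso_def)
    then show "\<kappa> c = Q *v \<pi> c"
      by (simp add: gens vec_eq_iff forall_2 matrix_vector_mult_def sum_2)
  qed (simp_all add: gens Q_def vec_eq_iff forall_2 matrix_vector_mult_def sum_2)
  have surj: "\<exists>x\<in>carrier Hd. \<kappa> x = v" for v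
  proof -
    have "v \<in> \<psi> ` carrier (Hd Mod ?Z)"
      using \<psi> by (simp add: iso_def bij_betw_def)
    then show ?thesis by (auto simp: carrier_FactGroup \<kappa>_def)
  qed
  \<comment> \<open>Preimages of the standard basis give the columns of a right inverse of \<open>Q\<close>.\<close>
  obtain x1 x2 where x12: "x1 \<in> carrier Hd" "\<kappa> x1 = vector [1, 0]" "x2 \<in> carrier Hd" "\<kappa> x2 = vector [0, 1]"
    using surj by metis
  define R :: "int^2^2" where "R = vector [vector [\<pi> x1 $ 1, \<pi> x2 $ 1], vector [\<pi> x1 $ 2, \<pi> x2 $ 2]]"
  have QR: "Q ** R = mat 1"
    using \<kappa>Q[OF x12(1)] \<kappa>Q[OF x12(3)] unfolding x12(2,4)
    by (simp add: R_def vec_eq_iff forall_2 matrix_matrix_mult_def matrix_vector_mult_def sum_2 mat_def)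
  have QB: "Q ** B' = B ** Q"
  proof -
    have "\<kappa> (f a) = B *v \<kappa> a" "\<kappa> (f b) = B *v \<kappa> b"
      by (simp_all add: \<kappa>_def f_def act)
    then have "Q *v vector [p, q] = B *v \<kappa> a" "Q *v vector [p', q'] = B *v \<kappa> b"
      by (simp_all add: fa fb \<kappa>Q \<pi>(2))
    then show ?thesis
      by (simp add: B'_def Q_def vec_eq_iff forall_2 matrix_matrix_mult_def matrix_vector_mult_def sum_2)
  qed
  have B': "det B' = 1" "trace B' > 2"
    using int_matrix_conjugate[OF QR QB] B by simp_all
  \<comment> \<open>Since \<open>\<gamma>\<^sup>r\<close> is a commutator, the automorphism scales the centre by \<open>det B'\<close>.\<close>
  have e: "e = 1"
  proof -
    have fM: "f (x \<otimes>\<^bsub>Hd\<^esub> y) = f x \<otimes>\<^bsub>Hd\<^esub> f y" if "x \<in> carrier Hd" "y \<in> carrier Hd" for x y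
      using AutoGroup_mult[OF fA that] .
    have fcr: "f (c [^]\<^bsub>Hd\<^esub> int r) = ?N (0, 0, e * int r)"
      using hom_int_pow[OF AutoGroup_hom[OF fA] c_closed is_group is_group, of "int r"]
      by (simp add: fc normal_form_def int_pow_pow)
    have "f a \<otimes>\<^bsub>Hd\<^esub> f b = f b \<otimes>\<^bsub>Hd\<^esub> f a \<otimes>\<^bsub>Hd\<^esub> f (c [^]\<^bsub>Hd\<^esub> int r)"
    proof -
      have "f (a \<otimes>\<^bsub>Hd\<^esub> b) = f (b \<otimes>\<^bsub>Hd\<^esub> a \<otimes>\<^bsub>Hd\<^esub> c [^]\<^bsub>Hd\<^esub> int r)"
        by (rule arg_cong[OF ab])
      then show ?thesis by (simp add: fM)
    qed
    then have "m + n - int r * q * p' = n + m - int r * q' * p + e * int r"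
      unfolding fa fb fcr by (simp add: normal_form_mult normal_form_eq_iff)
    then have "int r * (p * q' - p' * q) = int r * e"
      by (simp add: algebra_simps)
    then show ?thesis
      using B'(1) r0 by (simp add: B'_def det_2)
  qed
  have fc': "f c = c" using fc e by (simp add: normal_form_gens)
  \<comment> \<open>The generators inside \<open>D\<close> are \<open>\<iota> a\<close>, \<open>\<iota> b\<close>, \<open>\<iota> c\<close> and \<open>(\<one>, 1)\<close>.\<close>
  define \<iota> where "\<iota> x = (x, 0::int)" for x :: 'a
  interpret \<phi>: group_hom integer_group "AutoGroup Hd" \<phi>
    by (intro group_hom.intro group_hom_axioms.intro AutoGroup group_integer_group \<phi>)
  have \<phi>0: "\<phi> 0 x = x" if "x \<in> carrier Hd" for x
    using that \<phi>.hom_one by (simp add: one_AutoGroup)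
  have \<phi>1: "\<phi> k \<one>\<^bsub>Hd\<^esub> = \<one>\<^bsub>Hd\<^esub>" for k
    by (rule hom_one[OF AutoGroup_hom[OF \<phi>.hom_closed] is_group is_group]) simp
  have \<iota>: "\<iota> \<in> hom Hd D"
    by (rule homI) (auto simp: \<iota>_def D \<phi>0)
  interpret \<iota>: group_hom Hd D \<iota>
    by (intro group_hom.intro group_hom_axioms.intro is_group D.is_group \<iota>)
  have \<iota>N: "normal_form D (\<iota> a) (\<iota> b) (\<iota> c) p = \<iota> (?N p)" for p
    using hom_normal_form[OF D.is_group \<iota>] by simp
  have d: "(\<one>\<^bsub>Hd\<^esub>, 1) \<in> carrier D" by (simp add: D)
  have dpow: "(\<one>\<^bsub>Hd\<^esub>, 1) [^]\<^bsub>D\<^esub> k = (\<one>\<^bsub>Hd\<^esub>, k)" for k :: int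
  proof -
    have "(\<lambda>k. (\<one>\<^bsub>Hd\<^esub>, k)) \<in> hom integer_group D"
      by (rule homI) (auto simp: D \<phi>1)
    from hom_int_pow[OF this, of 1 k] show ?thesis by simp
  qed
  have conj: "(\<one>\<^bsub>Hd\<^esub>, 1) \<otimes>\<^bsub>D\<^esub> \<iota> x \<otimes>\<^bsub>D\<^esub> inv\<^bsub>D\<^esub> (\<one>\<^bsub>Hd\<^esub>, 1) = \<iota> (f x)" if "x \<in> carrier Hd" for x
  proof -
    have "(\<one>\<^bsub>Hd\<^esub>, 1) \<otimes>\<^bsub>D\<^esub> \<iota> x = \<iota> (f x) \<otimes>\<^bsub>D\<^esub> (\<one>\<^bsub>Hd\<^esub>, 1)"
      using that f_closed[OF that] by (simp add: D \<iota>_def \<phi>0 f_def[symmetric])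
    then show ?thesis
      using d that f_closed[OF that] by (simp add: D.inv_solve_right' D.m_assoc)
  qed
  have normal: "(\<lambda>(p, n). normal_form D (\<iota> a) (\<iota> b) (\<iota> c) p \<otimes>\<^bsub>D\<^esub> (\<one>\<^bsub>Hd\<^esub>, 1) [^]\<^bsub>D\<^esub> (n::int)) = map_prod ?N id"
    by (auto simp: \<iota>N dpow) (auto simp: \<iota>_def D \<phi>0)
  have bij: "bij_betw (map_prod ?N id) (UNIV \<times> UNIV) (carrier Hd \<times> (UNIV :: int set))"
    using bij_normal_form by (intro bij_betw_map_prod) auto
  have "D\<lparr>carrier := range (\<lambda>(p, n). normal_form D (\<iota> a) (\<iota> b) (\<iota> c) p \<otimes>\<^bsub>D\<^esub> (\<one>\<^bsub>Hd\<^esub>, 1) [^]\<^bsub>D\<^esub> (n::int))\<rparr>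
      \<cong> disc_osc r B' l"
  proof (rule disc_osc_recognition(2)[OF _ B'(1) d])
    show "heis_triple D r (\<iota> a) (\<iota> b) (\<iota> c)"
    proof unfold_locales
      show "\<iota> a \<otimes>\<^bsub>D\<^esub> \<iota> b = \<iota> b \<otimes>\<^bsub>D\<^esub> \<iota> a \<otimes>\<^bsub>D\<^esub> \<iota> c [^]\<^bsub>D\<^esub> int r"
        using arg_cong[OF ab, of \<iota>] \<iota>.hom_int_pow[of c "int r"] by simp
      show "\<iota> a \<otimes>\<^bsub>D\<^esub> \<iota> c = \<iota> c \<otimes>\<^bsub>D\<^esub> \<iota> a"
        using arg_cong[OF ac, of \<iota>] by simp
      show "\<iota> b \<otimes>\<^bsub>D\<^esub> \<iota> c = \<iota> c \<otimes>\<^bsub>D\<^esub> \<iota> b"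
        using arg_cong[OF bc, of \<iota>] by simp
    qed auto
    show "inj (\<lambda>(p, n). normal_form D (\<iota> a) (\<iota> b) (\<iota> c) p \<otimes>\<^bsub>D\<^esub> (\<one>\<^bsub>Hd\<^esub>, 1) [^]\<^bsub>D\<^esub> (n::int))"
      using bij unfolding normal by (simp add: bij_betw_def)
  qed (simp_all add: conj \<iota>N fa fb fc' B'_def l_def)
  moreover have "range (map_prod ?N id) = carrier D"
    using bij by (simp add: bij_betw_def D)
  ultimately have "D \<cong> disc_osc r B' l"
    unfolding normal by simp
  then show ?thesis using that r0 B' D.is_group by blast
qed

section \<open>The split oscillator group\<close>

text \<open>The matrix \<open>e\<^sup>t\<^sup>A\<close>, a hyperbolic rotation: see \<open>mat_exp_A_mat\<close>.\<close>

definition boost :: "real \<Rightarrow> real^2^2" where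
  "boost t = vector [vector [cosh t, sinh t], vector [sinh t, cosh t]]"

text \<open>Since \<open>A\<^sup>2 = 1\<close>, the even terms of the exponential series sum to \<open>cosh t\<close> and the odd ones to \<open>sinh t\<close>
times \<open>A\<close>.\<close>

lemma mat_exp_A_mat: "mat_exp (t *\<^sub>R A_mat) = boost t"
proof -
  have mul: "(t *\<^sub>R A_mat) ** (x *\<^sub>R mat 1 + y *\<^sub>R A_mat) = (t * y) *\<^sub>R mat 1 + (t * x) *\<^sub>R A_mat" for x y :: real
    by (simp add: vec_eq_iff forall_2 matrix_matrix_mult_def sum_2 mat_def A_mat_def)
  have pow: "((**) (t *\<^sub>R A_mat) ^^ n) (mat 1) =
      (if even n then t ^ n else 0) *\<^sub>R mat 1 + (if even n then 0 else t ^ n) *\<^sub>R A_mat" for n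
    by (induction n) (simp_all add: mul)
  have "(\<lambda>n. (if even n then t ^ n /\<^sub>R fact n else 0) *\<^sub>R (mat 1 :: real^2^2)
      + (if even n then 0 else t ^ n /\<^sub>R fact n) *\<^sub>R A_mat) sums (cosh t *\<^sub>R mat 1 + sinh t *\<^sub>R A_mat)"
    by (intro sums_add bounded_linear.sums[OF bounded_linear_scaleR_left] cosh_converges sinh_converges)
  also have "(\<lambda>n. (if even n then t ^ n /\<^sub>R fact n else 0) *\<^sub>R (mat 1 :: real^2^2)
      + (if even n then 0 else t ^ n /\<^sub>R fact n) *\<^sub>R A_mat)
      = (\<lambda>n. (1 / fact n) *\<^sub>R (((**) (t *\<^sub>R A_mat) ^^ n) (mat 1)))"
    by (auto simp: pow fun_eq_iff divide_inverse mult.commute)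
  also have "cosh t *\<^sub>R mat 1 + sinh t *\<^sub>R A_mat = boost t"
    by (simp add: vec_eq_iff forall_2 mat_def A_mat_def boost_def)
  finally show ?thesis
    unfolding mat_exp_def by (simp add: sums_iff)
qed

lemma boost_mult_vec [simp]:
  "(boost t *v \<xi>) $ 1 = cosh t * \<xi>$1 + sinh t * \<xi>$2"
  "(boost t *v \<xi>) $ 2 = sinh t * \<xi>$1 + cosh t * \<xi>$2"
  by (simp_all add: boost_def matrix_vector_mult_def sum_2)

lemma boost_0 [simp]: "boost 0 *v \<xi> = \<xi>"
  by (simp add: vec_eq_iff forall_2)

lemma boost_add: "boost s *v (boost t *v \<xi>) = boost (s + t) *v \<xi>"
  by (simp add: vec_eq_iff forall_2 cosh_add sinh_add algebra_simps)

lemma cosh_square: "cosh t * cosh t - sinh t * sinh t = (1::real)"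
  using hyperbolic_pythagoras[of t] by (simp add: power2_eq_square)

lemma det_boost: "det (boost t) = 1"
  using cosh_square by (simp add: boost_def det_2)

lemma trace_boost: "trace (boost t) = exp t + exp (- t)"
  by (simp add: trace_def sum_2 boost_def cosh_def)

lemma omega_boost: "omega (boost t *v \<xi>) (boost t *v \<xi>') = omega \<xi> \<xi>'"
proof -
  have "omega (boost t *v \<xi>) (boost t *v \<xi>') = (cosh t * cosh t - sinh t * sinh t) * omega \<xi> \<xi>'"
    by (simp add: omega_def algebra_simps)
  then show ?thesis by (simp add: cosh_square)
qed

text \<open>The trace expressed through the symplectic form. It is used for vectors that span a lattice in
the plane, where it shows that the trace of the integral matrix is \<open>e\<^sup>t + e\<^sup>-\<^sup>t\<close>.\<close>

lemma omega_trace_boost: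
  "omega (boost t *v \<xi>) \<xi>' + omega \<xi> (boost t *v \<xi>') = (exp t + exp (- t)) * omega \<xi> \<xi>'"
proof -
  have "exp t + exp (- t) = cosh t + cosh t" by (simp add: cosh_def)
  then show ?thesis by (simp add: omega_def algebra_simps)
qed

lemma omega_simps [simp]:
  "omega (\<xi> + \<xi>') \<zeta> = omega \<xi> \<zeta> + omega \<xi>' \<zeta>"
  "omega \<xi> (\<zeta> + \<zeta>') = omega \<xi> \<zeta> + omega \<xi> \<zeta>'"
  "omega (\<xi> - \<xi>') \<zeta> = omega \<xi> \<zeta> - omega \<xi>' \<zeta>"
  "omega \<xi> (\<zeta> - \<zeta>') = omega \<xi> \<zeta> - omega \<xi> \<zeta>'"
  "omega (- \<xi>) \<zeta> = - omega \<xi> \<zeta>"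
  "omega \<xi> (- \<zeta>) = - omega \<xi> \<zeta>"
  "omega (x *\<^sub>R \<xi>) \<zeta> = x * omega \<xi> \<zeta>"
  "omega \<xi> (x *\<^sub>R \<zeta>) = x * omega \<xi> \<zeta>"
  "omega \<xi> \<xi> = 0"
  "omega 0 \<zeta> = 0" "omega \<xi> 0 = 0"
  by (simp_all add: omega_def algebra_simps)

lemma omega_swap: "omega \<xi> \<zeta> = - omega \<zeta> \<xi>"
  by (simp add: omega_def)

lemma omega_mult_vec: "omega (P *v \<xi>) (P *v \<zeta>) = det P * omega \<xi> \<zeta>"
  by (simp add: omega_def matrix_vector_mult_def sum_2 det_2 algebra_simps)

lemma Osc_simps [simp]:
  "carrier Osc = UNIV"
  "(z, \<xi>, t) \<otimes>\<^bsub>Osc\<^esub> (z', \<xi>', t') =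
    (z + z' + omega \<xi> (boost t *v \<xi>') / 2, \<xi> + boost t *v \<xi>', t + t')"
  "\<one>\<^bsub>Osc\<^esub> = (0, 0, 0)"
  by (simp_all add: Osc_def mat_exp_A_mat)

lemma group_Osc: "group Osc"
proof (rule groupI)
  fix x y w :: osc
  obtain z \<xi> t z' \<xi>' t' z'' \<xi>'' t''
    where "x = (z, \<xi>, t)" "y = (z', \<xi>', t')" "w = (z'', \<xi>'', t'')"
    by (cases x, cases y, cases w) auto
  then show "x \<otimes>\<^bsub>Osc\<^esub> y \<otimes>\<^bsub>Osc\<^esub> w = x \<otimes>\<^bsub>Osc\<^esub> (y \<otimes>\<^bsub>Osc\<^esub> w)"
    by (simp add: boost_add[symmetric] omega_boost matrix_vector_right_distrib add_divide_distrib)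
next
  fix x :: osc
  obtain z \<xi> t where x: "x = (z, \<xi>, t)" by (cases x)
  show "\<exists>y\<in>carrier Osc. y \<otimes>\<^bsub>Osc\<^esub> x = \<one>\<^bsub>Osc\<^esub>"
    by (rule bexI[of _ "(- z, - (boost (- t) *v \<xi>), - t)"]) (auto simp: x)
qed auto

interpretation Osc: group Osc
  by (rule group_Osc)

abbreviation osc_mult :: "osc \<Rightarrow> osc \<Rightarrow> osc" (infixl "\<cdot>" 70) where
  "x \<cdot> y \<equiv> x \<otimes>\<^bsub>Osc\<^esub> y"

abbreviation oinv :: "osc \<Rightarrow> osc" where
  "oinv x \<equiv> inv\<^bsub>Osc\<^esub> x"

\<comment> \<open>Quantifiers over group elements are not to be split into quantifiers over coordinates.\<close>
declare split_paired_All [simp del] split_paired_Ex [simp del]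

lemma Osc_assoc: "x \<cdot> y \<cdot> w = x \<cdot> (y \<cdot> w)"
  by (rule Osc.m_assoc) simp_all

lemma Osc_zero_mult [simp]: "(0, 0, 0) \<cdot> x = x" "x \<cdot> (0, 0, 0) = x"
  using Osc.l_one[of x] Osc.r_one[of x] by simp_all

lemma Osc_inv: "oinv (z, \<xi>, t) = (- z, - (boost (- t) *v \<xi>), - t)"
  by (rule Osc.inv_equality) auto

lemma Osc_conj:
  "(z, \<xi>, t) \<cdot> (z', \<xi>', 0) \<cdot> oinv (z, \<xi>, t) =
    (z' + omega \<xi> (boost t *v \<xi>'), boost t *v \<xi>', 0)"
proof -
  have "(z, \<xi>, t) \<cdot> (z', \<xi>', 0) =
      (z' + omega \<xi> (boost t *v \<xi>'), boost t *v \<xi>', 0) \<cdot> (z, \<xi>, t)"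
    using omega_swap[of "boost t *v \<xi>'" \<xi>] by (simp add: add.commute)
  then show ?thesis by (simp add: Osc.inv_solve_right')
qed

lemma Osc_heis_pow: "(z, \<xi>, 0) [^]\<^bsub>Osc\<^esub> (n::int) = (of_int n * z, of_int n *\<^sub>R \<xi>, 0)"
proof -
  have "(\<lambda>n. (of_int n * z, of_int n *\<^sub>R \<xi>, 0)) \<in> hom integer_group Osc"
    by (rule homI) (auto simp: algebra_simps)
  from hom_int_pow[OF this, of 1 n] show ?thesis by (simp add: group_Osc)
qed

lemma Osc_normal_form:
  "normal_form Osc (z1, \<xi>1, 0) (z2, \<xi>2, 0) (z3, 0, 0) (x, y, k) =
    (of_int x * z1 + of_int y * z2 + of_int k * z3 + of_int (x * y) * omega \<xi>1 \<xi>2 / 2,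
     of_int x *\<^sub>R \<xi>1 + of_int y *\<^sub>R \<xi>2, 0)"
  by (simp add: normal_form_def Osc_heis_pow)

lemma Osc_heis_triple:
  assumes "omega \<xi>1 \<xi>2 = real r * z3"
  shows "heis_triple Osc r (z1, \<xi>1, 0) (z2, \<xi>2, 0) (z3, 0, 0)"
  by unfold_locales (use assms omega_swap[of \<xi>2 \<xi>1] in \<open>auto simp: Osc_heis_pow algebra_simps\<close>)

lemma Osc_pow_time: "snd (snd (g [^]\<^bsub>Osc\<^esub> (n::int))) = of_int n * snd (snd g)"
proof -
  have "(\<lambda>g. snd (snd g)) \<in> hom Osc \<lparr>carrier = UNIV, mult = (+), one = 0 :: real\<rparr>" (is "_ \<in> hom Osc ?R")
    by (rule homI) auto
  moreover have R: "group ?R"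
    by (rule groupI) (auto intro: exI[of _ "- _"])
  moreover have "x [^]\<^bsub>?R\<^esub> n = of_int n * x" for x
  proof -
    have "(\<lambda>n. of_int n * x) \<in> hom integer_group ?R"
      by (rule homI) (auto simp: algebra_simps)
    from hom_int_pow[OF this, of 1 n] show ?thesis using R by simp
  qed
  ultimately show ?thesis
    using hom_int_pow[of "\<lambda>g. snd (snd g)" Osc ?R g n] group_Osc by simp
qed

lemma continuous_on_boost [continuous_intros]:
  fixes f :: "'a::topological_space \<Rightarrow> real" and g :: "'a \<Rightarrow> real^2"
  assumes "continuous_on S f" "continuous_on S g"
  shows "continuous_on S (\<lambda>x. boost (f x) *v g x)"
proof -
  have "boost t *v \<xi> = (cosh t * \<xi>$1 + sinh t * \<xi>$2) *\<^sub>R axis 1 1 + (sinh t * \<xi>$1 + cosh t * \<xi>$2) *\<^sub>R axis 2 1" for t \<xi>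
    by (simp add: vec_eq_iff forall_2 axis_def)
  then show ?thesis
    using assms by (auto intro!: continuous_intros)
qed

lemma continuous_on_omega [continuous_intros]:
  fixes f g :: "'a::topological_space \<Rightarrow> real^2"
  assumes "continuous_on S f" "continuous_on S g"
  shows "continuous_on S (\<lambda>x. omega (f x) (g x))"
  unfolding omega_def using assms by (intro continuous_intros)

lemma continuous_on_Osc_mult [continuous_intros]:
  fixes f g :: "'a::topological_space \<Rightarrow> osc"
  assumes "continuous_on S f" "continuous_on S g"
  shows "continuous_on S (\<lambda>x. f x \<cdot> g x)"
proof -
  have "p \<cdot> q = (fst p + fst q + omega (fst (snd p)) (boost (snd (snd p)) *v fst (snd q)) / 2,
      fst (snd p) + boost (snd (snd p)) *v fst (snd q), snd (snd p) + snd (snd q))" for p q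
    by (cases p; cases q) simp
  then show ?thesis
    using assms by (auto intro!: continuous_intros)
qed

lemma open_Osc_left_vimage: "open U \<Longrightarrow> open ((\<lambda>x. g \<cdot> x) -` U)"
  by (intro open_vimage continuous_intros)

lemma open_Osc_right_vimage: "open U \<Longrightarrow> open ((\<lambda>x. x \<cdot> g) -` U)"
  by (intro open_vimage continuous_intros)

section \<open>Lebesgue measure is a two-sided Haar measure\<close>

text \<open>The determinant is \<open>1\<close>, so boxes and their images have the same volume.\<close>

lemma lborel_distr_boost: "distr lborel borel ((*v) (boost t)) = (lborel :: (real^2) measure)"
proof (rule lborel_eqI[symmetric])
  fix l u :: "real^2" assume lu: "\<And>b. b \<in> Basis \<Longrightarrow> l \<bullet> b \<le> u \<bullet> b"
  have cont: "(*v) (boost t) \<in> borel_measurable borel"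
    by (intro borel_measurable_continuous_onI continuous_intros)
  have lin: "linear ((*v) (boost (- t)))" by simp
  have im: "(*v) (boost t) -` box l u = (*v) (boost (- t)) ` box l u"
  proof (intro equalityI subsetI)
    fix x assume "x \<in> (*v) (boost t) -` box l u"
    then show "x \<in> (*v) (boost (- t)) ` box l u"
      by (intro image_eqI[of _ _ "boost t *v x"]) (simp_all add: boost_add)
  qed (auto simp: boost_add)
  have "emeasure (distr lborel borel ((*v) (boost t))) (box l u) = emeasure lebesgue ((*v) (boost (- t)) ` box l u)"
    using cont by (simp add: emeasure_distr im[symmetric] measurable_sets_borel)
  also have "\<dots> = ennreal (measure lebesgue ((*v) (boost (- t)) ` box l u))"
    using measurable_linear_image[OF lin lmeasurable_box] by (rule emeasure_eq_measure2)
  also have "\<dots> = ennreal (measure lebesgue (box l u))"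
    using measure_linear_image[OF lin lmeasurable_box] by (simp add: det_boost)
  also have "\<dots> = (\<Prod>b\<in>Basis. (u - l) \<bullet> b)"
    using lu by (simp add: measure_lborel_box_eq)
  finally show "emeasure (distr lborel borel ((*v) (boost t))) (box l u) = (\<Prod>b\<in>Basis. (u - l) \<bullet> b)" .
qed simp

lemma nn_integral_lborel_translate:
  fixes f :: "'a::euclidean_space \<Rightarrow> ennreal"
  assumes "f \<in> borel_measurable borel"
  shows "(\<integral>\<^sup>+x. f (c + x) \<partial>lborel) = (\<integral>\<^sup>+x. f x \<partial>lborel)"
  using assms by (subst (2) lborel_distr_plus[of c, symmetric]) (simp add: nn_integral_distr)

lemma nn_integral_lborel_boost:
  assumes "f \<in> borel_measurable borel"
  shows "(\<integral>\<^sup>+\<xi>. f (boost t *v \<xi>) \<partial>lborel) = (\<integral>\<^sup>+\<xi>. f \<xi> \<partial>lborel)"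
proof -
  have "(*v) (boost t) \<in> borel_measurable borel"
    by (intro borel_measurable_continuous_onI continuous_intros)
  then show ?thesis
    using assms by (subst (2) lborel_distr_boost[of t, symmetric]) (simp add: nn_integral_distr)
qed

text \<open>The order of integration is the one in which translations are triangular: a translation shifts \<open>z\<close>
by a function of \<open>\<xi>\<close> and \<open>t\<close>, and \<open>\<xi>\<close> by a function of \<open>t\<close>, up to a boost.\<close>

lemma nn_integral_osc:
  fixes f :: "osc \<Rightarrow> ennreal"
  assumes f: "f \<in> borel_measurable borel"
  shows "(\<integral>\<^sup>+x. f x \<partial>lborel) = (\<integral>\<^sup>+t. \<integral>\<^sup>+\<xi>. \<integral>\<^sup>+z. f (z, \<xi>, t) \<partial>lborel \<partial>lborel \<partial>lborel)"
proof -
  have f': "f \<in> borel_measurable (lborel \<Otimes>\<^sub>M (lborel \<Otimes>\<^sub>M lborel))"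
    using f by (simp add: lborel_prod)
  have "(\<integral>\<^sup>+x. f x \<partial>lborel) = (\<integral>\<^sup>+x. f x \<partial>(lborel \<Otimes>\<^sub>M lborel))"
    by (simp add: lborel_prod)
  also have "\<dots> = (\<integral>\<^sup>+q. \<integral>\<^sup>+z. f (z, q) \<partial>lborel \<partial>lborel)"
    by (rule lborel_pair.nn_integral_snd[symmetric]) (use f in \<open>simp add: lborel_prod\<close>)
  also have "\<dots> = (\<integral>\<^sup>+q. \<integral>\<^sup>+z. f (z, q) \<partial>lborel \<partial>(lborel \<Otimes>\<^sub>M lborel))"
    by (simp add: lborel_prod)
  also have "\<dots> = (\<integral>\<^sup>+t. \<integral>\<^sup>+\<xi>. \<integral>\<^sup>+z. f (z, \<xi>, t) \<partial>lborel \<partial>lborel \<partial>lborel)"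
    by (rule lborel_pair.nn_integral_snd[symmetric]) (use f' in measurable)
  finally show ?thesis .
qed

lemma measurable_Osc_mult [measurable]:
  "(\<lambda>x. g \<cdot> x) \<in> borel_measurable borel" "(\<lambda>x. x \<cdot> g) \<in> borel_measurable borel"
  by (intro borel_measurable_continuous_onI continuous_intros)+

lemma vimage_Osc_mult:
  assumes "U \<in> sets borel"
  shows "(\<lambda>x. g \<cdot> x) -` U \<in> sets borel" "(\<lambda>x. x \<cdot> g) -` U \<in> sets borel"
  using measurable_sets_borel[OF measurable_Osc_mult(1) assms] measurable_sets_borel[OF measurable_Osc_mult(2) assms]
  by blast+

lemma borel_measurable_osc_sections:
  assumes f: "f \<in> borel_measurable (borel :: osc measure)"
  shows "(\<lambda>z. f (z, q)) \<in> borel_measurable borel"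
    and "(\<lambda>\<xi>. \<integral>\<^sup>+z. f (z, \<xi>, t) \<partial>lborel) \<in> borel_measurable borel"
    and "(\<lambda>t. \<integral>\<^sup>+\<xi>. \<integral>\<^sup>+z. f (z, \<xi>, t) \<partial>lborel \<partial>lborel) \<in> borel_measurable borel"
proof -
  have f': "f \<in> borel_measurable (borel \<Otimes>\<^sub>M (borel \<Otimes>\<^sub>M borel))"
    using f by (simp add: borel_prod)
  then have f'' [measurable]: "f \<in> borel_measurable (lborel \<Otimes>\<^sub>M (lborel \<Otimes>\<^sub>M lborel))"
    by (simp cong: measurable_cong_sets sets_pair_measure_cong)
  show "(\<lambda>z. f (z, q)) \<in> borel_measurable borel"
    using f by (rule measurable_compose[rotated]) (intro borel_measurable_continuous_onI continuous_intros)
  have "(\<lambda>\<xi>. \<integral>\<^sup>+z. f (z, \<xi>, t) \<partial>lborel) \<in> borel_measurable lborel"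
    by measurable
  then show "(\<lambda>\<xi>. \<integral>\<^sup>+z. f (z, \<xi>, t) \<partial>lborel) \<in> borel_measurable borel"
    by simp
  have "(\<lambda>t. \<integral>\<^sup>+\<xi>. \<integral>\<^sup>+z. f (z, \<xi>, t) \<partial>lborel \<partial>lborel) \<in> borel_measurable lborel"
    by measurable
  then show "(\<lambda>t. \<integral>\<^sup>+\<xi>. \<integral>\<^sup>+z. f (z, \<xi>, t) \<partial>lborel \<partial>lborel) \<in> borel_measurable borel"
    by simp
qed

lemma nn_integral_Osc_left:
  assumes f: "f \<in> borel_measurable borel"
  shows "(\<integral>\<^sup>+x. f (g \<cdot> x) \<partial>lborel) = (\<integral>\<^sup>+x. f x \<partial>lborel)"
proof -
  obtain z' \<xi>' t' where g: "g = (z', \<xi>', t')" by (cases g)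
  note sec = borel_measurable_osc_sections[OF f]
  have "(\<integral>\<^sup>+x. f (g \<cdot> x) \<partial>lborel) = (\<integral>\<^sup>+t. \<integral>\<^sup>+\<xi>. \<integral>\<^sup>+z. f (g \<cdot> (z, \<xi>, t)) \<partial>lborel \<partial>lborel \<partial>lborel)"
    by (rule nn_integral_osc) (use f in measurable)
  also have "\<dots> = (\<integral>\<^sup>+t. \<integral>\<^sup>+\<xi>. \<integral>\<^sup>+z. f ((z' + omega \<xi>' (boost t' *v \<xi>) / 2) + z, \<xi>' + boost t' *v \<xi>, t' + t) \<partial>lborel \<partial>lborel \<partial>lborel)"
    by (simp add: g algebra_simps)
  also have "\<dots> = (\<integral>\<^sup>+t. \<integral>\<^sup>+\<xi>. \<integral>\<^sup>+z. f (z, \<xi>' + boost t' *v \<xi>, t' + t) \<partial>lborel \<partial>lborel \<partial>lborel)"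
    by (intro nn_integral_cong nn_integral_lborel_translate sec)
  also have "\<dots> = (\<integral>\<^sup>+t. \<integral>\<^sup>+\<xi>. \<integral>\<^sup>+z. f (z, \<xi>' + \<xi>, t' + t) \<partial>lborel \<partial>lborel \<partial>lborel)"
  proof (rule nn_integral_cong)
    fix t
    have "(\<lambda>\<xi>. \<integral>\<^sup>+z. f (z, \<xi>' + \<xi>, t' + t) \<partial>lborel) \<in> borel_measurable borel"
      by (rule measurable_compose[OF _ sec(2)]) simp
    from nn_integral_lborel_boost[OF this]
    show "(\<integral>\<^sup>+\<xi>. \<integral>\<^sup>+z. f (z, \<xi>' + boost t' *v \<xi>, t' + t) \<partial>lborel \<partial>lborel) =
      (\<integral>\<^sup>+\<xi>. \<integral>\<^sup>+z. f (z, \<xi>' + \<xi>, t' + t) \<partial>lborel \<partial>lborel)" .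
  qed
  also have "\<dots> = (\<integral>\<^sup>+t. \<integral>\<^sup>+\<xi>. \<integral>\<^sup>+z. f (z, \<xi>, t' + t) \<partial>lborel \<partial>lborel \<partial>lborel)"
    by (intro nn_integral_cong nn_integral_lborel_translate[where f = "\<lambda>\<xi>. \<integral>\<^sup>+z. f (z, \<xi>, _) \<partial>lborel"] sec)
  also have "\<dots> = (\<integral>\<^sup>+t. \<integral>\<^sup>+\<xi>. \<integral>\<^sup>+z. f (z, \<xi>, t) \<partial>lborel \<partial>lborel \<partial>lborel)"
    by (rule nn_integral_lborel_translate[OF sec(3)])
  also have "\<dots> = (\<integral>\<^sup>+x. f x \<partial>lborel)"
    by (rule nn_integral_osc[OF f, symmetric])
  finally show ?thesis .
qed

lemma nn_integral_Osc_right: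
  assumes f: "f \<in> borel_measurable borel"
  shows "(\<integral>\<^sup>+x. f (x \<cdot> g) \<partial>lborel) = (\<integral>\<^sup>+x. f x \<partial>lborel)"
proof -
  obtain z' \<xi>' t' where g: "g = (z', \<xi>', t')" by (cases g)
  note sec = borel_measurable_osc_sections[OF f]
  have "(\<integral>\<^sup>+x. f (x \<cdot> g) \<partial>lborel) = (\<integral>\<^sup>+t. \<integral>\<^sup>+\<xi>. \<integral>\<^sup>+z. f ((z, \<xi>, t) \<cdot> g) \<partial>lborel \<partial>lborel \<partial>lborel)"
    by (rule nn_integral_osc) (use f in measurable)
  also have "\<dots> = (\<integral>\<^sup>+t. \<integral>\<^sup>+\<xi>. \<integral>\<^sup>+z. f ((z' + omega \<xi> (boost t *v \<xi>') / 2) + z, boost t *v \<xi>' + \<xi>, t' + t) \<partial>lborel \<partial>lborel \<partial>lborel)"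
    by (simp add: g algebra_simps)
  also have "\<dots> = (\<integral>\<^sup>+t. \<integral>\<^sup>+\<xi>. \<integral>\<^sup>+z. f (z, boost t *v \<xi>' + \<xi>, t' + t) \<partial>lborel \<partial>lborel \<partial>lborel)"
    by (intro nn_integral_cong nn_integral_lborel_translate sec)
  also have "\<dots> = (\<integral>\<^sup>+t. \<integral>\<^sup>+\<xi>. \<integral>\<^sup>+z. f (z, \<xi>, t' + t) \<partial>lborel \<partial>lborel \<partial>lborel)"
    by (intro nn_integral_cong nn_integral_lborel_translate[where f = "\<lambda>\<xi>. \<integral>\<^sup>+z. f (z, \<xi>, _) \<partial>lborel"] sec)
  also have "\<dots> = (\<integral>\<^sup>+t. \<integral>\<^sup>+\<xi>. \<integral>\<^sup>+z. f (z, \<xi>, t) \<partial>lborel \<partial>lborel \<partial>lborel)"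
    by (rule nn_integral_lborel_translate[OF sec(3)])
  also have "\<dots> = (\<integral>\<^sup>+x. f x \<partial>lborel)"
    by (rule nn_integral_osc[OF f, symmetric])
  finally show ?thesis .
qed

lemma emeasure_Osc_translate:
  assumes U: "U \<in> sets borel"
  shows "emeasure lborel ((\<lambda>x. g \<cdot> x) -` U) = emeasure lborel U"
    and "emeasure lborel ((\<lambda>x. x \<cdot> g) -` U) = emeasure lborel U"
proof -
  have ind: "(indicator U :: osc \<Rightarrow> ennreal) \<in> borel_measurable borel"
    using U by simp
  note vimage_Osc_mult[OF U, of g]
  moreover have "indicator ((\<lambda>x. g \<cdot> x) -` U) x = (indicator U (g \<cdot> x) :: ennreal)"
    "indicator ((\<lambda>x. x \<cdot> g) -` U) x = (indicator U (x \<cdot> g) :: ennreal)" for x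
    by (simp_all add: indicator_def)
  ultimately show "emeasure lborel ((\<lambda>x. g \<cdot> x) -` U) = emeasure lborel U"
    "emeasure lborel ((\<lambda>x. x \<cdot> g) -` U) = emeasure lborel U"
    using nn_integral_Osc_left[OF ind, of g] nn_integral_Osc_right[OF ind, of g] U
    by (simp_all flip: nn_integral_indicator)
qed

section \<open>Fundamental domains and lattices\<close>

text \<open>A strict fundamental domain for the action of \<open>L\<close> by left multiplication.\<close>

definition fundamental_domain :: "osc set \<Rightarrow> osc set \<Rightarrow> bool" where
  "fundamental_domain L F \<longleftrightarrow> F \<in> sets borel \<and> (\<forall>x. \<exists>!l. l \<in> L \<and> l \<cdot> x \<in> F)"

lemma fundamental_domain_right_translate:
  assumes "fundamental_domain L F"
  shows "fundamental_domain L ((\<lambda>x. x \<cdot> g) -` F)"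
  unfolding fundamental_domain_def
proof (intro conjI allI)
  show "(\<lambda>x. x \<cdot> g) -` F \<in> sets borel"
    using assms by (intro vimage_Osc_mult) (simp add: fundamental_domain_def)
  fix x
  have "\<exists>!l. l \<in> L \<and> l \<cdot> (x \<cdot> g) \<in> F"
    using assms by (simp add: fundamental_domain_def)
  then show "\<exists>!l. l \<in> L \<and> l \<cdot> x \<in> (\<lambda>x. x \<cdot> g) -` F"
    by (simp only: vimage_eq Osc_assoc)
qed

text \<open>Cut \<open>F\<close> into the countably many pieces that a given \<open>l\<close> moves into \<open>F'\<close>. Translating each piece by
its \<open>l\<close> reassembles them to \<open>F'\<close>, and the invariant set \<open>W\<close> is carried along.\<close>

lemma emeasure_fundamental_domain_cong:
  assumes L: "subgroup L Osc" "countable L"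
    and F: "fundamental_domain L F" "fundamental_domain L F'"
    and W: "W \<in> sets borel" "\<And>l x. l \<in> L \<Longrightarrow> l \<cdot> x \<in> W \<longleftrightarrow> x \<in> W"
  shows "emeasure lborel (F \<inter> W) = emeasure lborel (F' \<inter> W)"
proof -
  interpret L: subgroup L Osc by fact
  have Fb [measurable]: "F \<in> sets borel" "F' \<in> sets borel"
    and ex: "\<And>x. \<exists>!l. l \<in> L \<and> l \<cdot> x \<in> F" "\<And>x. \<exists>!l. l \<in> L \<and> l \<cdot> x \<in> F'"
    using F by (simp_all add: fundamental_domain_def)
  note W(1) [measurable]
  have uniq: "l \<in> L \<Longrightarrow> m \<in> L \<Longrightarrow> l \<cdot> x \<in> F \<Longrightarrow> m \<cdot> x \<in> F \<Longrightarrow> l = m"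
    "l \<in> L \<Longrightarrow> m \<in> L \<Longrightarrow> l \<cdot> x \<in> F' \<Longrightarrow> m \<cdot> x \<in> F' \<Longrightarrow> l = m" for l m x
    using ex(1)[of x] ex(2)[of x] by blast+
  have tr [measurable]: "(\<lambda>x. l \<cdot> x) -` F \<in> sets borel" "(\<lambda>x. l \<cdot> x) -` F' \<in> sets borel" for l
    using Fb by (simp_all add: vimage_Osc_mult)
  have inv_cancel: "oinv l \<cdot> (l \<cdot> x) = x" "l \<cdot> (oinv l \<cdot> x) = x" for l x
    by (simp_all add: Osc.m_assoc[symmetric])
  let ?X = "\<lambda>l. F \<inter> W \<inter> (\<lambda>x. l \<cdot> x) -` F'"
  let ?Y = "\<lambda>l. F' \<inter> W \<inter> (\<lambda>x. oinv l \<cdot> x) -` F"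
  have "emeasure lborel (F \<inter> W) = emeasure lborel (\<Union>l\<in>L. ?X l)"
  proof (rule arg_cong[of _ _ "emeasure lborel"], intro equalityI subsetI)
    fix x assume "x \<in> F \<inter> W"
    moreover obtain l where "l \<in> L" "l \<cdot> x \<in> F'" using ex1_implies_ex[OF ex(2)[of x]] by blast
    ultimately show "x \<in> (\<Union>l\<in>L. ?X l)" by auto
  qed auto
  also have "\<dots> = (\<integral>\<^sup>+l. emeasure lborel (?X l) \<partial>count_space L)"
  proof (rule emeasure_UN_countable)
    show "disjoint_family_on ?X L"
      unfolding disjoint_family_on_def using uniq(2) by blast
  qed (use L(2) in auto)
  also have "\<dots> = (\<integral>\<^sup>+l. emeasure lborel (?Y l) \<partial>count_space L)"
  proof (rule nn_integral_cong)
    fix l assume "l \<in> space (count_space L)"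
    then have l: "l \<in> L" by simp
    have Y: "?Y l = (\<lambda>x. oinv l \<cdot> x) -` ?X l"
      by (rule Set.set_eqI) (simp add: inv_cancel W(2)[OF L.m_inv_closed[OF l]] conj_ac)
    show "emeasure lborel (?X l) = emeasure lborel (?Y l)"
      unfolding Y by (rule emeasure_Osc_translate(1)[symmetric]) measurable
  qed
  also have "\<dots> = emeasure lborel (\<Union>l\<in>L. ?Y l)"
  proof (rule emeasure_UN_countable[symmetric])
    show "disjoint_family_on ?Y L"
      unfolding disjoint_family_on_def
    proof (intro ballI impI)
      fix m n assume "m \<in> L" "n \<in> L" "m \<noteq> n"
      have "m = n" if "oinv m = oinv n"
        using arg_cong[OF that, of "\<lambda>x. oinv x"] by simp
      with \<open>m \<in> L\<close> \<open>n \<in> L\<close> \<open>m \<noteq> n\<close>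
      have "oinv m \<in> L" "oinv n \<in> L" "oinv m \<noteq> oinv n"
        by blast+
      then show "?Y m \<inter> ?Y n = {}" using uniq(1) by blast
    qed
  qed (use L(2) in auto)
  also have "(\<Union>l\<in>L. ?Y l) = F' \<inter> W"
  proof -
    have "\<exists>l\<in>L. oinv l \<cdot> x \<in> F" for x
    proof -
      obtain l where "l \<in> L" "l \<cdot> x \<in> F" using ex1_implies_ex[OF ex(1)[of x]] by blast
      then show ?thesis by (intro bexI[of _ "oinv l"]) simp_all
    qed
    then show ?thesis by blast
  qed
  finally show ?thesis .
qed

text \<open>A non-trivial element of \<open>L\<close> moves every point of \<open>U\<close> out of \<open>U\<close>. Hence the open sets of points moved
into \<open>U\<close> by a given element are disjoint, and elements of \<open>L\<close> cannot accumulate.\<close>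

lemma fundamental_domain_discrete:
  assumes L: "subgroup L Osc" and F: "fundamental_domain L F"
    and U: "open U" "U \<noteq> {}" "U \<subseteq> F"
  shows "discrete L" "countable L"
proof -
  interpret L: subgroup L Osc by fact
  obtain u where u: "u \<in> U" using U by blast
  have one: "l = \<one>\<^bsub>Osc\<^esub>" if "l \<in> L" "x \<in> U" "l \<cdot> x \<in> U" for l x
  proof -
    have "\<one>\<^bsub>Osc\<^esub> \<in> L \<and> \<one>\<^bsub>Osc\<^esub> \<cdot> x \<in> F" "l \<in> L \<and> l \<cdot> x \<in> F"
      using that subsetD[OF U(3)] L.one_closed by simp_all
    moreover have "\<exists>!l. l \<in> L \<and> l \<cdot> x \<in> F"
      using F by (simp add: fundamental_domain_def)
    ultimately show ?thesis by blast
  qed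
  have eq: "l = m" if "l \<in> L" "m \<in> L" "l \<cdot> x \<in> U" "m \<cdot> x \<in> U" for l m x
  proof -
    have "(l \<cdot> oinv m) \<cdot> (m \<cdot> x) = l \<cdot> x"
      by (simp add: Osc.m_assoc Osc.inv_solve_left')
    then have "l \<cdot> oinv m = \<one>\<^bsub>Osc\<^esub>"
      using that by (intro one[of _ "m \<cdot> x"]) simp_all
    then have "l = \<one>\<^bsub>Osc\<^esub> \<cdot> m"
      by (subst (asm) Osc.inv_solve_right') simp_all
    then show ?thesis by (simp only: Osc_zero_mult Osc_simps)
  qed
  show "discrete L"
  proof (rule discreteI)
    fix x assume x: "x \<in> L"
    let ?V = "(\<lambda>y. oinv x \<cdot> y \<cdot> u) -` U"
    have "open ?V" using U(1) by (intro open_vimage continuous_intros)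
    moreover have "x \<in> ?V" using u Osc.l_one[of u] by simp
    moreover have "y = x" if "y \<in> L" "y \<in> ?V" for y
    proof -
      have "oinv x \<cdot> y = \<one>\<^bsub>Osc\<^esub>"
        using that x u by (intro one[of _ u]) simp_all
      then have "y = x \<cdot> \<one>\<^bsub>Osc\<^esub>"
        by (subst (asm) Osc.inv_solve_left') simp_all
      then show ?thesis by (simp only: Osc_zero_mult Osc_simps)
    qed
    ultimately show "x isolated_in L"
      using x unfolding isolated_in_def by blast
  qed
  let ?T = "\<lambda>l. (\<lambda>x. l \<cdot> x) -` U"
  have ne: "oinv l \<cdot> u \<in> ?T l" for l
    using u Osc.l_one[of u] by (simp add: Osc.m_assoc[symmetric])
  have disj: "?T l \<inter> ?T m = {}" if "l \<in> L" "m \<in> L" "l \<noteq> m" for l m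
    using eq that by blast
  have "countable (?T ` L)"
  proof (rule countable_disjoint_open_subsets)
    show "open S" if "S \<in> ?T ` L" for S
      using that U(1) open_Osc_left_vimage by auto
    show "disjoint (?T ` L)"
      using disj by (fastforce simp: pairwise_def disjnt_def)
  qed
  moreover have "inj_on ?T L"
    by (rule inj_onI) (use ne disj in blast)
  ultimately show "countable L" by (rule countable_image_inj_on)
qed

context
  fixes L assumes L: "subgroup L Osc"
begin

interpretation L: subgroup L Osc by (rule L)

lemma coset_left: "l \<in> L \<Longrightarrow> L #>\<^bsub>Osc\<^esub> (l \<cdot> x) = L #>\<^bsub>Osc\<^esub> x"
  by (metis L L.rcos_const L.subset Osc.coset_mult_assoc Osc_simps(1) UNIV_I group_Osc)

lemma coset_mem: "x \<in> L #>\<^bsub>Osc\<^esub> x"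
  using Osc.rcos_self[OF _ L] by simp

lemma rcosets_cases:
  assumes "C \<in> rcosets\<^bsub>Osc\<^esub> L"
  obtains x where "C = L #>\<^bsub>Osc\<^esub> x"
  using assms by (auto simp: RCOSETS_def)

lemma coset_in_rcosets: "L #>\<^bsub>Osc\<^esub> x \<in> rcosets\<^bsub>Osc\<^esub> L"
  unfolding RCOSETS_def Osc_simps(1) by blast

lemma coset_eq: "C \<in> rcosets\<^bsub>Osc\<^esub> L \<Longrightarrow> x \<in> C \<Longrightarrow> C = L #>\<^bsub>Osc\<^esub> x"
  by (erule rcosets_cases) (use Osc.repr_independence[OF _ _ L] in simp)

lemma coset_translate: "L #>\<^bsub>Osc\<^esub> x #>\<^bsub>Osc\<^esub> g = L #>\<^bsub>Osc\<^esub> (x \<cdot> g)"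
  by (rule Osc.coset_mult_assoc) auto

text \<open>Sets of cosets are handled through their preimages under the projection.\<close>

lemma Union_rcosets:
  assumes "U \<subseteq> rcosets\<^bsub>Osc\<^esub> L"
  shows "\<Union>U = (\<lambda>x. L #>\<^bsub>Osc\<^esub> x) -` U"
  using assms coset_mem coset_eq by blast

lemma space_quotient_borel: "space (quotient_borel L) = rcosets\<^bsub>Osc\<^esub> L"
  unfolding quotient_borel_def by (rule space_measure_of) auto

lemma sets_quotient_borel_open:
  assumes "U \<subseteq> rcosets\<^bsub>Osc\<^esub> L" "open (\<Union>U)"
  shows "U \<in> sets (quotient_borel L)"
  using assms by (auto simp: quotient_borel_def)

lemma measurable_coset: "(\<lambda>x. L #>\<^bsub>Osc\<^esub> x) \<in> borel \<rightarrow>\<^sub>M quotient_borel L"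
  unfolding quotient_borel_def
  by (rule measurable_measure_of) (auto simp: coset_in_rcosets Union_rcosets)

lemma measurable_coset_translate:
  "(\<lambda>C. C #>\<^bsub>Osc\<^esub> g) \<in> quotient_borel L \<rightarrow>\<^sub>M quotient_borel L"
  unfolding quotient_borel_def[of L]
proof (rule measurable_measure_of)
  fix U assume U: "U \<in> {U. U \<subseteq> rcosets\<^bsub>Osc\<^esub> L \<and> open (\<Union>U)}"
  let ?V = "(\<lambda>C. C #>\<^bsub>Osc\<^esub> g) -` U \<inter> rcosets\<^bsub>Osc\<^esub> L"
  have "\<Union>?V = (\<lambda>x. x \<cdot> g) -` (\<Union>U)"
    using U by (intro Set.set_eqI) (simp add: Union_rcosets coset_translate coset_in_rcosets)
  then have "open (\<Union>?V)" using U open_Osc_right_vimage by simp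
  then show "(\<lambda>C. C #>\<^bsub>Osc\<^esub> g) -` U \<inter> space (sigma (rcosets\<^bsub>Osc\<^esub> L) {U. U \<subseteq> rcosets\<^bsub>Osc\<^esub> L \<and> open (\<Union>U)})
      \<in> sets (sigma (rcosets\<^bsub>Osc\<^esub> L) {U. U \<subseteq> rcosets\<^bsub>Osc\<^esub> L \<and> open (\<Union>U)})"
    using sets_quotient_borel_open[of ?V] space_quotient_borel by (simp add: quotient_borel_def)
next
  show "(\<lambda>C. C #>\<^bsub>Osc\<^esub> g) \<in> space (sigma (rcosets\<^bsub>Osc\<^esub> L) {U. U \<subseteq> rcosets\<^bsub>Osc\<^esub> L \<and> open (\<Union>U)}) \<rightarrow> rcosets\<^bsub>Osc\<^esub> L"
  proof (rule funcsetI)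
    fix C assume "C \<in> space (sigma (rcosets\<^bsub>Osc\<^esub> L) {U. U \<subseteq> rcosets\<^bsub>Osc\<^esub> L \<and> open (\<Union>U)})"
    then have "C \<in> rcosets\<^bsub>Osc\<^esub> L"
      using space_quotient_borel by (simp add: quotient_borel_def)
    then obtain x where "C = L #>\<^bsub>Osc\<^esub> x" by (rule rcosets_cases)
    then show "C #>\<^bsub>Osc\<^esub> g \<in> rcosets\<^bsub>Osc\<^esub> L"
      by (simp only: coset_translate coset_in_rcosets)
  qed
qed auto

lemma coset_translate_image:
  assumes "S \<subseteq> rcosets\<^bsub>Osc\<^esub> L"
  shows "(\<lambda>C. C #>\<^bsub>Osc\<^esub> g) ` S = (\<lambda>C. C #>\<^bsub>Osc\<^esub> oinv g) -` S \<inter> rcosets\<^bsub>Osc\<^esub> L"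
proof (intro equalityI subsetI)
  fix C assume "C \<in> (\<lambda>C. C #>\<^bsub>Osc\<^esub> g) ` S"
  then obtain C' where C': "C' \<in> S" "C = C' #>\<^bsub>Osc\<^esub> g" by blast
  obtain x where "C' = L #>\<^bsub>Osc\<^esub> x" by (rule rcosets_cases[OF subsetD[OF assms C'(1)]])
  with C' have x: "L #>\<^bsub>Osc\<^esub> x \<in> S" "C = L #>\<^bsub>Osc\<^esub> x #>\<^bsub>Osc\<^esub> g" by simp_all
  then show "C \<in> (\<lambda>C. C #>\<^bsub>Osc\<^esub> oinv g) -` S \<inter> rcosets\<^bsub>Osc\<^esub> L"
    using Osc.r_one[of x] by (simp add: coset_translate coset_in_rcosets Osc.m_assoc)
next
  fix C assume C: "C \<in> (\<lambda>C. C #>\<^bsub>Osc\<^esub> oinv g) -` S \<inter> rcosets\<^bsub>Osc\<^esub> L"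
  then have "C \<in> rcosets\<^bsub>Osc\<^esub> L" by blast
  then obtain x where x: "C = L #>\<^bsub>Osc\<^esub> x" by (rule rcosets_cases)
  show "C \<in> (\<lambda>C. C #>\<^bsub>Osc\<^esub> g) ` S"
    by (rule image_eqI[of _ _ "C #>\<^bsub>Osc\<^esub> oinv g"])
       (use C Osc.r_one[of x] in \<open>simp_all add: x coset_translate Osc.m_assoc\<close>)
qed

lemma sets_coset_translate_image:
  assumes "S \<in> sets (quotient_borel L)"
  shows "(\<lambda>C. C #>\<^bsub>Osc\<^esub> g) ` S \<in> sets (quotient_borel L)"
  using measurable_sets[OF measurable_coset_translate[of "oinv g"] assms]
    sets.sets_into_space[OF assms] by (simp add: space_quotient_borel coset_translate_image)

end

text \<open>The measure on the quotient is the image of Lebesgue measure on \<open>F\<close>. Translating a set of cosets by \<open>g\<close>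
replaces \<open>F\<close> by the fundamental domain \<open>F g\<^sup>-\<^sup>1\<close>, by right invariance, and the preimage of a set of cosets
has the same measure in all fundamental domains.\<close>

theorem osc_lattice_fundamental_domain:
  assumes L: "subgroup L Osc" and F: "fundamental_domain L F"
    and U: "open U" "U \<noteq> {}" "U \<subseteq> F" and fin: "emeasure lborel F < \<infinity>"
  shows "osc_lattice L"
proof -
  note cnt = fundamental_domain_discrete(2)[OF L F U]
  have Fb [measurable]: "F \<in> sets borel" using F by (simp add: fundamental_domain_def)
  let ?p = "\<lambda>x. L #>\<^bsub>Osc\<^esub> x"
  define M where "M = distr (density lborel (indicator F)) (quotient_borel L) ?p"
  have meas: "?p \<in> density lborel (indicator F) \<rightarrow>\<^sub>M quotient_borel L"
    using measurable_coset[OF L] by simp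
  have M_sets: "sets M = sets (quotient_borel L)" and M_space: "space M = rcosets\<^bsub>Osc\<^esub> L"
    by (simp_all add: M_def space_quotient_borel[OF L])
  have pre: "?p -` S \<in> sets borel" if "S \<in> sets M" for S
    using measurable_sets[OF measurable_coset[OF L]] that M_sets by simp
  have M: "emeasure M S = emeasure lborel (F \<inter> ?p -` S)" if "S \<in> sets M" for S
  proof -
    have "emeasure M S = emeasure (density lborel (indicator F)) (?p -` S)"
      using that emeasure_distr[OF meas] M_sets by (simp add: M_def)
    also have "\<dots> = (\<integral>\<^sup>+x. indicator F x * indicator (?p -` S) x \<partial>lborel)"
      using pre[OF that] by (intro emeasure_density) auto
    also have "\<dots> = (\<integral>\<^sup>+x. indicator (F \<inter> ?p -` S) x \<partial>lborel)"
      by (simp add: indicator_inter_arith)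
    also have "\<dots> = emeasure lborel (F \<inter> ?p -` S)"
      using pre[OF that] by (intro nn_integral_indicator) auto
    finally show ?thesis .
  qed
  have total: "emeasure M (space M) = emeasure lborel F"
  proof -
    have "?p -` space M = UNIV" by (intro Set.set_eqI) (simp add: M_space coset_in_rcosets[OF L])
    then show ?thesis using M[OF sets.top] by simp
  qed
  have "finite_measure M"
    using fin by (intro finite_measureI) (simp add: total)
  moreover have "emeasure M (space M) \<noteq> 0"
  proof
    assume "emeasure M (space M) = 0"
    then have "F \<in> null_sets lborel" by (simp add: total null_sets_def)
    then have "U \<in> null_sets lborel"
      using U by (intro null_sets_subset[of F lborel U]) auto
    then have "negligible U"
      by (simp add: negligible_iff_null_sets null_sets_completionI)
    then show False using U open_not_negligible by blast
  qed
  moreover have "emeasure M ((\<lambda>C. C #>\<^bsub>Osc\<^esub> g) ` S) = emeasure M S" if S: "S \<in> sets M" for g S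
  proof -
    have SL: "S \<subseteq> rcosets\<^bsub>Osc\<^esub> L" using sets.sets_into_space[OF S] by (simp add: M_space)
    have tS: "(\<lambda>C. C #>\<^bsub>Osc\<^esub> g) ` S \<in> sets M"
      using sets_coset_translate_image[OF L] S by (simp add: M_sets)
    let ?W = "?p -` S" and ?W' = "?p -` ((\<lambda>C. C #>\<^bsub>Osc\<^esub> g) ` S)"
    have W': "x \<cdot> g \<in> ?W' \<longleftrightarrow> x \<in> ?W" for x
      using Osc.r_one[of x] by (simp add: coset_translate_image[OF L SL] coset_translate[OF L] coset_in_rcosets[OF L] Osc.m_assoc)
    have "emeasure M ((\<lambda>C. C #>\<^bsub>Osc\<^esub> g) ` S) = emeasure lborel (F \<inter> ?W')"
      by (rule M[OF tS])
    also have "\<dots> = emeasure lborel ((\<lambda>x. x \<cdot> g) -` (F \<inter> ?W'))"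
      by (rule emeasure_Osc_translate(2)[symmetric]) (use pre[OF tS] in simp)
    also have "(\<lambda>x. x \<cdot> g) -` (F \<inter> ?W') = (\<lambda>x. x \<cdot> g) -` F \<inter> ?W"
      using W' by (intro Set.set_eqI) simp
    also have "emeasure lborel \<dots> = emeasure lborel (F \<inter> ?W)"
      by (rule emeasure_fundamental_domain_cong[OF L cnt fundamental_domain_right_translate[OF F] F pre[OF S]])
         (simp add: coset_left[OF L])
    also have "\<dots> = emeasure M S" by (rule M[OF S, symmetric])
    finally show ?thesis .
  qed
  ultimately have "finite_invariant_quotient_measure L M"
    by (simp add: finite_invariant_quotient_measure_def M_sets)
  then show ?thesis
    using L fundamental_domain_discrete(1)[OF L F U] by (auto simp: osc_lattice_def)
qed

section \<open>Integrality of the parameters\<close>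

lemma matrix_inv_cancel:
  fixes A :: "real^'n^'n"
  assumes "invertible A"
  shows "A ** matrix_inv A = mat 1" "matrix_inv A ** A = mat 1"
  using assms someI_ex[of "\<lambda>A'. A ** A' = mat 1 \<and> A' ** A = mat 1"]
  by (auto simp: invertible_def matrix_inv_def)

lemma matrix_inv_vec_cancel:
  fixes A :: "real^'n^'n"
  assumes "invertible A"
  shows "A *v (matrix_inv A *v v) = v" "matrix_inv A *v (A *v v) = v"
  using matrix_inv_cancel[OF assms] by (simp_all add: matrix_vector_mul_assoc)

lemma invertible_det_1: "det (A :: real^2^2) = 1 \<Longrightarrow> invertible A"
  by (simp add: invertible_det_nz)

lemma real_mat_det [simp]: "det (real_mat B) = of_int (det B)"
  by (simp add: det_2)

lemma real_mat_trace [simp]: "trace (real_mat B) = of_int (trace B)"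
  by (simp add: trace_def)

lemma real_vec_nth [simp]: "real_vec v $ i = of_int (v $ i)"
  by (simp add: real_vec_def)

lemma corr_vec_nth [simp]:
  "corr_vec B $ 1 = - (B$1$2 * B$2$2)" "corr_vec B $ 2 = B$1$1 * B$2$1"
  by (simp_all add: corr_vec_def)

lemma Gamma_set_iff:
  "(z, v) \<in> Gamma_set r \<longleftrightarrow> (\<exists>x y k :: int. v = vector [of_int x, of_int y] \<and>
    z = of_int x * of_int y / 2 + of_int k / of_nat r)"
proof
  assume "(z, v) \<in> Gamma_set r"
  then obtain k :: int where "v$1 \<in> \<int>" "v$2 \<in> \<int>" "z = 1/2 * v$1 * v$2 + of_int k / of_nat r"
    by (auto simp: Gamma_set_def)
  moreover obtain x y :: int where "v$1 = of_int x" "v$2 = of_int y"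
    using \<open>v$1 \<in> \<int>\<close> \<open>v$2 \<in> \<int>\<close> by (auto elim!: Ints_cases)
  ultimately show "\<exists>x y k :: int. v = vector [of_int x, of_int y] \<and>
      z = of_int x * of_int y / 2 + of_int k / of_nat r"
    by (intro exI[of _ x] exI[of _ y] exI[of _ k]) (simp add: vec_eq_iff forall_2)
qed (auto simp: Gamma_set_def)

text \<open>The function \<open>x y / 2\<close> describes the central coordinates in \<open>Gamma_set r\<close>. An integral matrix of
determinant \<open>1\<close> preserves it up to integers and a linear form; the linear form, which is the source
of the correction vector, arises because \<open>x\<^sup>2\<close> and \<open>x\<close> have the same parity.\<close>

lemma half_product_shift:
  fixes B :: "int^2^2" and x y :: int
  assumes det: "det B = 1"
  obtains m :: int where
    "of_int x * of_int y / 2 + (of_int (B$1$2 * B$2$2) / 2 * of_int y + of_int (B$1$1 * B$2$1) / 2 * of_int x) =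
      of_int (B$1$1 * x + B$1$2 * y) * of_int (B$2$1 * x + B$2$2 * y) / 2 + (of_int m :: real)"
proof -
  have even: "even (x * (1 - x))" "even (y * (1 - y))" by simp_all
  from even(1) obtain p where p: "x * (1 - x) = 2 * p" by (rule dvdE)
  from even(2) obtain q where q: "y * (1 - y) = 2 * q" by (rule dvdE)
  define m where "m = B$1$1 * B$2$1 * p + B$1$2 * B$2$2 * q - B$1$2 * B$2$1 * x * y"
  have ad: "B$1$1 * B$2$2 = 1 + B$1$2 * B$2$1"
    using det by (simp add: det_2)
  have "(B$1$1 * x + B$1$2 * y) * (B$2$1 * x + B$2$2 * y) + 2 * m
      = B$1$1 * B$2$1 * (x * x + 2 * p) + B$1$2 * B$2$2 * (y * y + 2 * q)
        + (B$1$1 * B$2$2) * (x * y) - B$1$2 * B$2$1 * (x * y)"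
    by (simp add: m_def algebra_simps)
  also have "\<dots> = B$1$1 * B$2$1 * x + B$1$2 * B$2$2 * y + x * y"
    unfolding ad p[symmetric] q[symmetric] by (simp add: algebra_simps)
  finally have "real_of_int ((B$1$1 * x + B$1$2 * y) * (B$2$1 * x + B$2$2 * y) + 2 * m)
      = real_of_int (B$1$1 * B$2$1 * x + B$1$2 * B$2$2 * y + x * y)"
    by (simp only:)
  then show ?thesis
    by (intro that[of m]) (simp add: field_simps)
qed

lemma omega_matrix_inv:
  assumes "det (B :: real^2^2) = 1"
  shows "omega \<xi> (B *v v) = omega (matrix_inv B *v \<xi>) v"
  using omega_mult_vec[of B "matrix_inv B *v \<xi>" v] assms
    matrix_inv_vec_cancel(1)[OF invertible_det_1[OF assms]] by simp

lemma heis_shear_lin: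
  assumes "det B = 1"
  shows "heis_shear \<xi> (heis_lin B (z, v)) = (z + omega (matrix_inv B *v \<xi>) v, B *v v)"
  by (simp add: heis_shear_def heis_lin_def assms omega_matrix_inv)

text \<open>Apply the map to the two elements of \<open>Gamma_set r\<close> over the standard basis: integrality of the planar
parts of the images is integrality of \<open>B\<close>, and that of the central parts is integrality of \<open>l\<close>.\<close>

lemma B_set_imp_integral:
  assumes r: "r > 0" and det: "det B = 1" and B: "(\<xi>, B) \<in> B_set r"
  obtains B' l where "real_mat B' = B"
    "real_vec l = real r *\<^sub>R (matrix_inv B *v \<xi>) + (real r / 2) *\<^sub>R corr_vec B"
proof -
  define u where "u = matrix_inv B *v \<xi>"
  have img: "(z + omega u v, B *v v) \<in> Gamma_set r" if "(z, v) \<in> Gamma_set r" for z v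
    using B that heis_shear_lin[OF det, of \<xi> z v] unfolding B_set_def u_def by force
  have "(0, vector [1, 0]) \<in> Gamma_set r" "(0, vector [0, 1]) \<in> Gamma_set r"
    by (auto simp: Gamma_set_def)
  note im = img[OF this(1)] img[OF this(2)]
  from im(1) obtain a c k :: int where
    1: "B *v vector [1, 0] = vector [of_int a, of_int c]" "omega u (vector [1, 0]) = of_int a * of_int c / 2 + of_int k / of_nat r"
    unfolding Gamma_set_iff by auto
  from im(2) obtain b d k' :: int where
    2: "B *v vector [0, 1] = vector [of_int b, of_int d]" "omega u (vector [0, 1]) = of_int b * of_int d / 2 + of_int k' / of_nat r"
    unfolding Gamma_set_iff by auto
  have ent: "B$1$1 = of_int a" "B$2$1 = of_int c" "B$1$2 = of_int b" "B$2$2 = of_int d"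
    using 1(1) 2(1) by (simp_all add: vec_eq_iff forall_2 matrix_vector_mult_def sum_2)
  have "real_mat (vector [vector [a, b], vector [c, d]]) = B"
    by (simp add: vec_eq_iff forall_2 ent)
  moreover have "real_vec (vector [k', - k]) = real r *\<^sub>R u + (real r / 2) *\<^sub>R corr_vec B"
    using 1(2) 2(2) r by (simp add: vec_eq_iff forall_2 ent omega_def field_simps)
  ultimately show ?thesis using that unfolding u_def by blast
qed

text \<open>By \<open>half_product_shift\<close>, the map sends \<open>x y / 2\<close> to the corresponding value for the image point, up to
a multiple of \<open>1 / r\<close>. For the reverse inclusion the same formula is used at the preimage under \<open>B\<close>.\<close>

lemma integral_imp_B_set:
  fixes B :: "int^2^2"
  assumes r: "r > 0" and det: "det B = 1"
    and l: "real_vec l = real r *\<^sub>R (matrix_inv (real_mat B) *v \<xi>) + (real r / 2) *\<^sub>R corr_vec (real_mat B)"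
  shows "(\<xi>, real_mat B) \<in> B_set r"
proof -
  define u where "u = matrix_inv (real_mat B) *v \<xi>"
  have det': "det (real_mat B) = 1" using det by simp
  have u: "u$1 = of_int (l$1) / real r + of_int (B$1$2 * B$2$2) / 2"
    "u$2 = of_int (l$2) / real r - of_int (B$1$1 * B$2$1) / 2"
    using l r unfolding u_def[symmetric] by (simp_all add: vec_eq_iff forall_2 field_simps)
  have key: "\<exists>m :: int. of_int x * of_int y / 2 + omega u (vector [of_int x, of_int y]) =
      of_int (B$1$1 * x + B$1$2 * y) * of_int (B$2$1 * x + B$2$2 * y) / 2 + of_int m / real r" for x y :: int
  proof -
    obtain m :: int where m: "of_int x * of_int y / 2 + (of_int (B$1$2 * B$2$2) / 2 * of_int y + of_int (B$1$1 * B$2$1) / 2 * of_int x) =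
      of_int (B$1$1 * x + B$1$2 * y) * of_int (B$2$1 * x + B$2$2 * y) / 2 + (of_int m :: real)"
      using half_product_shift[OF det] by blast
    have "omega u (vector [of_int x, of_int y]) = (of_int (B$1$2 * B$2$2) / 2 * of_int y + of_int (B$1$1 * B$2$1) / 2 * of_int x)
        + of_int (l$1 * y - l$2 * x) / real r"
      unfolding omega_def u using r by (simp add: field_simps)
    with m have "of_int x * of_int y / 2 + omega u (vector [of_int x, of_int y]) =
      of_int (B$1$1 * x + B$1$2 * y) * of_int (B$2$1 * x + B$2$2 * y) / 2 + of_int m
        + of_int (l$1 * y - l$2 * x) / real r" by linarith
    also have "\<dots> = of_int (B$1$1 * x + B$1$2 * y) * of_int (B$2$1 * x + B$2$2 * y) / 2
        + of_int (int r * m + l$1 * y - l$2 * x) / real r"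
      using r by (simp add: field_simps)
    finally show ?thesis by blast
  qed
  have Bv: "real_mat B *v vector [of_int x, of_int y] =
      vector [of_int (B$1$1 * x + B$1$2 * y), of_int (B$2$1 * x + B$2$2 * y)]" for x y
    by (simp add: vec_eq_iff forall_2 matrix_vector_mult_def sum_2)
  have "heis_shear \<xi> ` (heis_lin (real_mat B) ` Gamma_set r) = Gamma_set r"
  proof (intro equalityI subsetI)
    fix p assume "p \<in> heis_shear \<xi> ` (heis_lin (real_mat B) ` Gamma_set r)"
    then obtain z v where zv: "(z, v) \<in> Gamma_set r" and p: "p = (z + omega u v, real_mat B *v v)"
      by (auto simp: heis_shear_lin[OF det'] u_def)
    from zv obtain x y k :: int where v: "v = vector [of_int x, of_int y]"
      and z: "z = of_int x * of_int y / 2 + of_int k / of_nat r"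
      unfolding Gamma_set_iff by blast
    obtain m :: int where "of_int x * of_int y / 2 + omega u v =
      of_int (B$1$1 * x + B$1$2 * y) * of_int (B$2$1 * x + B$2$2 * y) / 2 + of_int m / real r"
      using key v by blast
    then have "z + omega u v = of_int (B$1$1 * x + B$1$2 * y) * of_int (B$2$1 * x + B$2$2 * y) / 2 + of_int (k + m) / real r"
      by (simp add: z add_divide_distrib)
    then show "p \<in> Gamma_set r"
      unfolding p Gamma_set_iff v Bv by blast
  next
    fix p assume "p \<in> Gamma_set r"
    then obtain x' y' k :: int where p: "p = (of_int x' * of_int y' / 2 + of_int k / of_nat r, vector [of_int x', of_int y'])"
      by (cases p) (auto simp: Gamma_set_iff)
    define x y where "x = B$2$2 * x' - B$1$2 * y'" and "y = B$1$1 * y' - B$2$1 * x'"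
    have ad: "B$1$1 * B$2$2 = 1 + B$1$2 * B$2$1" using det by (simp add: det_2)
    have "B$1$1 * x + B$1$2 * y = (B$1$1 * B$2$2) * x' - B$1$2 * B$2$1 * x'"
      "B$2$1 * x + B$2$2 * y = (B$1$1 * B$2$2) * y' - B$1$2 * B$2$1 * y'"
      by (simp_all add: x_def y_def algebra_simps)
    then have xy: "B$1$1 * x + B$1$2 * y = x'" "B$2$1 * x + B$2$2 * y = y'"
      unfolding ad by (simp_all add: algebra_simps)
    obtain m :: int where m: "of_int x * of_int y / 2 + omega u (vector [of_int x, of_int y]) =
        of_int x' * of_int y' / 2 + of_int m / real r"
      using key[of x y] unfolding xy by blast
    have "(of_int x * of_int y / 2 + of_int (k - m) / real r, vector [of_int x, of_int y]) \<in> Gamma_set r"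
      unfolding Gamma_set_iff by blast
    moreover have "p = heis_shear \<xi> (heis_lin (real_mat B) (of_int x * of_int y / 2 + of_int (k - m) / real r, vector [of_int x, of_int y]))"
      using m by (simp add: heis_shear_lin[OF det'] u_def[symmetric] p Bv xy diff_divide_distrib)
    ultimately show "p \<in> heis_shear \<xi> ` (heis_lin (real_mat B) ` Gamma_set r)"
      unfolding image_image by (metis image_eqI)
  qed
  then show ?thesis using invertible_det_1[OF det'] by (simp add: B_set_def)
qed

section \<open>The lattices \<open>L\<^sub>r\<^sub>,\<^sub>s(\<eta>, P, z, \<xi>)\<close>\<close>

lemma matrix_vector_columns:
  "P *v v = (v$1) *\<^sub>R (P *v vector [1, 0]) + (v$2) *\<^sub>R (P *v vector [0, 1])" for P :: "real^2^2"
  by (simp add: vec_eq_iff forall_2 matrix_vector_mult_def sum_2)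

lemma omega_basis [simp]: "omega (vector [1, 0]) (vector [0, 1]) = 1"
  by (simp add: omega_def)

lemma continuous_on_matrix_vector [continuous_intros]:
  fixes A :: "real^'n^'m"
  shows "continuous_on S f \<Longrightarrow> continuous_on S (\<lambda>x. A *v f x)"
  using continuous_on_compose2[OF matrix_vector_mult_linear_continuous_on[of UNIV A]] by simp

text \<open>The parameters of a lattice together with the integral matrix and vector that belong to them. The
parameter \<open>\<eta>\<close> only conjugates the group and is added at the end.\<close>

locale lattice_data =
  fixes r :: nat and s :: real and P :: "real^2^2" and z :: real and \<xi> :: "real^2"
    and B :: "int^2^2" and l :: "int^2"
  assumes r: "r > 0" and s: "s > 0" and P: "invertible P"
    and B: "real_mat B = matrix_inv P ** boost s ** P" and det_B: "det B = 1"
    and l: "real_vec l = real r *\<^sub>R (matrix_inv (real_mat B) *v \<xi>) + (real r / 2) *\<^sub>R corr_vec (real_mat B)"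
begin

definition ga :: osc where "ga = (0, P *v vector [1, 0], 0)"
definition gb :: osc where "gb = (0, P *v vector [0, 1], 0)"
definition gc :: osc where "gc = (det P / real r, 0, 0)"
definition gd :: osc where "gd = (det P * z, P *v \<xi>, s)"

definition elem :: "(int \<times> int \<times> int) \<times> int \<Rightarrow> osc" where
  "elem = (\<lambda>(p, n). normal_form Osc ga gb gc p \<cdot> gd [^]\<^bsub>Osc\<^esub> n)"

lemma det_P: "det P \<noteq> 0"
  using P by (simp add: invertible_det_nz)

lemma elem_normal_form:
  "normal_form Osc ga gb gc (x, y, k) =
    (det P * (of_int k / real r + of_int x * of_int y / 2), P *v vector [of_int x, of_int y], 0)"
  unfolding ga_def gb_def gc_def Osc_normal_form omega_mult_vec
  by (simp add: matrix_vector_columns[of P "vector [of_int x, of_int y]"] algebra_simps)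

lemma generators_image:
  "heis_to_osc ` heis_lin P ` Gamma_set r = range (normal_form Osc ga gb gc)"
proof (intro equalityI subsetI)
  fix p assume "p \<in> heis_to_osc ` heis_lin P ` Gamma_set r"
  then obtain h v where "(h, v) \<in> Gamma_set r" and p: "p = (det P * h, P *v v, 0)"
    by (auto simp: heis_to_osc_def heis_lin_def)
  then obtain x y k :: int where "v = vector [of_int x, of_int y]" "h = of_int x * of_int y / 2 + of_int k / real r"
    unfolding Gamma_set_iff by blast
  then have "p = normal_form Osc ga gb gc (x, y, k)"
    by (simp add: p elem_normal_form add.commute)
  then show "p \<in> range (normal_form Osc ga gb gc)" by blast
next
  fix p assume "p \<in> range (normal_form Osc ga gb gc)"
  then obtain q where "p = normal_form Osc ga gb gc q" by blast
  then obtain x y k where p: "p = normal_form Osc ga gb gc (x, y, k)" by (cases q) simp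
  have "p = heis_to_osc (heis_lin P (of_int x * of_int y / 2 + of_int k / real r, vector [of_int x, of_int y]))"
    by (simp add: p elem_normal_form heis_to_osc_def heis_lin_def add.commute)
  moreover have "(of_int x * of_int y / 2 + of_int k / real r, vector [of_int x, of_int y]) \<in> Gamma_set r"
    unfolding Gamma_set_iff by blast
  ultimately show "p \<in> heis_to_osc ` heis_lin P ` Gamma_set r" by blast
qed

lemma triple: "heis_triple Osc r ga gb gc"
  unfolding ga_def gb_def gc_def
  by (rule Osc_heis_triple) (use r in \<open>simp add: omega_mult_vec\<close>)

lemma conj_gd:
  "gd \<cdot> (h, P *v v, 0) \<cdot> oinv gd =
    (h + det P * omega (matrix_inv (real_mat B) *v \<xi>) v, P *v (real_mat B *v v), 0)"
proof -
  have "P ** real_mat B = boost s ** P"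
    unfolding B by (simp add: matrix_mul_assoc matrix_inv_cancel[OF P])
  then have "boost s *v (P *v v) = P *v (real_mat B *v v)"
    by (simp add: matrix_vector_mul_assoc)
  then show ?thesis
    using omega_matrix_inv[of "real_mat B" \<xi> v] det_B
    unfolding gd_def Osc_conj by (simp add: omega_mult_vec)
qed

lemma elem_time: "snd (snd (elem (p, n))) = of_int n * s"
proof -
  obtain x y k where p: "p = (x, y, k)" by (cases p)
  show ?thesis
    using Osc_pow_time[of gd n] by (cases "gd [^]\<^bsub>Osc\<^esub> n") (simp add: elem_def p elem_normal_form gd_def)
qed

text \<open>In the coordinates given by \<open>P\<close>, a box with sides \<open>1 / r\<close>, \<open>1\<close>, \<open>1\<close> and \<open>s\<close>.\<close>

definition fund :: "osc set" where
  "fund = {x. fst x / det P \<in> {0..<1 / real r} \<and> (matrix_inv P *v fst (snd x)) $ 1 \<in> {0..<1} \<and>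
    (matrix_inv P *v fst (snd x)) $ 2 \<in> {0..<1} \<and> snd (snd x) \<in> {0..<s}}"

definition fund_interior :: "osc set" where
  "fund_interior = {x. fst x / det P \<in> {0<..<1 / real r} \<and> (matrix_inv P *v fst (snd x)) $ 1 \<in> {0<..<1} \<and>
    (matrix_inv P *v fst (snd x)) $ 2 \<in> {0<..<1} \<and> snd (snd x) \<in> {0<..<s}}"

lemma elem_act:
  assumes q: "gd [^]\<^bsub>Osc\<^esub> n \<cdot> x = (det P * h, P *v v, t)"
  shows "elem ((x1, y1, k), n) \<cdot> x =
    (det P * (h + of_int k / real r + of_int x1 * of_int y1 / 2 + (of_int x1 * v$2 - of_int y1 * v$1) / 2),
     P *v (vector [of_int x1, of_int y1] + v), t)"
proof -
  have "elem ((x1, y1, k), n) \<cdot> x = normal_form Osc ga gb gc (x1, y1, k) \<cdot> (det P * h, P *v v, t)"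
    unfolding elem_def by (simp only: prod.case Osc_assoc q)
  also have "\<dots> = (det P * (h + of_int k / real r + of_int x1 * of_int y1 / 2 + (of_int x1 * v$2 - of_int y1 * v$1) / 2),
     P *v (vector [of_int x1, of_int y1] + v), t)"
    by (simp add: elem_normal_form omega_mult_vec matrix_vector_right_distrib) (simp add: omega_def algebra_simps)
  finally show ?thesis .
qed

lemma floor_shift_unique:
  fixes x e :: real
  assumes "e > 0"
  shows "x + of_int k * e \<in> {0..<e} \<longleftrightarrow> k = - \<lfloor>x / e\<rfloor>"
proof -
  have "x + of_int k * e \<in> {0..<e} \<longleftrightarrow> of_int (- k) \<le> x / e \<and> x / e < of_int (- k) + 1"
    using assms by (auto simp: field_simps)
  also have "\<dots> \<longleftrightarrow> \<lfloor>x / e\<rfloor> = - k" by linarith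
  finally show ?thesis by auto
qed

text \<open>The exponents are found one after the other by rounding: first the time fixes \<open>n\<close>, then the plane
fixes \<open>x\<close> and \<open>y\<close>, and finally the centre fixes \<open>k\<close>.\<close>

lemma fund_unique: "\<exists>!q. elem q \<cdot> x \<in> fund"
proof -
  define n where "n = - \<lfloor>snd (snd x) / s\<rfloor>"
  define q where "q = gd [^]\<^bsub>Osc\<^esub> n \<cdot> x"
  define h v t where "h = fst q / det P" and "v = matrix_inv P *v fst (snd q)" and "t = snd (snd q)"
  have q: "gd [^]\<^bsub>Osc\<^esub> n \<cdot> x = (det P * h, P *v v, t)"
    using det_P by (simp add: q_def[symmetric] h_def v_def t_def matrix_inv_vec_cancel[OF P])
  define x1 y1 where "x1 = - \<lfloor>v$1\<rfloor>" and "y1 = - \<lfloor>v$2\<rfloor>"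
  define w where "w = h + of_int x1 * of_int y1 / 2 + (of_int x1 * v$2 - of_int y1 * v$1) / 2"
  define k where "k = - \<lfloor>w / (1 / real r)\<rfloor>"
  have time: "snd (snd (elem (p, m) \<cdot> x)) = snd (snd x) + of_int m * s" for p m
    using elem_time[of p m] by (cases "elem (p, m)"; cases x) simp
  have iff: "elem ((x2, y2, k2), n) \<cdot> x \<in> fund \<longleftrightarrow> x2 = x1 \<and> y2 = y1 \<and> k2 = k" for x2 y2 k2
  proof -
    have t: "t \<in> {0..<s}"
    proof -
      have "t = snd (snd (elem ((0,0,0), n) \<cdot> x))" by (simp add: elem_act[OF q])
      then show ?thesis
        unfolding time using floor_shift_unique[OF s, of "snd (snd x)" n] n_def by simp
    qed
    have "elem ((x2, y2, k2), n) \<cdot> x \<in> fund \<longleftrightarrow>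
      h + of_int k2 / real r + of_int x2 * of_int y2 / 2 + (of_int x2 * v$2 - of_int y2 * v$1) / 2 \<in> {0..<1 / real r} \<and>
      v$1 + of_int x2 * 1 \<in> {0..<1} \<and> v$2 + of_int y2 * 1 \<in> {0..<1}"
      using t det_P by (simp add: fund_def elem_act[OF q] matrix_inv_vec_cancel[OF P] add.commute)
    also have "v$1 + of_int x2 * 1 \<in> {0..<1} \<longleftrightarrow> x2 = x1"
      using floor_shift_unique[of 1 "v$1" x2] by (simp add: x1_def)
    also have "v$2 + of_int y2 * 1 \<in> {0..<1} \<longleftrightarrow> y2 = y1"
      using floor_shift_unique[of 1 "v$2" y2] by (simp add: y1_def)
    also have "h + of_int k2 / real r + of_int x2 * of_int y2 / 2 + (of_int x2 * v$2 - of_int y2 * v$1) / 2 \<in> {0..<1 / real r} \<and>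
        x2 = x1 \<and> y2 = y1 \<longleftrightarrow> w + of_int k2 * (1 / real r) \<in> {0..<1 / real r} \<and> x2 = x1 \<and> y2 = y1"
      unfolding w_def by (auto simp: algebra_simps)
    also have "w + of_int k2 * (1 / real r) \<in> {0..<1 / real r} \<longleftrightarrow> k2 = k"
      unfolding k_def using r by (intro floor_shift_unique) simp
    finally show ?thesis by blast
  qed
  show ?thesis
  proof (rule ex1I[of _ "((x1, y1, k), n)"])
    show "elem ((x1, y1, k), n) \<cdot> x \<in> fund" using iff by simp
  next
    fix q' assume q': "elem q' \<cdot> x \<in> fund"
    obtain x2 y2 k2 m where q'_eq: "q' = ((x2, y2, k2), m)" by (metis surj_pair)
    have "snd (snd (elem q' \<cdot> x)) \<in> {0..<s}" using q' by (simp add: fund_def)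
    then have "m = n"
      unfolding q'_eq time using floor_shift_unique[OF s, of "snd (snd x)" m] by (simp add: n_def)
    then show "q' = ((x1, y1, k), n)" using q' iff by (simp add: q'_eq)
  qed
qed

text \<open>Unique exponents follow from \<open>fund_unique\<close>, applied to a point that \<open>elem p\<close> moves into the domain.\<close>

lemma inj_elem: "inj elem"
proof (rule injI)
  fix p q assume eq: "elem p = elem q"
  obtain p0 where p0: "elem p0 \<cdot> \<one>\<^bsub>Osc\<^esub> \<in> fund" using fund_unique[of "\<one>\<^bsub>Osc\<^esub>"] by blast
  have "elem p \<cdot> (oinv (elem p) \<cdot> elem p0) \<in> fund"
    using p0 by (simp add: Osc_assoc[symmetric])
  moreover from this have "elem q \<cdot> (oinv (elem p) \<cdot> elem p0) \<in> fund"
    by (simp only: eq)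
  ultimately show "p = q"
    using fund_unique[of "oinv (elem p) \<cdot> elem p0"] by blast
qed

text \<open>Conjugation by \<open>gd\<close> multiplies \<open>ga\<close> and \<open>gb\<close> by powers of \<open>gc\<close> whose exponents involve \<open>B\<^sup>-\<^sup>1 \<xi>\<close> and half
the products of the entries in the columns of \<open>B\<close>; the definition of \<open>l\<close> turns them into \<open>- l\<^sub>2\<close> and \<open>l\<^sub>1\<close>.\<close>

lemma range_elem: "subgroup (range elem) Osc" "Osc\<lparr>carrier := range elem\<rparr> \<cong> disc_osc r B l"
proof -
  define u where "u = matrix_inv (real_mat B) *v \<xi>"
  have u: "u$1 = of_int (l$1) / real r + of_int (B$1$2 * B$2$2) / 2"
    "u$2 = of_int (l$2) / real r - of_int (B$1$1 * B$2$1) / 2"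
    using l r unfolding u_def[symmetric] by (simp_all add: vec_eq_iff forall_2 field_simps)
  have gd: "gd \<in> carrier Osc" by simp
  have 1: "gd \<cdot> ga \<cdot> oinv gd = normal_form Osc ga gb gc (B$1$1, B$2$1, - (l$2))"
  proof -
    have "real_mat B *v vector [1, 0] = vector [of_int (B$1$1), of_int (B$2$1)]"
      by (simp add: vec_eq_iff forall_2 matrix_vector_mult_def sum_2)
    moreover have "gd \<cdot> ga \<cdot> oinv gd =
        (0 + det P * omega u (vector [1, 0]), P *v (real_mat B *v vector [1, 0]), 0)"
      unfolding ga_def u_def by (rule conj_gd)
    ultimately show ?thesis
      by (simp add: elem_normal_form omega_def u algebra_simps)
  qed
  have 2: "gd \<cdot> gb \<cdot> oinv gd = normal_form Osc ga gb gc (B$1$2, B$2$2, l$1)"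
  proof -
    have "real_mat B *v vector [0, 1] = vector [of_int (B$1$2), of_int (B$2$2)]"
      by (simp add: vec_eq_iff forall_2 matrix_vector_mult_def sum_2)
    moreover have "gd \<cdot> gb \<cdot> oinv gd =
        (0 + det P * omega u (vector [0, 1]), P *v (real_mat B *v vector [0, 1]), 0)"
      unfolding gb_def u_def by (rule conj_gd)
    ultimately show ?thesis
      by (simp add: elem_normal_form omega_def u algebra_simps)
  qed
  have 3: "gd \<cdot> gc \<cdot> oinv gd = gc"
    using conj_gd[of "det P / real r" 0] by (simp add: gc_def)
  have inj: "inj (\<lambda>(p, n). normal_form Osc ga gb gc p \<cdot> gd [^]\<^bsub>Osc\<^esub> (n::int))"
    using inj_elem by (simp add: elem_def)
  note * = disc_osc_recognition[OF triple det_B gd 1 2 3 inj]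
  show "subgroup (range elem) Osc" "Osc\<lparr>carrier := range elem\<rparr> \<cong> disc_osc r B l"
    using * by (simp_all add: elem_def)
qed

lemma generate_eq: "generate Osc (heis_to_osc ` heis_lin P ` Gamma_set r \<union> {gd}) = range elem"
proof (rule Osc.generateI[OF range_elem(1), symmetric])
  have "normal_form Osc ga gb gc p = elem (p, 0)" for p
    by (simp add: elem_def)
  moreover have "gd = elem ((0, 0, 0), 1)"
    by (simp add: elem_def normal_form_def)
  ultimately show "heis_to_osc ` heis_lin P ` Gamma_set r \<union> {gd} \<subseteq> range elem"
    unfolding generators_image by auto
next
  fix K assume K: "subgroup K Osc" and sub: "heis_to_osc ` heis_lin P ` Gamma_set r \<union> {gd} \<subseteq> K"
  have "normal_form Osc ga gb gc p \<in> K" for p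
    using sub unfolding generators_image by blast
  moreover have "gd [^]\<^bsub>Osc\<^esub> n \<in> K" for n :: int
    using sub Osc.subgroup_int_pow_closed[OF K] by simp
  ultimately have "elem (p, n) \<in> K" for p n
    unfolding elem_def prod.case by (rule subgroup.m_closed[OF K])
  then show "range elem \<subseteq> K" by (metis image_subsetI surj_pair)
qed

lemma fundamental_domain_fund: "fundamental_domain (range elem) fund"
  unfolding fundamental_domain_def
proof (intro conjI allI)
  show "fund \<in> sets borel"
  proof -
    have m: "(\<lambda>x::osc. fst x / det P) \<in> borel_measurable borel" "(\<lambda>x::osc. (matrix_inv P *v fst (snd x)) $ 1) \<in> borel_measurable borel"
      "(\<lambda>x::osc. (matrix_inv P *v fst (snd x)) $ 2) \<in> borel_measurable borel" "(\<lambda>x::osc. snd (snd x)) \<in> borel_measurable borel"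
      using det_P by (intro borel_measurable_continuous_onI continuous_intros; simp)+
    have "fund = (\<lambda>x. fst x / det P) -` {0..<1 / real r} \<inter> (\<lambda>x. (matrix_inv P *v fst (snd x)) $ 1) -` {0..<1}
      \<inter> (\<lambda>x. (matrix_inv P *v fst (snd x)) $ 2) -` {0..<1} \<inter> (\<lambda>x. snd (snd x)) -` {0..<s}"
      unfolding fund_def by blast
    also have "\<dots> \<in> sets borel"
      by (intro sets.Int m[THEN measurable_sets_borel]) simp_all
    finally show ?thesis .
  qed
next
  fix x
  obtain q where q: "elem q \<cdot> x \<in> fund" "\<And>q'. elem q' \<cdot> x \<in> fund \<Longrightarrow> q' = q"
    using fund_unique[of x] by blast
  then show "\<exists>!l. l \<in> range elem \<and> l \<cdot> x \<in> fund"
    by (intro ex1I[of _ "elem q"]) blast+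
qed

lemma emeasure_fund: "emeasure lborel fund < \<infinity>"
proof -
  let ?g = "\<lambda>(h, v, t). (det P * h, P *v v, t)"
  have "fund \<subseteq> ?g ` ({0..1 / real r} \<times> cbox 0 1 \<times> {0..s})"
  proof
    fix x assume x: "x \<in> fund"
    show "x \<in> ?g ` ({0..1 / real r} \<times> cbox 0 1 \<times> {0..s})"
    proof (rule image_eqI)
      show "x = ?g (fst x / det P, matrix_inv P *v fst (snd x), snd (snd x))"
        using det_P by (simp add: matrix_inv_vec_cancel[OF P])
      show "(fst x / det P, matrix_inv P *v fst (snd x), snd (snd x)) \<in> {0..1 / real r} \<times> cbox 0 1 \<times> {0..s}"
        using x by (simp add: fund_def mem_box_cart forall_2)
    qed
  qed
  moreover have "compact (?g ` ({0..1 / real r} \<times> cbox 0 1 \<times> {0..s}))"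
    unfolding case_prod_beta
    by (intro compact_continuous_image continuous_intros compact_Times compact_Icc compact_cbox)
  ultimately have "bounded fund"
    using bounded_subset compact_imp_bounded by blast
  then show ?thesis by (rule emeasure_bounded_finite)
qed

lemma fund_interior: "open fund_interior" "fund_interior \<noteq> {}" "fund_interior \<subseteq> fund"
proof -
  have "fund_interior = (\<lambda>x. fst x / det P) -` {0<..<1 / real r} \<inter> (\<lambda>x. (matrix_inv P *v fst (snd x)) $ 1) -` {0<..<1}
      \<inter> (\<lambda>x. (matrix_inv P *v fst (snd x)) $ 2) -` {0<..<1} \<inter> (\<lambda>x. snd (snd x)) -` {0<..<s}"
    unfolding fund_interior_def by blast
  also have "open \<dots>"
    using det_P by (intro open_Int open_vimage open_greaterThanLessThan continuous_intros) simp_all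
  finally show "open fund_interior" .
  have "(det P * (1 / (2 * real r)), P *v vector [1/2, 1/2], s / 2) \<in> fund_interior"
    using det_P r s by (simp add: fund_interior_def matrix_inv_vec_cancel[OF P] field_simps)
  then show "fund_interior \<noteq> {}" by blast
  show "fund_interior \<subseteq> fund"
    unfolding fund_def fund_interior_def by (rule Collect_mono) simp
qed

end

lemma conj_iso_subgroup:
  assumes "subgroup L Osc"
  shows "subgroup ((\<lambda>x. g \<cdot> x \<cdot> oinv g) ` L) Osc"
    and "Osc\<lparr>carrier := (\<lambda>x. g \<cdot> x \<cdot> oinv g) ` L\<rparr> \<cong> Osc\<lparr>carrier := L\<rparr>"
proof -
  let ?c = "\<lambda>x. g \<cdot> x \<cdot> oinv g"
  have mult: "?c (x \<cdot> y) = ?c x \<cdot> ?c y" for x y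
    by (simp add: Osc.m_assoc Osc.inv_solve_left)
  have inj: "inj ?c"
    by (rule injI) (simp add: Osc.Units_eq)
  interpret c: group_hom Osc Osc ?c
    by (intro group_hom.intro group_hom_axioms.intro group_Osc homI) (simp_all add: mult)
  show "subgroup (?c ` L) Osc"
    by (rule c.subgroup_img_is_subgroup[OF assms])
  have "?c \<in> iso (Osc\<lparr>carrier := L\<rparr>) (Osc\<lparr>carrier := ?c ` L\<rparr>)"
    using inj by (intro isoI homI) (simp_all add: mult bij_betw_def inj_on_subset[OF inj subset_UNIV])
  then show "Osc\<lparr>carrier := ?c ` L\<rparr> \<cong> Osc\<lparr>carrier := L\<rparr>"
    using group.iso_sym[OF subgroup.subgroup_is_group[OF assms group_Osc]] is_isoI by blast
qed

lemma fundamental_domain_conj: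
  assumes "fundamental_domain L F"
  shows "fundamental_domain ((\<lambda>x. g \<cdot> x \<cdot> oinv g) ` L) ((\<lambda>x. oinv g \<cdot> x) -` F)"
  unfolding fundamental_domain_def
proof (intro conjI allI)
  have F: "F \<in> sets borel" "\<And>x. \<exists>!l. l \<in> L \<and> l \<cdot> x \<in> F"
    using assms by (simp_all add: fundamental_domain_def)
  show "(\<lambda>x. oinv g \<cdot> x) -` F \<in> sets borel"
    using F(1) by (rule vimage_Osc_mult)
  fix x
  let ?c = "\<lambda>x. g \<cdot> x \<cdot> oinv g"
  have eq: "oinv g \<cdot> (?c l \<cdot> x) = l \<cdot> (oinv g \<cdot> x)" for l
    by (simp add: Osc.m_assoc Osc.inv_solve_left')
  obtain l where l: "l \<in> L" "l \<cdot> (oinv g \<cdot> x) \<in> F"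
    and uniq: "\<And>m. m \<in> L \<Longrightarrow> m \<cdot> (oinv g \<cdot> x) \<in> F \<Longrightarrow> m = l"
    using F(2)[of "oinv g \<cdot> x"] by (elim ex1E conjE) blast
  show "\<exists>!m. m \<in> ?c ` L \<and> m \<cdot> x \<in> (\<lambda>x. oinv g \<cdot> x) -` F"
  proof (rule ex1I[of _ "?c l"])
    show "?c l \<in> ?c ` L \<and> ?c l \<cdot> x \<in> (\<lambda>x. oinv g \<cdot> x) -` F"
      using l by (simp add: eq)
    fix m assume m: "m \<in> ?c ` L \<and> m \<cdot> x \<in> (\<lambda>x. oinv g \<cdot> x) -` F"
    then obtain l' where "l' \<in> L" "m = ?c l'" by blast
    then show "m = ?c l" using m uniq[of l'] by (simp add: eq)
  qed
qed

context lattice_data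
begin

theorem L_lat_lattice: "osc_lattice (L_lat r s \<eta> P z \<xi>)"
  and L_lat_iso: "Osc\<lparr>carrier := L_lat r s \<eta> P z \<xi>\<rparr> \<cong> disc_osc r B l"
proof -
  let ?g = "(0, \<eta>, 0) :: osc"
  let ?c = "\<lambda>x. ?g \<cdot> x \<cdot> oinv ?g"
  have L: "L_lat r s \<eta> P z \<xi> = ?c ` range elem"
    unfolding L_lat_def gd_def[symmetric] generate_eq osc_conj_def[abs_def] ..
  have "emeasure lborel ((\<lambda>x. oinv ?g \<cdot> x) -` fund) < \<infinity>"
    using emeasure_fund fundamental_domain_fund by (simp add: emeasure_Osc_translate fundamental_domain_def)
  moreover obtain u where u: "u \<in> fund_interior" using fund_interior(2) by blast
  have "?g \<cdot> u \<in> (\<lambda>x. oinv ?g \<cdot> x) -` fund_interior"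
    using u by (simp add: Osc_assoc[symmetric] del: Osc_simps(2))
  then have "(\<lambda>x. oinv ?g \<cdot> x) -` fund_interior \<noteq> {}" by blast
  ultimately show "osc_lattice (L_lat r s \<eta> P z \<xi>)"
    unfolding L
    by (intro osc_lattice_fundamental_domain[OF conj_iso_subgroup(1)[OF range_elem(1)]
          fundamental_domain_conj[OF fundamental_domain_fund] open_Osc_left_vimage[OF fund_interior(1)]])
       (use fund_interior(3) in auto)
  show "Osc\<lparr>carrier := L_lat r s \<eta> P z \<xi>\<rparr> \<cong> disc_osc r B l"
    unfolding L using conj_iso_subgroup(2)[OF range_elem(1)] range_elem(2) iso_trans by blast
qed

end

section \<open>Recurrence of lattices\<close>

text \<open>The property that replaces the invariant measure in the study of lattices; unlike the measure, it is
easily carried along under conjugation (\<open>recurrent_conj\<close>).\<close>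

definition recurrent :: "osc set \<Rightarrow> bool" where
  "recurrent L \<longleftrightarrow> (\<forall>V g. open V \<longrightarrow> V \<noteq> {} \<longrightarrow>
    (\<exists>n::nat. n > 0 \<and> (\<exists>v\<in>V. \<exists>w\<in>V. v \<cdot> g [^]\<^bsub>Osc\<^esub> n \<cdot> oinv w \<in> L)))"

lemma coset_image_open:
  assumes L: "subgroup L Osc" and V: "open V"
  shows "(\<lambda>x. L #>\<^bsub>Osc\<^esub> x) ` V \<in> sets (quotient_borel L)"
proof (rule sets_quotient_borel_open[OF L])
  show sub: "(\<lambda>x. L #>\<^bsub>Osc\<^esub> x) ` V \<subseteq> rcosets\<^bsub>Osc\<^esub> L"
    using coset_in_rcosets[OF L] by blast
  have "\<Union>((\<lambda>x. L #>\<^bsub>Osc\<^esub> x) ` V) = (\<Union>l\<in>L. (\<lambda>x. l \<cdot> x) -` V)"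
  proof (intro equalityI subsetI)
    fix x assume "x \<in> \<Union>((\<lambda>x. L #>\<^bsub>Osc\<^esub> x) ` V)"
    then obtain v l where v: "v \<in> V" and l: "l \<in> L" "x = l \<cdot> v"
      unfolding r_coset_def by blast
    have "oinv l \<cdot> x = v"
      by (simp add: l(2) Osc_assoc[symmetric])
    then show "x \<in> (\<Union>l\<in>L. (\<lambda>x. l \<cdot> x) -` V)"
      using v subgroup.m_inv_closed[OF L l(1)] by blast
  next
    fix x assume "x \<in> (\<Union>l\<in>L. (\<lambda>x. l \<cdot> x) -` V)"
    then obtain l where "l \<in> L" "l \<cdot> x \<in> V" by blast
    then show "x \<in> \<Union>((\<lambda>x. L #>\<^bsub>Osc\<^esub> x) ` V)"
      using coset_left[OF L \<open>l \<in> L\<close>, of x] coset_mem[OF L, of x] by blast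
  qed
  also have "open \<dots>"
    using open_Osc_left_vimage[OF V] by blast
  finally show "open (\<Union>((\<lambda>x. L #>\<^bsub>Osc\<^esub> x) ` V))" .
qed

text \<open>The images of \<open>V\<close> in the quotient, translated by the powers of \<open>g\<close>, all have the same measure. It is
positive because countably many translates of the image of \<open>V\<close> cover the quotient. In a finite measure
space two of them must intersect.\<close>

theorem osc_lattice_recurrent:
  assumes "osc_lattice L"
  shows "recurrent L"
  unfolding recurrent_def
proof (intro allI impI)
  fix V :: "osc set" and g
  assume V: "open V" "V \<noteq> {}"
  from assms obtain M where L: "subgroup L Osc" and M_sets: "sets M = sets (quotient_borel L)"
    and fin: "finite_measure M" and nz: "emeasure M (space M) \<noteq> 0"
    and inv: "\<And>h S. S \<in> sets M \<Longrightarrow> emeasure M ((\<lambda>C. C #>\<^bsub>Osc\<^esub> h) ` S) = emeasure M S"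
    unfolding osc_lattice_def finite_invariant_quotient_measure_def by auto
  interpret finite_measure M by fact
  have M_space: "space M = rcosets\<^bsub>Osc\<^esub> L"
    using sets_eq_imp_space_eq[OF M_sets] by (simp add: space_quotient_borel[OF L])
  define A where "A h = (\<lambda>x. L #>\<^bsub>Osc\<^esub> (x \<cdot> h)) ` V" for h
  have A_eq: "A h = (\<lambda>C. C #>\<^bsub>Osc\<^esub> h) ` (\<lambda>x. L #>\<^bsub>Osc\<^esub> x) ` V" for h
    by (simp add: A_def image_image coset_translate[OF L])
  note V_sets = coset_image_open[OF L V(1)]
  have A_sets: "A h \<in> sets M" for h
    unfolding A_eq M_sets by (rule sets_coset_translate_image[OF L V_sets])
  have A_measure: "emeasure M (A h) = emeasure M ((\<lambda>x. L #>\<^bsub>Osc\<^esub> x) ` V)" for h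
    unfolding A_eq by (rule inv) (simp add: M_sets V_sets)
  \<comment> \<open>A countable dense set of translations suffices to cover the quotient.\<close>
  have pos: "emeasure M (A h) \<noteq> 0" for h
  proof
    assume 0: "emeasure M (A h) = 0"
    obtain Q :: "osc set" where Q: "countable Q" "\<And>X. open X \<Longrightarrow> X \<noteq> {} \<Longrightarrow> \<exists>q\<in>Q. q \<in> X"
      using countable_dense_exists by blast
    have "(\<Union>q\<in>Q. A (oinv q)) \<in> null_sets M"
      using Q(1) by (rule null_sets_UN') (use 0 A_measure A_sets in \<open>simp add: null_sets_def\<close>)
    moreover have "space M \<subseteq> (\<Union>q\<in>Q. A (oinv q))"
    proof
      fix C assume "C \<in> space M"
      then obtain x where x: "C = L #>\<^bsub>Osc\<^esub> x" unfolding M_space by (rule rcosets_cases[OF L])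
      obtain v where v: "v \<in> V" using V by blast
      have "oinv x \<cdot> v \<in> (\<lambda>q. x \<cdot> q) -` V"
        using v by (simp add: Osc_assoc[symmetric])
      then obtain q where q: "q \<in> Q" "x \<cdot> q \<in> V"
        using Q(2)[OF open_Osc_left_vimage[OF V(1)], of x] by blast
      have "C = L #>\<^bsub>Osc\<^esub> (x \<cdot> q \<cdot> oinv q)"
        by (simp add: x Osc_assoc)
      then have "C \<in> A (oinv q)"
        unfolding A_def using q(2) by blast
      then show "C \<in> (\<Union>q\<in>Q. A (oinv q))" using q(1) by blast
    qed
    ultimately have "space M \<in> null_sets M"
      using null_sets_subset[of _ M "space M"] sets.top by blast
    then show False using nz by (simp add: null_sets_def)
  qed
  have "\<not> disjoint_family (\<lambda>i::nat. A (g [^]\<^bsub>Osc\<^esub> i))"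
  proof
    assume disj: "disjoint_family (\<lambda>i::nat. A (g [^]\<^bsub>Osc\<^esub> i))"
    have "(\<lambda>i::nat. measure M (A (g [^]\<^bsub>Osc\<^esub> i))) sums measure M (\<Union>i::nat. A (g [^]\<^bsub>Osc\<^esub> i))"
      by (rule finite_measure_UNION[OF _ disj]) (use A_sets in blast)
    moreover have "measure M (A (g [^]\<^bsub>Osc\<^esub> (i::nat))) = measure M (A g)" for i
      by (simp add: measure_def A_measure)
    ultimately have "summable (\<lambda>i::nat. measure M (A g))"
      by (simp add: sums_iff)
    then have "measure M (A g) = 0"
      by (simp add: summable_const_iff)
    then show False using pos[of g] by (simp add: emeasure_eq_measure)
  qed
  then obtain i j :: nat where "i \<noteq> j" "A (g [^]\<^bsub>Osc\<^esub> i) \<inter> A (g [^]\<^bsub>Osc\<^esub> j) \<noteq> {}"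
    unfolding disjoint_family_on_def by blast
  then obtain i j :: nat where ij: "i < j" "A (g [^]\<^bsub>Osc\<^esub> i) \<inter> A (g [^]\<^bsub>Osc\<^esub> j) \<noteq> {}"
    by (metis inf_commute linorder_neq_iff)
  then obtain w v where wv: "w \<in> V" "v \<in> V"
    "L #>\<^bsub>Osc\<^esub> (w \<cdot> g [^]\<^bsub>Osc\<^esub> i) = L #>\<^bsub>Osc\<^esub> (v \<cdot> g [^]\<^bsub>Osc\<^esub> j)"
    unfolding A_def by blast
  have "v \<cdot> g [^]\<^bsub>Osc\<^esub> j \<in> L #>\<^bsub>Osc\<^esub> (w \<cdot> g [^]\<^bsub>Osc\<^esub> i)"
    unfolding wv(3) by (rule coset_mem[OF L])
  then obtain m where m: "m \<in> L" "v \<cdot> g [^]\<^bsub>Osc\<^esub> j = m \<cdot> (w \<cdot> g [^]\<^bsub>Osc\<^esub> i)"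
    unfolding r_coset_def by blast
  have "g [^]\<^bsub>Osc\<^esub> j = g [^]\<^bsub>Osc\<^esub> (j - i) \<cdot> g [^]\<^bsub>Osc\<^esub> i"
    using ij(1) by (simp add: Osc.nat_pow_mult)
  with m(2) have "(v \<cdot> g [^]\<^bsub>Osc\<^esub> (j - i)) \<cdot> g [^]\<^bsub>Osc\<^esub> i = (m \<cdot> w) \<cdot> g [^]\<^bsub>Osc\<^esub> i"
    by (simp add: Osc_assoc)
  then have "v \<cdot> g [^]\<^bsub>Osc\<^esub> (j - i) = m \<cdot> w"
    by simp
  then have "v \<cdot> g [^]\<^bsub>Osc\<^esub> (j - i) \<cdot> oinv w = m"
    by (simp add: Osc_assoc)
  then show "\<exists>n::nat. n > 0 \<and> (\<exists>v\<in>V. \<exists>w\<in>V. v \<cdot> g [^]\<^bsub>Osc\<^esub> n \<cdot> oinv w \<in> L)"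
    using ij(1) wv(1,2) m(1) by (intro exI[of _ "j - i"]) auto
qed

lemma recurrent_conj:
  assumes "recurrent L"
  shows "recurrent ((\<lambda>x. h \<cdot> x \<cdot> oinv h) ` L)"
  unfolding recurrent_def
proof (intro allI impI)
  fix V :: "osc set" and g assume V: "open V" "V \<noteq> {}"
  let ?V = "(\<lambda>x. h \<cdot> x) -` V"
  obtain v where "v \<in> V" using V by blast
  then have "oinv h \<cdot> v \<in> ?V" by (simp add: Osc_assoc[symmetric])
  then obtain n :: nat and v w where n: "n > 0" "v \<in> ?V" "w \<in> ?V"
    "v \<cdot> g [^]\<^bsub>Osc\<^esub> n \<cdot> oinv w \<in> L"
    using assms open_Osc_left_vimage[OF V(1), of h] unfolding recurrent_def by blast
  have "(h \<cdot> v) \<cdot> g [^]\<^bsub>Osc\<^esub> n \<cdot> oinv (h \<cdot> w)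
      = h \<cdot> (v \<cdot> g [^]\<^bsub>Osc\<^esub> n \<cdot> oinv w) \<cdot> oinv h"
    by (simp add: Osc_assoc Osc.inv_mult_group)
  then have "(h \<cdot> v) \<cdot> g [^]\<^bsub>Osc\<^esub> n \<cdot> oinv (h \<cdot> w)
      \<in> (\<lambda>x. h \<cdot> x \<cdot> oinv h) ` L"
    using n(4) by blast
  then show "\<exists>n::nat. n > 0 \<and> (\<exists>v\<in>V. \<exists>w\<in>V. v \<cdot> g [^]\<^bsub>Osc\<^esub> n \<cdot> oinv w
      \<in> (\<lambda>x. h \<cdot> x \<cdot> oinv h) ` L)"
    using n(1-3) by blast
qed

section \<open>Discrete subgroups of the line and of the symplectic plane\<close>

lemma additive_of_int_scaleR:
  fixes S :: "'a::real_vector set"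
  assumes diff: "\<And>x y. x \<in> S \<Longrightarrow> y \<in> S \<Longrightarrow> x - y \<in> S" and x: "x \<in> S"
  shows "of_int k *\<^sub>R x \<in> S"
proof -
  have 0: "0 \<in> S" using diff[OF x x] by simp
  have add: "u + v \<in> S" if "u \<in> S" "v \<in> S" for u v
    using diff[OF that(1) diff[OF 0 that(2)]] by simp
  show ?thesis
  proof (induction k rule: int_induct[where k = 0])
    case (step1 i)
    then show ?case using add[OF _ x] by (simp add: scaleR_add_left)
  next
    case (step2 i)
    then show ?case using diff[OF _ x] by (simp add: scaleR_diff_left)
  qed (simp add: 0)
qed

text \<open>The infimum of the positive elements is attained, since two elements closer than \<open>e\<close> coincide.\<close>

lemma discrete_real_subgroup_cyclic:
  fixes S :: "real set"
  assumes diff: "\<And>x y. x \<in> S \<Longrightarrow> y \<in> S \<Longrightarrow> x - y \<in> S"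
    and e: "e > 0" "\<And>x. x \<in> S \<Longrightarrow> \<bar>x\<bar> < e \<Longrightarrow> x = 0"
    and x0: "x0 \<in> S" "x0 \<noteq> 0"
  obtains c where "c > 0" "c \<in> S" "\<And>x. x \<in> S \<Longrightarrow> \<exists>k::int. x = of_int k * c"
proof -
  define Q where "Q = {x \<in> S. x > 0}"
  have 0: "0 \<in> S" using diff[OF x0(1) x0(1)] by simp
  have "- x0 \<in> S" using diff[OF 0 x0(1)] by simp
  with x0 have ne: "Q \<noteq> {}" unfolding Q_def by (cases "x0 > 0") auto
  have bdd: "bdd_below Q" by (rule bdd_belowI[of _ 0]) (simp add: Q_def)
  have "Inf Q < Inf Q + e" using e(1) by simp
  then obtain c where c: "c \<in> Q" "c < Inf Q + e"
    using cInf_lessD[OF ne] by blast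
  have min: "c \<le> y" if "y \<in> Q" for y
  proof (rule ccontr)
    assume "\<not> c \<le> y"
    moreover have "Inf Q \<le> y" using bdd that by (rule cInf_lower[rotated])
    ultimately have "c - y = 0"
      using c that by (intro e(2) diff) (auto simp: Q_def)
    then show False using \<open>\<not> c \<le> y\<close> by simp
  qed
  have c': "c > 0" "c \<in> S" using c by (auto simp: Q_def)
  have "\<exists>k::int. x = of_int k * c" if x: "x \<in> S" for x
  proof -
    have "x - of_int \<lfloor>x / c\<rfloor> * c \<in> S"
      using diff[OF x additive_of_int_scaleR[of S c "\<lfloor>x / c\<rfloor>", OF diff c'(2)]] by simp
    moreover have "0 \<le> x - of_int \<lfloor>x / c\<rfloor> * c" "x - of_int \<lfloor>x / c\<rfloor> * c < c"
      using c'(1) floor_divide_lower[of c x] floor_divide_upper[of c x] by (simp_all add: algebra_simps)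
    ultimately have "x - of_int \<lfloor>x / c\<rfloor> * c = 0"
      using min[of "x - of_int \<lfloor>x / c\<rfloor> * c"] by (force simp: Q_def)
    then show ?thesis by (intro exI[of _ "\<lfloor>x / c\<rfloor>"]) simp
  qed
  with c' show ?thesis using that by blast
qed

text \<open>Cramer's rule in the plane.\<close>

lemma omega_cramer: "omega u v *\<^sub>R w = omega w v *\<^sub>R u - omega w u *\<^sub>R v"
  by (simp add: vec_eq_iff forall_2 omega_def algebra_simps)

text \<open>A subgroup of the plane on which the symplectic form takes values in \<open>c \<int>\<close> is contained in the dual of
the lattice spanned by \<open>u\<close> and \<open>v\<close>. A basis is obtained by echelon reduction: \<open>w2\<close> generates the values
\<open>omega w u\<close>, and \<open>w1\<close> generates the values \<open>omega w v\<close> on the elements with \<open>omega w u = 0\<close>.\<close>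

lemma symplectic_lattice_basis:
  fixes \<Lambda> :: "(real^2) set"
  assumes diff: "\<And>x y. x \<in> \<Lambda> \<Longrightarrow> y \<in> \<Lambda> \<Longrightarrow> x - y \<in> \<Lambda>"
    and c: "c > 0" "\<And>x y. x \<in> \<Lambda> \<Longrightarrow> y \<in> \<Lambda> \<Longrightarrow> \<exists>k::int. omega x y = of_int k * c"
    and u: "u \<in> \<Lambda>" and v: "v \<in> \<Lambda>" and uv: "omega u v \<noteq> 0"
  obtains w1 w2 where "w1 \<in> \<Lambda>" "w2 \<in> \<Lambda>" "omega w1 w2 > 0"
    "\<And>w. w \<in> \<Lambda> \<Longrightarrow> \<exists>x y :: int. w = of_int x *\<^sub>R w1 + of_int y *\<^sub>R w2"
proof -
  have mult: "of_int k *\<^sub>R x \<in> \<Lambda>" if "x \<in> \<Lambda>" for k x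
    by (rule additive_of_int_scaleR) (use diff that in auto)
  have small: "omega x y = 0" if "x \<in> \<Lambda>" "y \<in> \<Lambda>" "\<bar>omega x y\<bar> < c" for x y
  proof -
    obtain k :: int where k: "omega x y = of_int k * c" using c(2) \<open>x \<in> \<Lambda>\<close> \<open>y \<in> \<Lambda>\<close> by blast
    then have "\<bar>of_int k\<bar> * c < 1 * c" using that(3) c(1) by (simp add: abs_mult)
    then have "k = 0" using c(1) by (simp add: mult_less_cancel_right_disj)
    then show ?thesis using k by simp
  qed
  obtain p where p: "p > 0" "p \<in> (\<lambda>w. omega w u) ` \<Lambda>"
    "\<And>x. x \<in> (\<lambda>w. omega w u) ` \<Lambda> \<Longrightarrow> \<exists>k::int. x = of_int k * p"
  proof (rule discrete_real_subgroup_cyclic[of "(\<lambda>w. omega w u) ` \<Lambda>" c "omega v u"])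
    show "x - y \<in> (\<lambda>w. omega w u) ` \<Lambda>" if "x \<in> (\<lambda>w. omega w u) ` \<Lambda>" "y \<in> (\<lambda>w. omega w u) ` \<Lambda>" for x y
      using that diff by (auto simp flip: omega_simps(3))
    show "omega v u \<in> (\<lambda>w. omega w u) ` \<Lambda>" using v by blast
    show "omega v u \<noteq> 0" using uv omega_swap[of v u] by simp
  qed (use c small u in auto)
  then obtain w2 where w2: "w2 \<in> \<Lambda>" "omega w2 u = p" by blast
  let ?K = "{w \<in> \<Lambda>. omega w u = 0}"
  obtain q where q: "q > 0" "q \<in> (\<lambda>w. omega w v) ` ?K"
    "\<And>x. x \<in> (\<lambda>w. omega w v) ` ?K \<Longrightarrow> \<exists>k::int. x = of_int k * q"
  proof (rule discrete_real_subgroup_cyclic[of "(\<lambda>w. omega w v) ` ?K" c "omega u v"])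
    show "x - y \<in> (\<lambda>w. omega w v) ` ?K" if xy: "x \<in> (\<lambda>w. omega w v) ` ?K" "y \<in> (\<lambda>w. omega w v) ` ?K" for x y
    proof -
      obtain a b where "a \<in> ?K" "b \<in> ?K" "x = omega a v" "y = omega b v" using xy by blast
      then show ?thesis using diff by (intro image_eqI[of _ _ "a - b"]) auto
    qed
  qed (use c small u v uv in auto)
  then obtain w1 where w1: "w1 \<in> \<Lambda>" "omega w1 u = 0" "omega w1 v = q" by blast
  have gen: "\<exists>x y :: int. w = of_int x *\<^sub>R w1 + of_int y *\<^sub>R w2" if w: "w \<in> \<Lambda>" for w
  proof -
    obtain y :: int where y: "omega w u = of_int y * p" using p(3) w by blast
    let ?w = "w - of_int y *\<^sub>R w2"
    have "?w \<in> ?K" using diff[OF w mult[OF w2(1)]] y w2 by simp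
    then obtain x :: int where x: "omega ?w v = of_int x * q" using q(3) by blast
    have "omega u v *\<^sub>R (?w - of_int x *\<^sub>R w1) = 0"
      unfolding omega_cramer[of u v] using x y w1 w2 by simp
    then have "?w - of_int x *\<^sub>R w1 = 0"
      using uv by (simp only: scaleR_eq_0_iff) blast
    then have "w = of_int x *\<^sub>R w1 + of_int y *\<^sub>R w2"
      by (simp add: algebra_simps)
    then show ?thesis by blast
  qed
  have "omega u v * omega w1 w2 = - (q * p)"
    using omega_cramer[of u v w1] w1 w2 omega_swap[of u w2]
    by (metis diff_zero mult_minus_right omega_simps(7) scaleR_zero_left)
  then have "omega w1 w2 \<noteq> 0" using p(1) q(1) by auto
  then consider "omega w1 w2 > 0" | "omega w2 w1 > 0"
    using omega_swap[of w2 w1] by linarith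
  then show ?thesis
  proof cases
    case 1
    then show ?thesis using that w1 w2 gen by blast
  next
    case 2
    have "\<exists>x y :: int. w = of_int x *\<^sub>R w2 + of_int y *\<^sub>R w1" if "w \<in> \<Lambda>" for w
      using gen[OF that] by (metis add.commute)
    then show ?thesis using that 2 w1 w2 by blast
  qed
qed

text \<open>For \<open>e\<^sup>t\<close> between \<open>1/2\<close> and \<open>2\<close> the trace lies in the interval from \<open>2\<close> to \<open>5/2\<close>, whose only integer is
\<open>2\<close>.\<close>

lemma exp_trace_small:
  fixes t :: real
  assumes "\<bar>t\<bar> < ln 2" and k: "exp t + exp (- t) = of_int k"
  shows "t = 0"
proof -
  have "t < ln 2" "ln (1/2) < t" using assms(1) by (simp_all add: ln_div)
  then have b: "exp t < 2" "exp t > 1 / 2"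
    by (metis exp_less_mono exp_ln zero_less_numeral, metis exp_less_mono exp_ln half_gt_zero zero_less_one)
  have inv: "exp (- t) * exp t = 1" by (simp flip: exp_add)
  have "(2 - exp t) * (exp t - 1 / 2) > 0" using b by simp
  then have "exp t * (exp t + exp (- t)) < exp t * (5 / 2)"
    using inv by (simp add: algebra_simps)
  then have "exp t + exp (- t) < 5 / 2" by simp
  moreover have sq: "exp t * (exp t + exp (- t)) = exp t * 2 + (exp t - 1)\<^sup>2"
    using inv by (simp add: power2_eq_square algebra_simps)
  then have "exp t * (exp t + exp (- t)) \<ge> exp t * 2" by simp
  then have "exp t + exp (- t) \<ge> 2" by simp
  ultimately have "k = 2" unfolding k by linarith
  then have "(exp t - 1)\<^sup>2 = 0" using sq k by simp
  then show ?thesis by simp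
qed

lemma exp_trace_gt_2:
  fixes t :: real
  assumes "t \<noteq> 0"
  shows "exp t + exp (- t) > 2"
proof -
  have "exp t * (exp t + exp (- t)) = exp t * 2 + (exp t - 1)\<^sup>2"
    by (simp add: power2_eq_square algebra_simps flip: exp_add)
  moreover have "(exp t - 1)\<^sup>2 > 0" using assms by simp
  ultimately have "exp t * 2 < exp t * (exp t + exp (- t))" by linarith
  then show ?thesis by simp
qed

section \<open>The structure of an arbitrary lattice\<close>

lemma boost_lightcone:
  "(boost t *v \<xi>) $ 1 + (boost t *v \<xi>) $ 2 = exp t * (\<xi>$1 + \<xi>$2)"
  "(boost t *v \<xi>) $ 1 - (boost t *v \<xi>) $ 2 = exp (- t) * (\<xi>$1 - \<xi>$2)"
  using cosh_plus_sinh[of t] cosh_minus_sinh[of t]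
  by (simp_all add: algebra_simps flip: cosh_plus_sinh cosh_minus_sinh)

lemma boost_minus: "boost t *v (- \<xi>) = - (boost t *v \<xi>)"
  by (simp add: vec_eq_iff forall_2)

lemma vec2_zero_iff: "\<xi> = 0 \<longleftrightarrow> \<xi>$1 + \<xi>$2 = 0 \<and> \<xi>$1 - \<xi>$2 = 0" for \<xi> :: "real^2"
  by (auto simp: vec_eq_iff forall_2)

lemma boost_fixpoint:
  assumes "t \<noteq> 0" "boost t *v \<xi> = \<xi>"
  shows "\<xi> = 0"
proof -
  have "\<xi>$1 + \<xi>$2 = exp t * (\<xi>$1 + \<xi>$2)" "\<xi>$1 - \<xi>$2 = exp (- t) * (\<xi>$1 - \<xi>$2)"
    using boost_lightcone[of t \<xi>] unfolding assms(2) by simp_all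
  then show ?thesis
    using assms(1) by (simp add: vec2_zero_iff)
qed

text \<open>The element of positive time is normalised to have no planar part; this can be achieved by a
conjugation.\<close>

locale recurrent_discrete =
  fixes L :: "osc set" and z0 t0 e :: real
  assumes L: "subgroup L Osc" and e: "e > 0" "\<And>x. x \<in> L \<Longrightarrow> norm x < e \<Longrightarrow> x = 0"
    and rec: "recurrent L" and t0: "t0 > 0" and \<delta>: "(z0, 0, t0) \<in> L"
begin

lemma mult_closed: "x \<in> L \<Longrightarrow> y \<in> L \<Longrightarrow> x \<cdot> y \<in> L"
  using subgroup.m_closed[OF L] .

lemma inv_closed: "x \<in> L \<Longrightarrow> oinv x \<in> L"
  using subgroup.m_inv_closed[OF L] .

text \<open>If all planar parts vanished, recurrence under a unit translation of the plane would fail for the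
set \<open>V\<close> below, on which the first coordinate of the planar part, moved to the right of the time
component, is less than \<open>1/2\<close> in absolute value.\<close>

lemma exists_translation: "\<exists>z \<xi> t. (z, \<xi>, t) \<in> L \<and> \<xi> \<noteq> 0"
proof (rule ccontr)
  assume "\<not> ?thesis"
  then have triv: "\<xi> = 0" if "(z, \<xi>, t) \<in> L" for z \<xi> t using that by blast
  let ?V = "{x :: osc. \<bar>(boost (- snd (snd x)) *v fst (snd x)) $ 1\<bar> < 1 / 2}"
  have "open ?V" by (intro open_Collect_less continuous_intros)
  moreover have "(0, 0, 0) \<in> ?V" by simp
  ultimately obtain n :: nat and v w where n: "n > 0" and vw: "v \<in> ?V" "w \<in> ?V"
    and m: "v \<cdot> (0, vector [1, 0], 0) [^]\<^bsub>Osc\<^esub> n \<cdot> oinv w \<in> L"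
    using rec unfolding recurrent_def by blast
  obtain zv \<xi>v tv zw \<xi>w tw where v: "v = (zv, \<xi>v, tv)" and w: "w = (zw, \<xi>w, tw)"
    by (cases v, cases w)
  have pow: "(0, vector [1, 0], 0) [^]\<^bsub>Osc\<^esub> n = (0, real n *\<^sub>R vector [1, 0], 0)"
    using Osc_heis_pow[of 0 "vector [1, 0]" "int n"] by (simp add: int_pow_int)
  have "\<xi>v + boost tv *v (real n *\<^sub>R vector [1, 0]) - boost (tv - tw) *v \<xi>w = 0"
  proof -
    have "\<exists>h. v \<cdot> (0, real n *\<^sub>R vector [1, 0], 0) \<cdot> oinv w =
        (h, \<xi>v + boost tv *v (real n *\<^sub>R vector [1, 0]) - boost (tv - tw) *v \<xi>w, tv - tw)"
      by (simp add: v w Osc_inv boost_add boost_minus)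
    then show ?thesis using triv m unfolding pow by metis
  qed
  then have "boost (- tv) *v (\<xi>v + boost tv *v (real n *\<^sub>R vector [1, 0]) - boost (tv - tw) *v \<xi>w) = 0"
    by simp
  then have "boost (- tv) *v \<xi>v + real n *\<^sub>R vector [1, 0] - boost (- tw) *v \<xi>w = 0"
    by (simp add: matrix_vector_right_distrib matrix_vector_mult_diff_distrib boost_add)
  then have "(boost (- tv) *v \<xi>v) $ 1 + real n - (boost (- tw) *v \<xi>w) $ 1 = 0"
    by (simp add: vec_eq_iff forall_2)
  moreover have "\<bar>(boost (- tv) *v \<xi>v) $ 1\<bar> < 1 / 2" "\<bar>(boost (- tw) *v \<xi>w) $ 1\<bar> < 1 / 2"
    using vw by (simp_all only: v w mem_Collect_eq fst_conv snd_conv)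
  ultimately have "real n < 1" by linarith
  then show False using n by simp
qed

text \<open>The commutator with \<open>\<delta>\<close> has time \<open>0\<close>, and its planar part does not vanish since \<open>boost t0\<close> has no
non-zero fixed vector.\<close>

lemma exists_heis_translation: "\<exists>z \<xi>. (z, \<xi>, 0) \<in> L \<and> \<xi> \<noteq> 0"
proof -
  obtain z \<xi> t where x: "(z, \<xi>, t) \<in> L" "\<xi> \<noteq> 0" using exists_translation by blast
  have "(z0, 0, t0) \<cdot> (z, \<xi>, t) \<cdot> oinv (z0, 0, t0) \<cdot> oinv (z, \<xi>, t) \<in> L"
    using x \<delta> by (intro mult_closed inv_closed)
  moreover have "\<exists>y. (z0, 0, t0) \<cdot> (z, \<xi>, t) \<cdot> oinv (z0, 0, t0) \<cdot> oinv (z, \<xi>, t)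
      = (y, boost t0 *v \<xi> - \<xi>, 0)"
    by (simp add: Osc_inv boost_minus boost_add)
  ultimately obtain y where "(y, boost t0 *v \<xi> - \<xi>, 0) \<in> L" by force
  moreover have "boost t0 *v \<xi> - \<xi> \<noteq> 0" using boost_fixpoint[of t0 \<xi>] t0 x(2) by auto
  ultimately show ?thesis by blast
qed

lemma conj_heis:
  assumes "(z, \<xi>, t) \<in> L" "(h, w, 0) \<in> L"
  shows "(h + omega \<xi> (boost t *v w), boost t *v w, 0) \<in> L"
  using mult_closed[OF mult_closed[OF assms] inv_closed[OF assms(1)]] unfolding Osc_conj .

text \<open>Iterated conjugation would give elements with the same central part and planar parts \<open>\<rho>\<^sup>n w\<close>. The
quotients of consecutive ones are non-trivial and tend to the identity.\<close>

lemma not_contracted: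
  assumes h: "(h, w, 0) \<in> L" and \<sigma>: "(z, 0, \<sigma>) \<in> L" and \<rho>: "boost \<sigma> *v w = \<rho> *\<^sub>R w" "0 < \<rho>" "\<rho> < 1"
  shows "w = 0"
proof (rule ccontr)
  assume w: "w \<noteq> 0"
  have iter: "(h, \<rho> ^ n *\<^sub>R w, 0) \<in> L" for n
  proof (induction n)
    case (Suc n)
    have "boost \<sigma> *v (\<rho> ^ n *\<^sub>R w) = \<rho> ^ Suc n *\<^sub>R w"
      using \<rho>(1) by (simp add: matrix_vector_mult_scaleR mult.commute)
    then show ?case using conj_heis[OF \<sigma> Suc] by simp
  qed (simp add: h)
  obtain n where n: "\<rho> ^ n < e / norm w"
    using real_arch_pow_inv[of "e / norm w" \<rho>] e(1) w \<rho> by auto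
  let ?y = "(h, \<rho> ^ n *\<^sub>R w, 0) \<cdot> oinv (h, \<rho> ^ Suc n *\<^sub>R w, 0)"
  have y: "?y = (0, (\<rho> ^ n - \<rho> ^ Suc n) *\<^sub>R w, 0)"
    by (simp add: Osc_inv boost_minus algebra_simps)
  have pos: "0 < \<rho> ^ n - \<rho> ^ Suc n"
    using \<rho> by simp
  have "norm ?y = (\<rho> ^ n - \<rho> ^ Suc n) * norm w"
    unfolding y using pos by (simp add: norm_Pair)
  also have "\<dots> \<le> \<rho> ^ n * norm w"
    using \<rho> by (intro mult_right_mono) auto
  also have "\<dots> < e" using n w by (simp add: field_simps)
  finally have "?y = 0"
    using iter by (intro e(2) mult_closed inv_closed)
  then have "(\<rho> ^ n - \<rho> ^ Suc n) *\<^sub>R w = 0"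
    unfolding y zero_prod_def by (simp only: prod.inject)
  then show False using pos w by (metis less_irrefl scaleR_eq_0_iff)
qed

text \<open>The two light-cone directions are the eigenlines of the boosts: \<open>\<delta>\<close> contracts one of them and its
inverse contracts the other.\<close>

lemma lightcone_nonzero:
  assumes h: "(h, w, 0) \<in> L" and w: "w \<noteq> 0"
  shows "w$1 + w$2 \<noteq> 0" "w$1 - w$2 \<noteq> 0"
proof -
  have b: "boost t *v w = exp (- t) *\<^sub>R w" if "w$1 + w$2 = 0" for t
  proof -
    have "exp (- t) * w$1 + exp (- t) * w$2 = 0" using that by (simp flip: distrib_left)
    then show ?thesis
      using boost_lightcone[of t w] that
      by (subst eq_iff_diff_eq_0) (simp add: vec2_zero_iff right_diff_distrib del: boost_mult_vec)
  qed
  have b': "boost (- t) *v w = exp (- t) *\<^sub>R w" if "w$1 - w$2 = 0" for t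
    using boost_lightcone[of "- t" w] that
    by (subst eq_iff_diff_eq_0) (simp add: vec2_zero_iff del: boost_mult_vec)
  have "(- z0, 0, - t0) \<in> L" using inv_closed[OF \<delta>] by (simp add: Osc_inv)
  with not_contracted[OF h \<delta>, of "exp (- t0)"] not_contracted[OF h, of "- z0" "- t0" "exp (- t0)"]
  show "w$1 + w$2 \<noteq> 0" "w$1 - w$2 \<noteq> 0"
    using b b' t0 w by auto
qed

lemma commutator_central:
  assumes "(h, w, 0) \<in> L" "(h', w', 0) \<in> L"
  shows "(omega w w', 0, 0) \<in> L"
proof -
  have "(h' + omega w w', w', 0) \<cdot> oinv (h', w', 0) \<in> L"
    using conj_heis[OF assms] assms(2) by (intro mult_closed inv_closed) simp_all
  then show ?thesis by (simp add: Osc_inv)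
qed

text \<open>The generators \<open>a, b, c, d\<close> are found in three steps: the centre, the plane and the time axis each
contribute a lattice of rank \<open>1\<close>, \<open>2\<close> and \<open>1\<close>.\<close>

theorem iso_disc_osc:
  obtains r B l where "r > 0" "det B = 1" "trace B > 2" "Osc\<lparr>carrier := L\<rparr> \<cong> disc_osc r B l"
proof -
  obtain z1 u where u: "(z1, u, 0) \<in> L" "u \<noteq> 0" using exists_heis_translation by blast
  define v where "v = boost t0 *v u"
  have v: "(z1, v, 0) \<in> L" using conj_heis[OF \<delta> u(1)] by (simp add: v_def)
  have "omega u v = sinh t0 * ((u$1 + u$2) * (u$1 - u$2))"
    by (simp add: v_def omega_def algebra_simps)
  then have uv: "omega u v \<noteq> 0" using lightcone_nonzero[OF u] t0 by simp
  \<comment> \<open>The centre contains the commutator of \<open>(z1, u, 0)\<close> and its conjugate, so by discreteness it is infinite cyclic.\<close>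
  let ?C = "{h. (h, 0, 0) \<in> L}"
  obtain c where c: "c > 0" "c \<in> ?C" "\<And>x. x \<in> ?C \<Longrightarrow> \<exists>k::int. x = of_int k * c"
  proof (rule discrete_real_subgroup_cyclic[of ?C e "omega u v"])
    show "x - y \<in> ?C" if "x \<in> ?C" "y \<in> ?C" for x y
      using mult_closed[of "(x, 0, 0)" "oinv (y, 0, 0)"] inv_closed[of "(y, 0, 0)"] that by (simp add: Osc_inv)
    show "x = 0" if "x \<in> ?C" "\<bar>x\<bar> < e" for x
      using e(2)[of "(x, 0, 0)"] that by (simp add: norm_Pair zero_prod_def)
    show "omega u v \<in> ?C" using commutator_central[OF u(1) v] by simp
  qed (use e(1) uv in auto)
  \<comment> \<open>The projection to the plane is a lattice because commutators are central.\<close>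
  let ?\<Lambda> = "{w. \<exists>h. (h, w, 0) \<in> L}"
  obtain w1 w2 where w: "w1 \<in> ?\<Lambda>" "w2 \<in> ?\<Lambda>" "omega w1 w2 > 0"
    and gen: "\<And>w. w \<in> ?\<Lambda> \<Longrightarrow> \<exists>x y :: int. w = of_int x *\<^sub>R w1 + of_int y *\<^sub>R w2"
  proof (rule symplectic_lattice_basis[of ?\<Lambda> c u v])
    show "x - y \<in> ?\<Lambda>" if xy: "x \<in> ?\<Lambda>" "y \<in> ?\<Lambda>" for x y
    proof -
      obtain h h' where "(h, x, 0) \<in> L" "(h', y, 0) \<in> L" using xy by blast
      then have "(h, x, 0) \<cdot> oinv (h', y, 0) \<in> L" by (intro mult_closed inv_closed)
      then show ?thesis by (auto simp: Osc_inv)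
    qed
    show "\<exists>k::int. omega x y = of_int k * c" if "x \<in> ?\<Lambda>" "y \<in> ?\<Lambda>" for x y
      using that commutator_central by (intro c(3)) blast
  qed (use c u v uv in auto)
  obtain za zb where ab: "(za, w1, 0) \<in> L" "(zb, w2, 0) \<in> L" using w by blast
  have cL: "(c, 0, 0) \<in> L" using c(2) by simp
  obtain k :: int where k: "omega w1 w2 = of_int k * c"
    using c(3)[of "omega w1 w2"] commutator_central[OF ab] by auto
  have "k > 0" using w(3) c(1) unfolding k by (simp add: zero_less_mult_iff)
  define r where "r = nat k"
  have r: "r > 0" "omega w1 w2 = real r * c" using \<open>k > 0\<close> k by (simp_all add: r_def)
  let ?a = "(za, w1, 0) :: osc" and ?b = "(zb, w2, 0) :: osc" and ?c = "(c, 0, 0) :: osc"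
  let ?N = "normal_form Osc ?a ?b ?c"
  have triple: "heis_triple Osc r ?a ?b ?c" by (rule Osc_heis_triple[OF r(2)])
  have N_closed: "?N p \<in> L" for p
    using ab cL Osc.subgroup_int_pow_closed[OF L] by (cases p) (auto simp: normal_form_def intro!: mult_closed)
  \<comment> \<open>Two elements of time \<open>0\<close> with the same planar part differ by a central element.\<close>
  have N_cases: "\<exists>p. x = ?N p" if x: "x \<in> L" "snd (snd x) = 0" for x
  proof -
    obtain h w where x': "x = (h, w, 0)" using x(2) by (cases x) auto
    obtain i j :: int where ij: "w = of_int i *\<^sub>R w1 + of_int j *\<^sub>R w2" using gen[of w] x(1) x' by blast
    obtain h' where h': "?N (i, j, 0) = (h', w, 0)" by (simp add: Osc_normal_form ij)
    have "(h, w, 0) \<cdot> oinv (h', w, 0) \<in> L"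
      using x N_closed[of "(i, j, 0)"] unfolding x' h' by (intro mult_closed inv_closed)
    then have "h - h' \<in> ?C" by (simp add: Osc_inv)
    then obtain m :: int where "h - h' = of_int m * c" using c(3) by blast
    then have "x = ?N (i, j, m)"
      using h' by (simp add: x' Osc_normal_form)
    then show ?thesis by blast
  qed
  have coords: "x = x' \<and> y = y'" if "of_int x *\<^sub>R w1 + of_int y *\<^sub>R w2 = of_int x' *\<^sub>R w1 + of_int y' *\<^sub>R w2" for x y x' y' :: int
  proof -
    have "omega (of_int x *\<^sub>R w1 + of_int y *\<^sub>R w2) w2 = omega (of_int x' *\<^sub>R w1 + of_int y' *\<^sub>R w2) w2"
      "omega w1 (of_int x *\<^sub>R w1 + of_int y *\<^sub>R w2) = omega w1 (of_int x' *\<^sub>R w1 + of_int y' *\<^sub>R w2)"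
      by (simp_all only: that)
    then show ?thesis using w(3) by simp
  qed
  have N_inj: "p = q" if "?N p = ?N q" for p q
  proof -
    obtain x y m x' y' m' where pq: "p = (x, y, m)" "q = (x', y', m')" by (metis surj_pair)
    have "x = x' \<and> y = y'" using that by (intro coords) (simp add: pq Osc_normal_form)
    with that show ?thesis using c(1) by (simp add: pq Osc_normal_form)
  qed
  \<comment> \<open>Every element acts on the plane lattice by an integral matrix.\<close>
  have action: "\<exists>B m n. (z, \<xi>, t) \<cdot> ?a \<cdot> oinv (z, \<xi>, t) = ?N (B$1$1, B$2$1, m) \<and>
      (z, \<xi>, t) \<cdot> ?b \<cdot> oinv (z, \<xi>, t) = ?N (B$1$2, B$2$2, n) \<and>
      det (B::int^2^2) = 1 \<and> of_int (trace B) = exp t + exp (- t)"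
    if x: "(z, \<xi>, t) \<in> L" for z \<xi> t
  proof -
    obtain p q where
      p: "(z, \<xi>, t) \<cdot> ?a \<cdot> oinv (z, \<xi>, t) = ?N p" and
      q: "(z, \<xi>, t) \<cdot> ?b \<cdot> oinv (z, \<xi>, t) = ?N q"
      using N_cases conj_heis[OF x ab(1)] conj_heis[OF x ab(2)] unfolding Osc_conj by (metis snd_conv)
    obtain a1 a2 m b1 b2 n where pq: "p = (a1, a2, m)" "q = (b1, b2, n)" by (metis surj_pair)
    have E: "boost t *v w1 = of_int a1 *\<^sub>R w1 + of_int a2 *\<^sub>R w2"
      "boost t *v w2 = of_int b1 *\<^sub>R w1 + of_int b2 *\<^sub>R w2"
      using p q unfolding Osc_conj pq by (simp_all add: Osc_normal_form)
    define B :: "int^2^2" where "B = vector [vector [a1, b1], vector [a2, b2]]"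
    have "of_int (trace B) * omega w1 w2 = (exp t + exp (- t)) * omega w1 w2"
      using omega_trace_boost[of t w1 w2] unfolding E by (simp add: B_def trace_def sum_2 algebra_simps)
    moreover have "of_int (det B) * omega w1 w2 = omega w1 w2"
    proof -
      have "omega w1 w2 = omega (of_int a1 *\<^sub>R w1 + of_int a2 *\<^sub>R w2) (of_int b1 *\<^sub>R w1 + of_int b2 *\<^sub>R w2)"
        using omega_boost[of t w1 w2] unfolding E by simp
      also have "\<dots> = of_int (det B) * omega w1 w2"
        using omega_swap[of w2 w1] by (simp add: B_def det_2 algebra_simps)
      finally show ?thesis by simp
    qed
    ultimately have "of_int (trace B) = exp t + exp (- t)" "det B = 1"
      using w(3) by simp_all
    then show ?thesis
      using p q unfolding pq by (intro exI[of _ B] exI[of _ m] exI[of _ n]) (simp add: B_def)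
  qed
  \<comment> \<open>The traces are integers, so the times form a discrete subgroup.\<close>
  let ?T = "(\<lambda>x. snd (snd x)) ` L"
  obtain s where s: "s > 0" "s \<in> ?T" "\<And>t. t \<in> ?T \<Longrightarrow> \<exists>k::int. t = of_int k * s"
  proof (rule discrete_real_subgroup_cyclic[of ?T "ln 2" t0])
    show "x - y \<in> ?T" if xy: "x \<in> ?T" "y \<in> ?T" for x y
    proof -
      obtain g g' where g: "g \<in> L" "g' \<in> L" "x = snd (snd g)" "y = snd (snd g')" using xy by blast
      have "x - y = snd (snd (g \<cdot> oinv g'))"
        by (cases g; cases g') (simp add: g Osc_inv)
      then show ?thesis using g by (metis image_eqI inv_closed mult_closed)
    qed
    show "t = 0" if t: "t \<in> ?T" "\<bar>t\<bar> < ln 2" for t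
    proof -
      obtain z \<xi> where "(z, \<xi>, t) \<in> L" using t(1) by auto
      then obtain k where "exp t + exp (- t) = of_int k" using action by metis
      then show ?thesis using exp_trace_small[OF t(2)] by blast
    qed
    show "t0 \<in> ?T" using \<delta> by (force intro: image_eqI[of _ _ "(z0, 0, t0)"])
  qed (use t0 in auto)
  obtain zd \<xi>d where d: "(zd, \<xi>d, s) \<in> L" using s(2) by auto
  let ?d = "(zd, \<xi>d, s) :: osc"
  obtain B m n where da: "?d \<cdot> ?a \<cdot> oinv ?d = ?N (B$1$1, B$2$1, m)"
    and db: "?d \<cdot> ?b \<cdot> oinv ?d = ?N (B$1$2, B$2$2, n)"
    and B: "det (B::int^2^2) = 1" "of_int (trace B) = exp s + exp (- s)"
    using action[OF d] by metis
  have "trace B > 2" using exp_trace_gt_2[of s] s(1) B(2) by linarith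
  define l :: "int^2" where "l = vector [n, - m]"
  let ?E = "\<lambda>(p, n). ?N p \<cdot> ?d [^]\<^bsub>Osc\<^esub> (n::int)"
  have time: "snd (snd (?N p \<cdot> ?d [^]\<^bsub>Osc\<^esub> n)) = of_int n * s" for p n
  proof -
    have "snd (snd (?N p)) = 0" by (cases p) (simp add: Osc_normal_form)
    then show ?thesis
      using Osc_pow_time[of ?d n] by (cases "?N p"; cases "?d [^]\<^bsub>Osc\<^esub> n") simp
  qed
  have dn: "?d [^]\<^bsub>Osc\<^esub> n \<in> L" for n :: int
    using Osc.subgroup_int_pow_closed[OF L d] .
  have inj: "inj ?E"
  proof (rule injI)
    fix x y assume eq: "?E x = ?E y"
    obtain p n q m where xy: "x = (p, n)" "y = (q, m)" by (metis surj_pair)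
    have "of_int n * s = of_int m * s" using arg_cong[OF eq, of "\<lambda>x. snd (snd x)"] by (simp only: xy prod.case time)
    then have "n = m" using s(1) by simp
    then have "?N p = ?N q" using eq by (simp add: xy)
    then show "x = y" using N_inj \<open>n = m\<close> by (simp add: xy)
  qed
  have range: "range ?E = L"
  proof (intro equalityI subsetI)
    fix x assume "x \<in> range ?E"
    then obtain q where q: "x = ?E q" by blast
    show "x \<in> L" unfolding q case_prod_beta using N_closed dn by (rule mult_closed)
  next
    fix x assume x: "x \<in> L"
    then obtain n :: int where n: "snd (snd x) = of_int n * s" using s(3) by blast
    let ?y = "x \<cdot> oinv (?d [^]\<^bsub>Osc\<^esub> n)"
    have "?y \<in> L" using x dn by (intro mult_closed inv_closed)
    moreover have "snd (snd ?y) = 0"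
      using Osc_pow_time[of ?d n] n by (cases x; cases "?d [^]\<^bsub>Osc\<^esub> n") (simp add: Osc_inv)
    ultimately obtain p where "?y = ?N p" using N_cases by blast
    then have "x = ?N p \<cdot> ?d [^]\<^bsub>Osc\<^esub> n"
      by (metis Osc_assoc Osc.l_inv Osc_simps(1,3) Osc_zero_mult(2) UNIV_I)
    then show "x \<in> range ?E" by (intro image_eqI[of _ _ "(p, n)"]) simp_all
  qed
  have "Osc\<lparr>carrier := range ?E\<rparr> \<cong> disc_osc r B l"
  proof (rule disc_osc_recognition(2)[OF triple B(1) _ _ _ _ inj])
    show "?d \<cdot> ?a \<cdot> oinv ?d = ?N (B$1$1, B$2$1, - (l$2))"
      using da by (simp only: l_def vector_2 minus_minus)
    show "?d \<cdot> ?b \<cdot> oinv ?d = ?N (B$1$2, B$2$2, l$1)"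
      using db by (simp only: l_def vector_2)
    show "?d \<cdot> ?c \<cdot> oinv ?d = ?c"
      unfolding Osc_conj by simp
  qed simp
  then have "Osc\<lparr>carrier := L\<rparr> \<cong> disc_osc r B l" by (simp only: range)
  then show ?thesis using that r(1) B(1) \<open>trace B > 2\<close> by blast
qed

end

text \<open>This allows one to conjugate away the planar part of an element of non-zero time.\<close>

lemma boost_minus_id_surj:
  assumes "t \<noteq> 0"
  obtains \<eta> where "boost t *v \<eta> - \<eta> = \<xi>"
proof -
  have lin: "linear (\<lambda>\<eta>. boost t *v \<eta> - \<eta>)"
    by (intro linear_compose_sub matrix_vector_mul_linear linear_ident)
  have "inj (\<lambda>\<eta>. boost t *v \<eta> - \<eta>)"
    unfolding linear_injective_0[OF lin] using boost_fixpoint[OF assms] by simp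
  then have "surj (\<lambda>\<eta>. boost t *v \<eta> - \<eta>)"
    by (rule linear_inj_imp_surj[OF lin])
  from surjD[OF this, of \<xi>] obtain \<eta> where "\<xi> = boost t *v \<eta> - \<eta>" by blast
  then show ?thesis by (intro that[of \<eta>]) simp
qed

lemma recurrent_positive_time:
  assumes "recurrent L"
  obtains z \<xi> t where "(z, \<xi>, t) \<in> L" "t > 0"
proof -
  let ?V = "{x :: osc. \<bar>snd (snd x)\<bar> < 1 / 2}"
  have "open ?V" by (intro open_Collect_less continuous_intros)
  moreover have "(0, 0, 0) \<in> ?V" by simp
  ultimately obtain n :: nat and v w where n: "n > 0" and vw: "v \<in> ?V" "w \<in> ?V"
    and m: "v \<cdot> (0, 0, 1) [^]\<^bsub>Osc\<^esub> n \<cdot> oinv w \<in> L"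
    using assms unfolding recurrent_def by blast
  let ?x = "v \<cdot> (0, 0, 1) [^]\<^bsub>Osc\<^esub> n \<cdot> oinv w"
  have "snd (snd ((0, 0, 1) [^]\<^bsub>Osc\<^esub> n)) = real n"
    using Osc_pow_time[of "(0, 0, 1)" "int n"] by (simp add: int_pow_int)
  then have "snd (snd ?x) = snd (snd v) + real n - snd (snd w)"
    by (cases v; cases w; cases "(0, 0, 1) [^]\<^bsub>Osc\<^esub> n") (simp add: Osc_inv)
  moreover have "real n \<ge> 1" using n by simp
  ultimately have "snd (snd ?x) > 0" using vw by simp
  then show ?thesis using that[of "fst ?x" "fst (snd ?x)" "snd (snd ?x)"] m by simp
qed

theorem osc_lattice_is_disc_osc:
  assumes "osc_lattice L"
  obtains r B l where "r > 0" "det B = 1" "trace B > 2" "Osc\<lparr>carrier := L\<rparr> \<cong> disc_osc r B l"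
proof -
  have L: "subgroup L Osc" and disc: "discrete L" using assms by (simp_all add: osc_lattice_def)
  have rec: "recurrent L" by (rule osc_lattice_recurrent[OF assms])
  obtain z \<xi> t where \<delta>: "(z, \<xi>, t) \<in> L" and t: "t > 0" using recurrent_positive_time[OF rec] .
  obtain \<eta> where \<eta>: "boost t *v \<eta> - \<eta> = \<xi>" using boost_minus_id_surj[of t \<xi>] t by auto
  let ?h = "(0, \<eta>, 0) :: osc"
  let ?c = "\<lambda>x. ?h \<cdot> x \<cdot> oinv ?h"
  note L' = conj_iso_subgroup(1)[OF L, of ?h]
  obtain z' where c\<delta>: "?c (z, \<xi>, t) = (z', 0, t)"
    using \<eta> by (simp add: Osc_inv boost_minus algebra_simps)
  have one: "(0, 0, 0) \<in> L" using subgroup.one_closed[OF L] by simp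
  obtain T where T: "open T" "T \<inter> L = {(0, 0, 0)}"
    using discreteD[OF disc one] unfolding isolated_in_def by blast
  let ?T = "(\<lambda>y. oinv ?h \<cdot> y \<cdot> ?h) -` T"
  have "open ?T" using T(1) by (intro open_vimage continuous_intros)
  moreover have "(0 :: osc) \<in> ?T"
    using T(2) by (auto simp: zero_prod_def Osc_inv)
  ultimately obtain e where e: "e > 0" "ball 0 e \<subseteq> ?T" using open_contains_ball by blast
  have small: "y = 0" if y: "y \<in> ?c ` L" "norm y < e" for y
  proof -
    obtain x where x: "x \<in> L" "y = ?c x" using y(1) by blast
    have "y \<in> ?T" using e(2) y(2) by (auto simp: subset_iff)
    moreover have "oinv ?h \<cdot> y \<cdot> ?h = x"
      unfolding x(2) by (simp add: Osc_assoc del: Osc_simps(2)) (simp add: Osc_assoc[symmetric] del: Osc_simps(2))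
    ultimately have "x = (0, 0, 0)" using T(2) x(1) by auto
    then show ?thesis by (simp add: x(2) Osc_inv zero_prod_def)
  qed
  have iso: "Osc\<lparr>carrier := L\<rparr> \<cong> Osc\<lparr>carrier := ?c ` L\<rparr>"
    by (rule group.iso_sym[OF subgroup.subgroup_is_group[OF L' group_Osc] conj_iso_subgroup(2)[OF L]])
  have mem: "(z', 0, t) \<in> ?c ` L" using imageI[OF \<delta>, of ?c] unfolding c\<delta> .
  have "recurrent_discrete (?c ` L) z' t e"
  proof (rule recurrent_discrete.intro)
    show "y = 0" if "y \<in> ?c ` L" "norm y < e" for y using that by (rule small)
  qed (fact L' e(1) recurrent_conj[OF rec] t mem)+
  then interpret recurrent_discrete "?c ` L" z' t e .
  obtain r B l where *: "r > 0" "det B = 1" "trace B > 2" "Osc\<lparr>carrier := ?c ` L\<rparr> \<cong> disc_osc r B l"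
    using iso_disc_osc .
  then show ?thesis using that iso_trans[OF iso] by blast
qed

section \<open>Realisation of the discrete groups\<close>

lemma exp_trace_unique:
  assumes "T > 2"
  shows "\<exists>!s::real. s > 0 \<and> exp s + exp (- s) = T"
proof -
  have two: "exp s + exp (- s) = 2 * cosh s" for s :: real by (simp add: cosh_def)
  have T4: "T\<^sup>2 > 4" using power_strict_mono[of 2 T 2] assms by simp
  define q where "q = sqrt (T\<^sup>2 - 4)"
  have q: "q > 0" "q\<^sup>2 = T\<^sup>2 - 4" using T4 by (simp_all add: q_def)
  define y where "y = (T + q) / 2"
  have y: "y > 1" using q(1) assms by (simp add: y_def)
  have "y * ((T - q) / 2) = (T\<^sup>2 - q\<^sup>2) / 4"
    by (simp add: y_def power2_eq_square field_simps)
  also have "\<dots> = 1" using q(2) by simp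
  finally have inv: "inverse y = (T - q) / 2" by (rule inverse_unique)
  show ?thesis
  proof (rule ex1I[of _ "ln y"])
    show ln: "ln y > 0 \<and> exp (ln y) + exp (- ln y) = T"
      using y inv by (simp add: exp_minus) (simp add: y_def field_simps)
    fix s assume s: "s > 0 \<and> exp s + exp (- s) = T"
    then have eq: "cosh s = cosh (ln y)" using ln unfolding two by linarith
    have "s = arcosh (cosh s)" using s by (intro arcosh_cosh_real[symmetric]) simp
    also have "\<dots> = arcosh (cosh (ln y))" by (simp only: eq)
    also have "\<dots> = ln y" using ln by (intro arcosh_cosh_real) simp
    finally show "s = ln y" .
  qed
qed

text \<open>The rows of \<open>P\<close> are half the sum and half the difference of left eigenvectors of \<open>B\<close> for \<open>e\<^sup>s\<close> and \<open>e\<^sup>-\<^sup>s\<close>.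
They are independent because the lower left entry of \<open>B\<close> is non-zero: otherwise both diagonal entries
would be \<open>1\<close> or both \<open>- 1\<close>, against the trace.\<close>

lemma hyperbolic_conjugate:
  fixes B :: "int^2^2"
  assumes det: "det B = 1" and tr: "trace B > 2" and s: "s > 0" "exp s + exp (- s) = of_int (trace B)"
  obtains P where "invertible P" "real_mat B = matrix_inv P ** boost s ** P"
proof -
  have ad: "B$1$1 * B$2$2 - B$1$2 * B$2$1 = 1" using det by (simp add: det_2)
  have "B$2$1 \<noteq> 0"
  proof
    assume "B$2$1 = 0"
    then have "B$1$1 * B$2$2 = 1" using ad by simp
    then show False using tr by (auto simp: zmult_eq_1_iff trace_def sum_2)
  qed
  moreover have "sinh s \<noteq> 0" using s(1) by simp
  moreover define P :: "real^2^2" where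
    "P = vector [vector [of_int (B$2$1), cosh s - of_int (B$1$1)], vector [0, sinh s]]"
  ultimately have "det P \<noteq> 0" by (simp add: P_def det_2)
  then have P: "invertible P" by (simp add: invertible_det_nz)
  have d: "of_int (B$2$2) = 2 * cosh s - of_int (B$1$1)"
    using s(2) by (simp add: cosh_def trace_def sum_2 field_simps)
  have "of_int (B$1$1 * B$2$2 - B$1$2 * B$2$1) = (1::real)" unfolding ad by simp
  then have bc: "of_int (B$2$1) * of_int (B$1$2) = of_int (B$1$1) * (2 * cosh s - of_int (B$1$1)) - (1::real)"
    by (simp add: d algebra_simps)
  have "P ** real_mat B = boost s ** P"
    using bc cosh_square[of s]
    by (simp add: P_def boost_def vec_eq_iff forall_2 matrix_matrix_mult_def sum_2 d) (simp add: algebra_simps)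
  then have "real_mat B = matrix_inv P ** boost s ** P"
    using matrix_inv_cancel(2)[OF P] by (metis matrix_mul_assoc matrix_mul_lid)
  then show ?thesis using that P by blast
qed

lemma trace_det_conjugate:
  fixes P :: "real^2^2"
  assumes "invertible P"
  shows "det (matrix_inv P ** M ** P) = det M" "trace (matrix_inv P ** M ** P) = trace M"
proof -
  have "det P * det (matrix_inv P) = 1"
    using matrix_inv_cancel(1)[OF assms] by (metis det_I det_mul)
  then show "det (matrix_inv P ** M ** P) = det M" by (simp add: det_mul algebra_simps)
  show "trace (matrix_inv P ** M ** P) = trace M"
    by (metis assms matrix_inv_cancel(1) matrix_mul_assoc matrix_mul_lid trace_mul_sym)
qed

theorem lattice_iso_disc_osc:
  assumes r: "r > 0" and s: "s > 0" and P: "(\<eta>, P, z, \<xi>) \<in> P_set r s"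
  obtains B :: "int^2^2" and l :: "int^2" where
    "real_mat B = matrix_inv P ** mat_exp (s *\<^sub>R A_mat) ** P" "det B = 1" "trace B > 2"
    "real_vec l = real r *\<^sub>R (matrix_inv (real_mat B) *v \<xi>) + (real r / 2) *\<^sub>R corr_vec (real_mat B)"
    "osc_lattice (L_lat r s \<eta> P z \<xi>)" "Osc\<lparr>carrier := L_lat r s \<eta> P z \<xi>\<rparr> \<cong> disc_osc r B l"
proof -
  let ?B = "matrix_inv P ** boost s ** P"
  have inv: "invertible P" and B_set: "(\<xi>, ?B) \<in> B_set r"
    using P by (simp_all add: P_set_def mat_exp_A_mat)
  have det: "det ?B = 1" using trace_det_conjugate(1)[OF inv] by (simp add: det_boost)
  obtain B l where B: "real_mat B = ?B"
    and l: "real_vec l = real r *\<^sub>R (matrix_inv ?B *v \<xi>) + (real r / 2) *\<^sub>R corr_vec ?B"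
    using B_set_imp_integral[OF r det B_set] .
  have det_B: "det B = 1" using real_mat_det[of B] det B by simp
  have "real_of_int (trace B) = exp s + exp (- s)"
    using real_mat_trace[of B] trace_det_conjugate(2)[OF inv, of "boost s"] B by (simp add: trace_boost)
  then have tr: "trace B > 2" using exp_trace_gt_2[of s] s by linarith
  interpret lattice_data r s P z \<xi> B l
    by unfold_locales (use r s inv B det_B l in simp_all)
  show ?thesis
    by (rule that[OF _ det_B tr _ L_lat_lattice L_lat_iso]) (simp_all add: mat_exp_A_mat B l)
qed

text \<open>The formula for \<open>\<xi>\<close> is the formula for \<open>l\<close> in the locale \<open>lattice_data\<close>, solved for \<open>\<xi>\<close>.\<close>

theorem disc_osc_realisation:
  fixes B :: "int^2^2"
  assumes r: "r > 0" and det: "det B = 1" and s: "s > 0" "exp s + exp (- s) = real_of_int (trace B)"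
    and P: "invertible P" "real_mat B = matrix_inv P ** mat_exp (s *\<^sub>R A_mat) ** P"
    and \<xi>: "\<xi> = (1 / real r) *\<^sub>R (real_mat B *v real_vec l) - (1 / 2) *\<^sub>R (real_mat B *v corr_vec (real_mat B))"
  shows "s \<in> S_set" "(\<eta>, P, z, \<xi>) \<in> P_set r s" "osc_lattice (L_lat r s \<eta> P z \<xi>)"
    "Osc\<lparr>carrier := L_lat r s \<eta> P z \<xi>\<rparr> \<cong> disc_osc r B l"
proof -
  have "invertible (real_mat B)" using det by (intro invertible_det_1) simp
  then have "matrix_inv (real_mat B) *v \<xi> = (1 / real r) *\<^sub>R real_vec l - (1 / 2) *\<^sub>R corr_vec (real_mat B)"
    unfolding \<xi> by (simp add: matrix_vector_mult_diff_distrib matrix_vector_mult_scaleR matrix_inv_vec_cancel)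
  then have l: "real_vec l = real r *\<^sub>R (matrix_inv (real_mat B) *v \<xi>) + (real r / 2) *\<^sub>R corr_vec (real_mat B)"
    using r by (simp add: scaleR_diff_right)
  have "(0::real) < exp s + exp (- s)" by (intro add_pos_pos) simp_all
  then have "exp s + exp (- s) = real (nat (trace B))" using s(2) by simp
  then show "s \<in> S_set" using s(1) by (simp add: S_set_def)
  show "(\<eta>, P, z, \<xi>) \<in> P_set r s"
    using P integral_imp_B_set[OF r det l] by (simp add: P_set_def)
  interpret lattice_data r s P z \<xi> B l
    by unfold_locales (use r s P det l in \<open>simp_all add: mat_exp_A_mat\<close>)
  show "osc_lattice (L_lat r s \<eta> P z \<xi>)" "Osc\<lparr>carrier := L_lat r s \<eta> P z \<xi>\<rparr> \<cong> disc_osc r B l"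
    by (rule L_lat_lattice L_lat_iso)+
qed

theorem disc_osc_lattice:
  fixes B :: "int^2^2"
  assumes "r > 0" "det B = 1" "trace B > 2"
  shows "\<exists>L. osc_lattice L \<and> Osc\<lparr>carrier := L\<rparr> \<cong> disc_osc r B l"
proof -
  obtain s :: real where s: "s > 0" "exp s + exp (- s) = of_int (trace B)"
    using exp_trace_unique[of "of_int (trace B)"] assms(3) by auto
  obtain P where P: "invertible P" "real_mat B = matrix_inv P ** boost s ** P"
    using hyperbolic_conjugate[OF assms(2,3) s] .
  show ?thesis
    using disc_osc_realisation(3,4)[OF assms(1,2) s P[folded mat_exp_A_mat] HOL.refl] by blast
qed

theorem corollary7p2:
  shows
    "(\<forall>(r::nat) s \<eta> P z \<xi>.
        r > 0 \<longrightarrow> s \<in> S_set \<longrightarrow> (\<eta>, P, z, \<xi>) \<in> P_set r s \<longrightarrow>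
        osc_lattice (L_lat r s \<eta> P z \<xi>) \<and>
        (\<exists>(B :: int^2^2) (l :: int^2).
           real_mat B = matrix_inv P ** mat_exp (s *\<^sub>R A_mat) ** P \<and>
           det B = 1 \<and> trace B > 2 \<and>
           real_vec l = real r *\<^sub>R (matrix_inv (real_mat B) *v \<xi>)
                        + (real r / 2) *\<^sub>R corr_vec (real_mat B) \<and>
           Osc\<lparr>carrier := L_lat r s \<eta> P z \<xi>\<rparr> \<cong> disc_osc r B l)) \<and>
     (\<forall>L. osc_lattice L \<longrightarrow>
        (\<exists>D :: (heis_gen word set \<times> int) monoid.
           discrete_split_oscillator_group D \<and> Osc\<lparr>carrier := L\<rparr> \<cong> D)) \<and>
     (\<forall>D :: ('a \<times> int) monoid. discrete_split_oscillator_group D \<longrightarrow>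
        (\<exists>L. osc_lattice L \<and> Osc\<lparr>carrier := L\<rparr> \<cong> D)) \<and>
     (\<forall>(r::nat) (B :: int^2^2) (l :: int^2).
        r > 0 \<longrightarrow> det B = 1 \<longrightarrow> trace B > 2 \<longrightarrow>
        (\<exists>!s::real. s > 0 \<and> exp s + exp (- s) = real_of_int (trace B)) \<and>
        (\<forall>s::real. s > 0 \<longrightarrow> exp s + exp (- s) = real_of_int (trace B) \<longrightarrow>
           (\<exists>P. invertible P \<and> real_mat B = matrix_inv P ** mat_exp (s *\<^sub>R A_mat) ** P) \<and>
           (\<forall>P \<xi>. invertible P \<longrightarrow>
              real_mat B = matrix_inv P ** mat_exp (s *\<^sub>R A_mat) ** P \<longrightarrow>
              \<xi> = (1 / real r) *\<^sub>R (real_mat B *v real_vec l)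
                  - (1 / 2) *\<^sub>R (real_mat B *v corr_vec (real_mat B)) \<longrightarrow>
              s \<in> S_set \<and> (0, P, 0, \<xi>) \<in> P_set r s \<and>
              osc_lattice (L_lat r s 0 P 0 \<xi>) \<and>
              Osc\<lparr>carrier := L_lat r s 0 P 0 \<xi>\<rparr> \<cong> disc_osc r B l)))"
proof (intro conjI allI impI)
  fix r :: nat and s \<eta> P z \<xi>
  assume r: "r > 0" and s: "s \<in> S_set" and P: "(\<eta>, P, z, \<xi>) \<in> P_set r s"
  have "s > 0" using s by (simp add: S_set_def)
  from lattice_iso_disc_osc[OF r this P] obtain B :: "int^2^2" and l :: "int^2" where
    *: "real_mat B = matrix_inv P ** mat_exp (s *\<^sub>R A_mat) ** P" "det B = 1" "trace B > 2"
      "real_vec l = real r *\<^sub>R (matrix_inv (real_mat B) *v \<xi>) + (real r / 2) *\<^sub>R corr_vec (real_mat B)"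
      "osc_lattice (L_lat r s \<eta> P z \<xi>)" "Osc\<lparr>carrier := L_lat r s \<eta> P z \<xi>\<rparr> \<cong> disc_osc r B l" .
  show "osc_lattice (L_lat r s \<eta> P z \<xi>)" by (rule *(5))
  show "\<exists>(B :: int^2^2) (l :: int^2).
       real_mat B = matrix_inv P ** mat_exp (s *\<^sub>R A_mat) ** P \<and>
       det B = 1 \<and> trace B > 2 \<and>
       real_vec l = real r *\<^sub>R (matrix_inv (real_mat B) *v \<xi>) + (real r / 2) *\<^sub>R corr_vec (real_mat B) \<and>
       Osc\<lparr>carrier := L_lat r s \<eta> P z \<xi>\<rparr> \<cong> disc_osc r B l"
    by (intro exI[of _ B] exI[of _ l] conjI *)
next
  fix L assume "osc_lattice L"
  then obtain r B l where "r > 0" "det B = 1" "trace B > 2" "Osc\<lparr>carrier := L\<rparr> \<cong> disc_osc r B l"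
    by (rule osc_lattice_is_disc_osc)
  then show "\<exists>D :: (heis_gen word set \<times> int) monoid.
      discrete_split_oscillator_group D \<and> Osc\<lparr>carrier := L\<rparr> \<cong> D"
    using disc_osc_discrete_split by blast
next
  fix D :: "('a \<times> int) monoid" assume "discrete_split_oscillator_group D"
  then obtain r B l where D: "r > 0" "det B = 1" "trace B > 2" "D \<cong> disc_osc r B l" "group D"
    by (rule discrete_split_is_disc_osc)
  from disc_osc_lattice[OF D(1-3)] obtain L where "osc_lattice L" "Osc\<lparr>carrier := L\<rparr> \<cong> disc_osc r B l"
    by blast
  then show "\<exists>L. osc_lattice L \<and> Osc\<lparr>carrier := L\<rparr> \<cong> D"
    using group.iso_sym[OF D(5,4)] iso_trans by blast
next
  fix r :: nat and B :: "int^2^2" and l :: "int^2"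
  assume r: "r > 0" and det: "det B = 1" and tr: "trace B > 2"
  show "\<exists>!s::real. s > 0 \<and> exp s + exp (- s) = real_of_int (trace B)"
    using tr by (intro exp_trace_unique) simp
  fix s :: real assume s: "s > 0" "exp s + exp (- s) = real_of_int (trace B)"
  show "\<exists>P. invertible P \<and> real_mat B = matrix_inv P ** mat_exp (s *\<^sub>R A_mat) ** P"
    using hyperbolic_conjugate[OF det tr s] unfolding mat_exp_A_mat by metis
  fix P \<xi>
  assume P: "invertible P" "real_mat B = matrix_inv P ** mat_exp (s *\<^sub>R A_mat) ** P"
    and \<xi>: "\<xi> = (1 / real r) *\<^sub>R (real_mat B *v real_vec l) - (1 / 2) *\<^sub>R (real_mat B *v corr_vec (real_mat B))"
  note * = disc_osc_realisation[OF r det s P \<xi>]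
  show "s \<in> S_set" "(0, P, 0, \<xi>) \<in> P_set r s" "osc_lattice (L_lat r s 0 P 0 \<xi>)"
    "Osc\<lparr>carrier := L_lat r s 0 P 0 \<xi>\<rparr> \<cong> disc_osc r B l"
    by (rule *)+
qed

end
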